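(* Let $\eta$ be a positive real function on $[2,\infty)$ and let $\mathcal{A}=\{a_n\}_{n\ge1}$ be a strictly increasing sequence of positive integers such that, for some constants $K_1,\dots,K_4>0$ and all $x\ge 2$: $K_1 x/\eta(x)\le\mathcal{A}(x)\le K_2 x/\eta(x)$, $\mathcal{A}(x/2)\ge K_3\mathcal{A}(x)$, and $\mathcal{A}(x,r)\le K_4\frac{r}{\varphi(r)}\frac{x}{\eta(x)^2}$ for every positive integer $r$. Let $f(n)=\gamma_d n^d+\dots+\gamma_0$ be a polynomial with integer coefficients, $\gamma_d>0$, and $f(\mathbb{N})\subseteq\mathbb{N}$. Let $r(n)=\#\{(k,s)\in\mathbb{N}\times\mathcal{S}: a_k+f(s)=n\}$. Then there exist positive constants $x_0,c_1,c_2$ depending only on $f$ and $K_1,\dots,K_4$ such that for all $x\ge x_0$, \[ \#\Big\{n\le x: r(n)\ge c_1\frac{x^{1/d}}{\eta(x)(\log x)^{1/2}}\Big\}\ge c_2\,x\,\frac{x^{1/d}}{x^{1/d}+\eta(x)(\log x)^{1/2}}. \]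
   Context: $\mathcal{S}$ is the set of positive integers representable as a sum of two squares. $\mathcal{A}(x)=\#\{n: a_n\le x\}$, $\mathcal{A}(x,r)=\#\{n: a_n\le x,\ a_n+r\in\mathcal{A}\}$; $\varphi$ is Euler's totient function. *)

theory Defs
  imports Complex_Main
    "HOL-Computational_Algebra.Polynomial"
    "HOL-Number_Theory.Totient"
begin

text \<open>A sequence \<open>a\<^sub>1 < a\<^sub>2 < \<dots>\<close> is encoded as a function on \<^typ>\<open>nat\<close> whose value at \<open>0\<close> is
  ignored. Accordingly, \<open>\<nat>\<close> in the mathematical text is the set of positive integers.\<close>

definition pos_int_seq :: "(nat \<Rightarrow> nat) \<Rightarrow> bool" where
  "pos_int_seq a \<longleftrightarrow> strict_mono_on {1..} a \<and> (\<forall>n\<ge>1. a n > 0)"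

definition seq_count :: "(nat \<Rightarrow> nat) \<Rightarrow> real \<Rightarrow> nat" where
  "seq_count a x = card {n. n \<ge> 1 \<and> real (a n) \<le> x}"

definition seq_pair_count :: "(nat \<Rightarrow> nat) \<Rightarrow> real \<Rightarrow> nat \<Rightarrow> nat" where
  "seq_pair_count a x r = card {n. n \<ge> 1 \<and> real (a n) \<le> x \<and> a n + r \<in> a ` {1..}}"

definition sums_of_two_squares :: "nat set" where
  "sums_of_two_squares = {n. n > 0 \<and> (\<exists>u v :: nat. n = u\<^sup>2 + v\<^sup>2)}"

text \<open>For nonconstant \<open>f\<close> that is positive on the positive integers, the set counted here is
  finite, so that \<^const>\<open>card\<close> is the true cardinality.\<close>

definition rep_count :: "(nat \<Rightarrow> nat) \<Rightarrow> int poly \<Rightarrow> nat \<Rightarrow> nat" where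
  "rep_count a f n =
     card {(k, s). k \<ge> 1 \<and> s \<in> sums_of_two_squares \<and> int (a k) + poly f (int s) = int n}"

end

theory Submission
  imports Defs "HOL-Analysis.Analysis" "HOL-Number_Theory.Number_Theory"
begin

text \<open>
  Second moment method, applied to a convenient subset \<open>T\<close> of the sums of two squares. By
  Cauchy-Schwarz the number of \<open>n\<close> with many representations \<open>a\<^sub>k + f(s) = n\<close>, \<open>s \<in> T\<close>, is large once
  the sum of \<open>r / \<phi>(r)\<close> over the differences \<open>r = f(t) - f(s)\<close>, \<open>s < t\<close> in \<open>T\<close>, is \<open>O(|T|\<^sup>2)\<close>.

  The set \<open>T\<close> consists of the products \<open>q m \<in> {N\<^sup>2<..K N\<^sup>2}\<close> with \<open>q\<close> a prime congruent to 1 modulo 4 and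
  \<open>m \<le> N\<close> composed of such primes. The prime \<open>q\<close> replaces a sieve: an elementary factorial argument
  gives \<open>O((ln p / p) |T|)\<close> elements of \<open>T\<close> in each class modulo a prime \<open>p \<le> N\<close>. Since
  \<open>r / \<phi>(r) = O(1 + \<Sum>p | r. p powr (-1/2))\<close>, which follows from Jensen's inequality, and the terms with
  \<open>p > N\<close> are negligible, equidistribution to prime moduli is all that is needed. The lower bound
  \<open>|T| \<ge> c N\<^sup>2 / sqrt (ln N)\<close> combines Mertens' theorem modulo 4 with a lower bound for \<open>\<Sum>1/m\<close>, obtained by
  comparing the average of \<open>\<Sum>d | n. \<chi>(d)\<close> with the square of that sum.
\<close>

subsection \<open>Chebyshev and Mertens estimates\<close>

text \<open>The second moment has a diagonal part of order x |T| / eta and, by the pair hypothesis,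
  an off-diagonal part of order x |T|^2 / eta^2. Cauchy-Schwarz therefore yields about x |T| / (eta
  + |T|) values, and |T| of order x^(1/d) / sqrt (ln x) gives the shape of the final bound.
  \<open>T\<close> is built from \<open>f\<close> and \<open>x\<close> alone, which keeps the
  constants uniform in the sequence. The obstacle is an upper bound in residue classes with the
  correct factor 1 / sqrt (ln x). In a product q m with m <= N < q the pair (q, m) is determined by
  the product, so counts over \<open>T\<close> are sums over m of counts of primes, and Chebyshev's
  method reaches those. It loses a factor ln p, absorbed by the weight p powr (-1/2). The scale N^2
  leaves q a range reaching at least N for every m <= N, so moduli up to N can be handled. The class
  bounds and the lower bound for |T| carry the same sum of 1/m, which cancels in their
  ratio.\<close>

lemma of_nat_div_ge: "real N / real d - 1 \<le> real (N div d)"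
  using floor_divide_of_nat_eq[of N d, where ?'a = real] by linarith

text \<open>The bijection (n, d) -> (d, n div d) onto the lattice points with d e <= N. Every
  convolution with \<open>mangoldt\<close> or \<open>chi4\<close> below is summed through
  it.\<close>

lemma sum_divisors_swap:
  fixes h :: "nat \<Rightarrow> nat \<Rightarrow> 'a::comm_monoid_add"
  shows "(\<Sum>n=1..N. \<Sum>d | d dvd n. h d (n div d)) = (\<Sum>d=1..N. \<Sum>e=1..N div d. h d e)"
proof -
  have "(\<Sum>n=1..N. \<Sum>d | d dvd n. h d (n div d))
      = (\<Sum>(n,d)\<in>(SIGMA n:{1..N}. {d. d dvd n}). h d (n div d))"
    by (rule sum.Sigma) auto
  also have "\<dots> = (\<Sum>(d,e)\<in>(SIGMA d:{1..N}. {1..N div d}). h d e)"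
  proof (rule sum.reindex_bij_witness[where j = "\<lambda>(n,d). (d, n div d)" and i = "\<lambda>(d,e). (d*e, d)"])
    fix b assume "b \<in> (SIGMA d:{1..N}. {1..N div d})"
    then show "(case b of (d,e) \<Rightarrow> (d*e,d)) \<in> (SIGMA n:{1..N}. {d. d dvd n})"
      by (auto simp: less_eq_div_iff_mult_less_eq mult.commute)
  next
    fix b assume "b \<in> (SIGMA n:{1..N}. {d. d dvd n})"
    then show "(case b of (n,d) \<Rightarrow> (d, n div d)) \<in> (SIGMA d:{1..N}. {1..N div d})"
      by (auto simp: div_le_mono dvd_imp_le div_greater_zero_iff Suc_le_eq dvd_pos_nat
          intro: order_trans[OF dvd_imp_le])
  qed auto
  also have "\<dots> = (\<Sum>d=1..N. \<Sum>e=1..N div d. h d e)"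
    by (rule sum.Sigma[symmetric]) auto
  finally show ?thesis .
qed

text \<open>Legendre's formula for N!, in the form ln = mangoldt convolved with 1.\<close>

lemma ln_fact_eq_sum_mangoldt:
  "ln (fact N) = (\<Sum>d=1..N. mangoldt d * real (N div d))"
proof -
  have "ln (fact N :: real) = (\<Sum>n=1..N. ln (real n))"
    by (induction N) (auto simp: ln_mult simp flip: of_nat_Suc)
  also have "\<dots> = (\<Sum>n=1..N. \<Sum>d | d dvd n. mangoldt d)"
    by (intro sum.cong refl, subst mangoldt_sum) auto
  also have "\<dots> = (\<Sum>d=1..N. \<Sum>e=1..N div d. mangoldt d)"
    by (rule sum_divisors_swap)
  finally show ?thesis by (simp add: mult.commute)
qed

definition cheb_psi :: "nat \<Rightarrow> real" where
  "cheb_psi N = (\<Sum>d=1..N. mangoldt d)"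

text \<open>Chebyshev's argument: ln (2n choose n) is a combination of the \<open>mangoldt d\<close>
  with weights (2n div d) - 2 (n div d), which are nonnegative and equal 1 for n < d <= 2n; the
  binomial is at most 4^n and ln 4 <= 2.\<close>

lemma cheb_psi_double: "cheb_psi (2 * n) \<le> cheb_psi n + 2 * real n"
proof -
  have eq: "cheb_psi (2 * n) = cheb_psi n + (\<Sum>d\<in>{n<..2*n}. mangoldt d)"
    unfolding cheb_psi_def by (subst sum.union_disjoint[symmetric]) (auto intro!: sum.cong)
  have "(\<Sum>d\<in>{n<..2*n}. mangoldt d :: real)
      \<le> (\<Sum>d=1..2*n. mangoldt d * (real (2 * n div d) - 2 * real (n div d)))"
  proof -
    have "(\<Sum>d\<in>{n<..2*n}. mangoldt d :: real)
        = (\<Sum>d\<in>{n<..2*n}. mangoldt d * (real (2 * n div d) - 2 * real (n div d)))"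
    proof (intro sum.cong refl)
      fix d assume d: "d \<in> {n<..2*n}"
      then have "2 * n div d = 1" by (intro div_nat_eqI) auto
      with d show "mangoldt d = (mangoldt d * (real (2*n div d) - 2 * real (n div d)) :: real)" by simp
    qed
    also have "\<dots> \<le> (\<Sum>d=1..2*n. mangoldt d * (real (2 * n div d) - 2 * real (n div d)))"
    proof (intro sum_mono2)
      fix d assume "d \<in> {1..2*n} - {n<..2*n}"
      have "2 * (n div d) \<le> 2 * n div d"
        by (metis div_mult2_eq div_times_less_eq_dividend dvd_div_mult2_eq le_refl
            less_eq_div_iff_mult_less_eq mult.commute mult.left_commute mult_le_mono2 neq0_conv div_by_0)
      then have "2 * real (n div d) \<le> real (2 * n div d)" by linarith
      then show "0 \<le> (mangoldt d * (real (2 * n div d) - 2 * real (n div d)) :: real)"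
        by (intro mult_nonneg_nonneg mangoldt_nonneg) linarith
    qed auto
    finally show ?thesis .
  qed
  also have "\<dots> = ln (fact (2 * n)) - 2 * ln (fact n)"
  proof -
    have "(\<Sum>d=1..2*n. mangoldt d * (2 * real (n div d))) = (\<Sum>d=1..n. mangoldt d * (2 * real (n div d)))"
      by (rule sum.mono_neutral_right) auto
    then show ?thesis
      unfolding ln_fact_eq_sum_mangoldt
      by (simp add: right_diff_distrib sum_subtractf sum_distrib_left mult.left_commute)
  qed
  also have "\<dots> = ln (real (2 * n choose n))"
  proof -
    have "real (2 * n choose n) = fact (2*n) / (fact n * fact n)"
      by (subst binomial_fact) auto
    then show ?thesis by (simp add: ln_div ln_mult)
  qed
  also have "\<dots> \<le> ln (4 ^ n)"
  proof -
    have "2 * n choose n \<le> 2 ^ (2 * n)" by (rule binomial_le_pow2)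
    then have "real (2 * n choose n) \<le> 4 ^ n"
      by (metis (mono_tags) numeral_power_eq_of_nat_cancel_iff of_nat_le_iff of_nat_numeral of_nat_power
          power2_eq_square power_mult four_x_squared numeral_times_numeral semiring_norm(12) semiring_norm(13))
    then show ?thesis by (subst ln_le_cancel_iff) auto
  qed
  also have "\<dots> = real n * (2 * ln 2)"
    using ln_realpow[of 4 n] ln_realpow[of "2::real" 2] by simp
  also have "\<dots> \<le> real n * (2 * 1)"
    using ln_le_minus_one[of "2::real"] by (intro mult_left_mono) auto
  finally show ?thesis using eq by simp
qed

text \<open>By halving: 4n + 2n = 6n leaves 2n of room below 8n, enough for the single extra term
  when N = 2n + 1.\<close>

lemma cheb_psi_le: "cheb_psi N \<le> 4 * real N"
proof (induction N rule: less_induct)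
  case (less N)
  show ?case
  proof (cases "N \<le> 1")
    case True
    then have "N = 0 \<or> N = 1" by auto
    then show ?thesis by (auto simp: cheb_psi_def)
  next
    case False
    define n where "n = N div 2"
    have n: "n < N" "N = 2 * n \<or> N = Suc (2 * n)" using False by (auto simp: n_def)
    have *: "cheb_psi (2 * n) \<le> 6 * real n"
      using cheb_psi_double[of n] less[OF n(1)] by simp
    from n(2) show ?thesis
    proof
      assume "N = 2 * n"
      then show ?thesis using * by simp
    next
      assume N: "N = Suc (2 * n)"
      have "mangoldt N \<le> ln (real N)" using N by (intro mangoldt_le) auto
      also have "\<dots> \<le> real N - 1" using N by (intro ln_le_minus_one) auto
      finally have "mangoldt N \<le> 2 * real n" using N by simp
      moreover have "cheb_psi N = cheb_psi (2 * n) + mangoldt N"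
        unfolding cheb_psi_def N by simp
      ultimately show ?thesis using * N by simp
    qed
  qed
qed

text \<open>Both bounds compare two evaluations of ln N!. Replacing N div d by N / d costs at most
  \<open>cheb_psi N\<close>, whence the 4; the 1 comes from ln N! >= N ln N - N.\<close>

lemma mertens_mangoldt:
  assumes "N \<ge> 1"
  shows "(\<Sum>d=1..N. mangoldt d / real d) \<le> ln (real N) + 4"
    and "(\<Sum>d=1..N. mangoldt d / real d) \<ge> ln (real N) - 1"
proof -
  let ?S = "\<Sum>d=1..N. mangoldt d / real d :: real"
  have "ln (fact N) \<le> real N * ln (real N)"
  proof -
    have "ln (fact N :: real) \<le> ln (real N ^ N)"
      using fact_le_power[of N, where ?'a = real] assms by (subst ln_le_cancel_iff) auto
    then show ?thesis using assms by (simp add: ln_realpow)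
  qed
  moreover have "ln (fact N) \<ge> real N * ln (real N) - real N"
    using assms
  proof (induction N rule: dec_induct)
    case (step n)
    have "real (Suc n) = real n * (1 + 1 / real n)" using step by (simp add: field_simps)
    then have "ln (real (Suc n)) = ln (real n) + ln (1 + 1 / real n)"
      using step by (simp add: ln_mult_pos add_pos_nonneg del: of_nat_Suc)
    then have "ln (real (Suc n)) - ln (real n) = ln (1 + 1 / real n)" by simp
    also have "\<dots> \<le> 1 / real n" by (intro ln_add_one_self_le_self) auto
    finally have "real n * (ln (real (Suc n)) - ln (real n)) \<le> real n * (1 / real n)"
      by (intro mult_left_mono) auto
    then have "real n * (ln (real (Suc n)) - ln (real n)) \<le> 1" using step by simp
    moreover have "ln (fact (Suc n) :: real) = ln (real (Suc n)) + ln (fact n)"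
      by (simp add: ln_mult del: of_nat_Suc)
    ultimately show ?case using step.IH by (simp add: algebra_simps)
  qed simp
  moreover have "ln (fact N) \<le> real N * ?S"
  proof -
    have "mangoldt d * real (N div d) \<le> real N * (mangoldt d / real d)" for d
      using mult_left_mono[OF of_nat_div_le_of_nat[of N d] mangoldt_nonneg[of d]] by (simp add: mult.commute)
    then show ?thesis unfolding ln_fact_eq_sum_mangoldt sum_distrib_left by (intro sum_mono) auto
  qed
  moreover have "ln (fact N) \<ge> real N * ?S - cheb_psi N"
  proof -
    have "real N * (mangoldt d / real d) - mangoldt d \<le> mangoldt d * real (N div d)" for d
    proof -
      have "real N / real d - 1 \<le> real (N div d)" using of_nat_div_ge[of N d] by simp
      from mult_left_mono[OF this mangoldt_nonneg[of d]] show ?thesis by (simp add: algebra_simps)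
    qed
    then show ?thesis unfolding ln_fact_eq_sum_mangoldt sum_distrib_left cheb_psi_def sum_subtractf[symmetric]
      by (intro sum_mono) auto
  qed
  ultimately have "real N * ?S \<le> real N * (ln (real N) + 4)" "real N * ?S \<ge> real N * (ln (real N) - 1)"
    using cheb_psi_le[of N] by (auto simp: algebra_simps)
  then show "?S \<le> ln (real N) + 4" "?S \<ge> ln (real N) - 1" using assms by auto
qed

subsection \<open>The non-principal character modulo 4\<close>

definition chi4 :: "nat \<Rightarrow> real" where
  "chi4 n = (if n mod 4 = 1 then 1 else if n mod 4 = 3 then -1 else 0)"

lemma chi4_mult: "chi4 (m * n) = chi4 m * chi4 n"
proof -
  have "m mod 4 \<in> {0,1,2,3}" "n mod 4 \<in> {0,1,2,3}" by auto
  moreover have "m * n mod 4 = (m mod 4) * (n mod 4) mod 4" by (simp add: mod_mult_eq)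
  ultimately show ?thesis unfolding chi4_def by auto
qed

lemma abs_chi4_le: "\<bar>chi4 n\<bar> \<le> 1"
  by (auto simp: chi4_def)

text \<open>Alternating series with decreasing terms: the residue of the starting point decides the
  sign of the first nonzero term. Both cases are carried together because the induction moves the
  starting point.\<close>

lemma chi4_sum_bounds:
  fixes g :: "nat \<Rightarrow> real"
  assumes "\<And>n. n \<ge> a \<Longrightarrow> g (Suc n) \<le> g n" "\<And>n. n \<ge> a \<Longrightarrow> g n \<ge> 0"
  shows "if a mod 4 \<in> {0,1} then 0 \<le> (\<Sum>n\<in>{a..<a+k}. chi4 n * g n) \<and> (\<Sum>n\<in>{a..<a+k}. chi4 n * g n) \<le> g a
     else -g a \<le> (\<Sum>n\<in>{a..<a+k}. chi4 n * g n) \<and> (\<Sum>n\<in>{a..<a+k}. chi4 n * g n) \<le> 0"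
  using assms
proof (induction k arbitrary: a)
  case 0
  then show ?case by simp
next
  case (Suc k)
  have *: "(\<Sum>n\<in>{a..<a + Suc k}. chi4 n * g n) = chi4 a * g a + (\<Sum>n\<in>{Suc a..<Suc a + k}. chi4 n * g n)"
    by (subst sum.atLeast_Suc_lessThan) auto
  have le: "g (Suc a) \<le> g a" "g a \<ge> 0" using Suc.prems by auto
  have IH: "if Suc a mod 4 \<in> {0,1} then 0 \<le> (\<Sum>n\<in>{Suc a..<Suc a+k}. chi4 n * g n) \<and> (\<Sum>n\<in>{Suc a..<Suc a+k}. chi4 n * g n) \<le> g (Suc a)
     else -g (Suc a) \<le> (\<Sum>n\<in>{Suc a..<Suc a+k}. chi4 n * g n) \<and> (\<Sum>n\<in>{Suc a..<Suc a+k}. chi4 n * g n) \<le> 0"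
    using Suc.prems by (intro Suc.IH) auto
  have "a mod 4 = 0 \<or> a mod 4 = 1 \<or> a mod 4 = 2 \<or> a mod 4 = 3" by auto
  then consider "a mod 4 = 0" "Suc a mod 4 = 1" | "a mod 4 = 1" "Suc a mod 4 = 2"
    | "a mod 4 = 2" "Suc a mod 4 = 3" | "a mod 4 = 3" "Suc a mod 4 = 0"
    by (auto simp: mod_Suc)
  then show ?case
    unfolding * using IH le by cases (auto simp: chi4_def)
qed

lemma abs_chi4_sum_le:
  fixes g :: "nat \<Rightarrow> real"
  assumes "\<And>n. n \<ge> a \<Longrightarrow> g (Suc n) \<le> g n" "\<And>n. n \<ge> a \<Longrightarrow> g n \<ge> 0"
  shows "\<bar>\<Sum>n\<in>{a..<a+k}. chi4 n * g n\<bar> \<le> g a"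
  using chi4_sum_bounds[of a g k] assms by (auto simp: abs_le_iff split: if_splits)

definition chi4_harm :: "nat \<Rightarrow> real" where
  "chi4_harm N = (\<Sum>n=1..N. chi4 n / real n)"

text \<open>Partial sums of the Leibniz series: 1 - 1/3 = 2/3, and the part from 4 on is
  nonnegative. This is the quantitative nonvanishing of L(1, chi) on which the results modulo 4
  rest.\<close>

lemma chi4_harm_ge:
  assumes "N \<ge> 1"
  shows "chi4_harm N \<ge> 2/3"
proof (cases "N \<ge> 3")
  case True
  define k where "k = N - 3"
  have N: "N = 3 + k" using True by (simp add: k_def)
  have "chi4_harm N = (\<Sum>n=1..3. chi4 n / real n) + (\<Sum>n\<in>{4..<4+k}. chi4 n / real n)"
    unfolding chi4_harm_def N by (subst sum.union_disjoint[symmetric]) (auto intro!: sum.cong)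
  moreover have "(\<Sum>n=1..3. chi4 n / real n) = 2/3"
  proof -
    have "{1..3::nat} = {1,2,3}" by auto
    then show ?thesis by (simp add: chi4_def)
  qed
  moreover have "(\<Sum>n\<in>{4..<4+k}. chi4 n / real n) \<ge> 0"
    using chi4_sum_bounds[of 4 "\<lambda>n. 1 / real n" k] by (auto simp: field_simps)
  ultimately show ?thesis by simp
next
  case False
  then have "N = 1 \<or> N = 2" using assms by auto
  moreover have "{1..2::nat} = {1,2}" by auto
  ultimately show ?thesis by (auto simp: chi4_harm_def chi4_def)
qed

lemma chi4_harm_diff:
  assumes "M \<le> N"
  shows "\<bar>chi4_harm N - chi4_harm M\<bar> \<le> 1 / real (Suc M)"
proof -
  have "chi4_harm N - chi4_harm M = (\<Sum>n\<in>{Suc M..<Suc M+(N-M)}. chi4 n * (1 / real n))"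
  proof -
    have "chi4_harm N = chi4_harm M + (\<Sum>n\<in>{Suc M..<Suc M+(N-M)}. chi4 n / real n)"
      unfolding chi4_harm_def using assms
      by (subst sum.union_disjoint[symmetric]) (auto intro!: sum.cong)
    then show ?thesis by simp
  qed
  also have "\<bar>\<dots>\<bar> \<le> 1 / real (Suc M)"
    by (rule abs_chi4_sum_le) (auto simp: field_simps)
  finally show ?thesis .
qed

lemma ln_over_self_antimono:
  fixes x y :: real
  assumes "3 \<le> x" "x \<le> y"
  shows "ln y / y \<le> ln x / x"
proof -
  have "ln (exp 1) \<le> ln x" using assms exp_le by (subst ln_le_cancel_iff) auto
  then have 1: "1 \<le> ln x" by simp
  have "ln y = ln x + ln (y / x)" using assms by (simp add: ln_div)
  also have "ln (y / x) \<le> y / x - 1" using assms by (intro ln_le_minus_one) auto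
  also have "y / x - 1 \<le> ln x * (y / x - 1)" using mult_right_mono[OF 1, of "y / x - 1"] assms by simp
  finally have "ln y \<le> ln x * (y / x)" by (simp add: algebra_simps)
  then show ?thesis using assms by (simp add: field_simps)
qed

text \<open>The terms n = 1 and n = 2 vanish, as ln 1 = 0 and chi4 2 = 0; from 3 > e on, ln n / n
  decreases and the alternating bound applies.\<close>

lemma chi4_ln_sum_bound: "\<bar>\<Sum>n=1..N. chi4 n * (ln (real n) / real n)\<bar> \<le> 1"
proof (cases "N \<ge> 3")
  case True
  define k where "k = N - 2"
  have N: "N = 2 + k" using True by (simp add: k_def)
  have "(\<Sum>n=1..N. chi4 n * (ln (real n) / real n)) = (\<Sum>n=1..2. chi4 n * (ln (real n) / real n))
      + (\<Sum>n\<in>{3..<3+k}. chi4 n * (ln (real n) / real n))"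
  proof -
    have "{1..N} = {1..2} \<union> {3..<3+k}" using N by auto
    then show ?thesis by (simp only:) (rule sum.union_disjoint; auto)
  qed
  also have "(\<Sum>n=1..2. chi4 n * (ln (real n) / real n)) = 0"
  proof -
    have "{1..2::nat} = {1,2}" by auto
    then show ?thesis by (simp add: chi4_def)
  qed
  finally have "(\<Sum>n=1..N. chi4 n * (ln (real n) / real n)) = (\<Sum>n\<in>{3..<3+k}. chi4 n * (ln (real n) / real n))"
    by simp
  also have "\<bar>\<dots>\<bar> \<le> ln (real 3) / real 3"
    by (rule abs_chi4_sum_le) (auto intro!: ln_over_self_antimono)
  also have "\<dots> \<le> 1" using ln_le_minus_one[of "3::real"] by simp
  finally show ?thesis .
next
  case False
  then have "N = 0 \<or> N = 1 \<or> N = 2" by auto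
  moreover have "{1..2::nat} = {1,2}" by auto
  ultimately show ?thesis by (auto simp: chi4_def)
qed

text \<open>From chi ln = (chi mangoldt) * chi, a bounded sum equals the sum of chi(d) mangoldt(d) /
  d times \<open>chi4_harm (N div d)\<close>. Replacing the last factor by
  \<open>chi4_harm N\<close> costs at most \<open>cheb_psi N / N\<close> <= 4, and dividing by 2/3
  turns 1 + 4 into 15/2 <= 8.\<close>

lemma mertens_chi4:
  assumes "N \<ge> 1"
  shows "\<bar>\<Sum>d=1..N. chi4 d * mangoldt d / real d\<bar> \<le> 8"
proof -
  let ?S = "\<Sum>d=1..N. chi4 d * mangoldt d / real d"
  have "(\<Sum>n=1..N. chi4 n * (ln (real n) / real n))
      = (\<Sum>n=1..N. \<Sum>d | d dvd n. (chi4 d * mangoldt d / real d) * (chi4 (n div d) / real (n div d)))"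
  proof (intro sum.cong refl)
    fix n assume n: "n \<in> {1..N}"
    have "chi4 n * (ln (real n) / real n) = (\<Sum>d | d dvd n. chi4 n / real n * mangoldt d)"
      using n by (subst sum_distrib_left[symmetric], subst mangoldt_sum) auto
    also have "\<dots> = (\<Sum>d | d dvd n. (chi4 d * mangoldt d / real d) * (chi4 (n div d) / real (n div d)))"
      using n by (intro sum.cong refl) (auto elim!: dvdE simp: chi4_mult)
    finally show "chi4 n * (ln (real n) / real n) = \<dots>" .
  qed
  also have "\<dots> = (\<Sum>d=1..N. \<Sum>e=1..N div d. (chi4 d * mangoldt d / real d) * (chi4 e / real e))"
    by (rule sum_divisors_swap)
  also have "\<dots> = (\<Sum>d=1..N. (chi4 d * mangoldt d / real d) * chi4_harm (N div d))"
    by (simp add: chi4_harm_def sum_distrib_left)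
  finally have A: "\<bar>\<Sum>d=1..N. (chi4 d * mangoldt d / real d) * chi4_harm (N div d)\<bar> \<le> 1"
    using chi4_ln_sum_bound[of N] by simp
  have "?S * chi4_harm N = (\<Sum>d=1..N. (chi4 d * mangoldt d / real d) * chi4_harm (N div d))
      + (\<Sum>d=1..N. (chi4 d * mangoldt d / real d) * (chi4_harm N - chi4_harm (N div d)))"
    unfolding sum.distrib[symmetric] sum_distrib_right
    by (intro sum.cong refl) (simp only: right_diff_distrib diff_add_cancel add_diff_eq add_diff_cancel_left')
  moreover have "\<bar>\<Sum>d=1..N. (chi4 d * mangoldt d / real d) * (chi4_harm N - chi4_harm (N div d))\<bar>
      \<le> (\<Sum>d=1..N. mangoldt d / real N)"
  proof (rule order_trans[OF sum_abs sum_mono])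
    fix d assume d: "d \<in> {1..N}"
    have "\<bar>(chi4 d * mangoldt d / real d) * (chi4_harm N - chi4_harm (N div d))\<bar>
        = \<bar>chi4 d\<bar> * (mangoldt d / real d) * \<bar>chi4_harm N - chi4_harm (N div d)\<bar>"
      using d by (simp add: abs_mult)
    also have "\<dots> \<le> 1 * (mangoldt d / real d) * (1 / real (Suc (N div d)))"
      using d mangoldt_nonneg[of d]
      by (intro mult_mono abs_chi4_le chi4_harm_diff divide_nonneg_nonneg) auto
    also have "\<dots> = mangoldt d / (real d * real (Suc (N div d)))" by simp
    also have "\<dots> \<le> mangoldt d / real N"
    proof (rule divide_left_mono)
      have "N = d * (N div d) + N mod d" by simp
      also have "N mod d \<le> d" using d by (intro less_imp_le mod_less_divisor) auto
      finally have "N \<le> d * Suc (N div d)" by simp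
      then show "real N \<le> real d * real (Suc (N div d))" by (metis of_nat_le_iff of_nat_mult)
    qed (use d mangoldt_nonneg in auto)
    finally show "\<bar>(chi4 d * mangoldt d / real d) * (chi4_harm N - chi4_harm (N div d))\<bar> \<le> mangoldt d / real N" .
  qed
  moreover have "(\<Sum>d=1..N. mangoldt d / real N) \<le> 4"
    using cheb_psi_le[of N] assms unfolding sum_divide_distrib[symmetric] cheb_psi_def
    by (simp add: field_simps)
  ultimately have "\<bar>?S * chi4_harm N\<bar> \<le> 5" using A by linarith
  moreover have "\<bar>?S * chi4_harm N\<bar> \<ge> \<bar>?S\<bar> * (2/3)"
    unfolding abs_mult using chi4_harm_ge[OF assms] by (intro mult_left_mono) auto
  ultimately show ?thesis by linarith
qed

lemma sum_power_from_2_le: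
  fixes x :: real
  assumes "0 \<le> x" "x \<le> 1/2"
  shows "(\<Sum>k=2..N. x ^ k) \<le> 2 * x\<^sup>2"
proof (cases "N \<ge> 2")
  case True
  then have "(\<Sum>k=2..N. x ^ k) \<le> 2 * x\<^sup>2 - x ^ N"
  proof (induction N rule: dec_induct)
    case (step n)
    have "2 * x * x ^ n \<le> 1 * x ^ n" using assms by (intro mult_right_mono) auto
    then show ?case using step by simp
  qed simp
  then show ?thesis using assms zero_le_power[of x N] by linarith
qed simp

text \<open>Only powers p^k with k >= 2 contribute; their terms add up to at most 2 ln p / p^2,
  which is at most 4 p powr (-3/2) because ln p <= 2 sqrt p.\<close>

lemma nonprime_mangoldt_sum_bounded:
  obtains C :: real where "\<And>N. (\<Sum>d | d \<in> {1..N} \<and> \<not> prime d. mangoldt d / real d) \<le> C"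
proof -
  let ?b = "\<lambda>n::nat. 4 * real n powr (-3/2)"
  have sb: "summable ?b" by (intro summable_mult) (simp add: summable_real_powr_iff)
  have "(\<Sum>d | d \<in> {1..N} \<and> \<not> prime d. mangoldt d / real d) \<le> suminf ?b" for N
  proof -
    let ?P = "{(p,k) \<in> {2..N} \<times> {2..N}. prime p}"
    have fin: "finite ?P" by (rule finite_subset[of _ "{2..N} \<times> {2..N}"]) auto
    have "(\<Sum>d | d \<in> {1..N} \<and> \<not> prime d. mangoldt d / real d :: real)
        = (\<Sum>d | d \<in> {1..N} \<and> \<not> prime d \<and> primepow d. mangoldt d / real d)"
      by (rule sum.mono_neutral_right) (auto simp: mangoldt_def)
    also have "\<dots> \<le> (\<Sum>d\<in>(\<lambda>(p,k). p ^ k) ` ?P. mangoldt d / real d)"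
    proof (rule sum_mono2)
      show "{d \<in> {1..N}. \<not> prime d \<and> primepow d} \<subseteq> (\<lambda>(p,k). p ^ k) ` ?P"
      proof
        fix d assume "d \<in> {d \<in> {1..N}. \<not> prime d \<and> primepow d}"
        then have d: "1 \<le> d" "d \<le> N" "\<not> prime d" "primepow d" by auto
        then obtain p k where pk: "prime p" "k > 0" "d = p ^ k" by (auto simp: primepow_def)
        have "k \<noteq> 1" using pk d by auto
        then have k: "k \<ge> 2" using pk by simp
        have "p \<le> d" unfolding pk(3) using pk prime_ge_1_nat by (intro self_le_power) auto
        moreover have "k < d" unfolding pk(3)
          using prime_gt_1_nat[OF pk(1)] power_gt_expt[of p k] by simp
        ultimately show "d \<in> (\<lambda>(p,k). p ^ k) ` ?P"
          using pk k d prime_ge_2_nat[OF pk(1)] by (intro image_eqI[of _ _ "(p,k)"]) auto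
      qed
    qed (use fin mangoldt_nonneg in auto)
    also have "\<dots> \<le> (\<Sum>x\<in>?P. mangoldt ((\<lambda>(p,k). p ^ k) x) / real ((\<lambda>(p,k). p ^ k) x))"
      using sum_image_le[OF fin, of "\<lambda>d. mangoldt d / real d :: real" "\<lambda>(p,k). p ^ k"] mangoldt_nonneg
      by (simp add: o_def)
    also have "\<dots> = (\<Sum>(p,k)\<in>?P. ln (real p) / real p ^ k)"
      by (intro sum.cong refl) (clarsimp simp: mangoldt_primepow)
    also have "\<dots> \<le> (\<Sum>(p,k)\<in>{2..N} \<times> {2..N}. ln (real p) / real p ^ k)"
      by (rule sum_mono2) auto
    also have "\<dots> = (\<Sum>p=2..N. \<Sum>k=2..N. ln (real p) / real p ^ k)"
      by (rule sum.cartesian_product[symmetric])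
    also have "\<dots> \<le> (\<Sum>p=2..N. ?b p)"
    proof (rule sum_mono)
      fix p assume p: "p \<in> {2..N}"
      have "(\<Sum>k=2..N. ln (real p) / real p ^ k) = ln (real p) * (\<Sum>k=2..N. (1 / real p) ^ k)"
        by (simp add: sum_distrib_left power_one_over)
      also have "\<dots> \<le> ln (real p) * (2 * (1 / real p)\<^sup>2)"
        using p by (intro mult_left_mono sum_power_from_2_le) auto
      also have "\<dots> \<le> 2 * sqrt (real p) * (2 * (1 / real p)\<^sup>2)"
        using p ln_bound[of "sqrt (real p)"] by (intro mult_right_mono) (auto simp: ln_sqrt)
      also have "\<dots> = ?b p"
      proof -
        have "real p powr (-3/2) = real p powr (1/2) * real p powr (-2)"
          unfolding powr_add[symmetric] by simp
        also have "real p powr (-2) = (1 / real p)\<^sup>2"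
          using p by (simp add: powr_minus power_one_over field_simps)
        also have "real p powr (1/2) = sqrt (real p)" using p by (simp add: powr_half_sqrt)
        finally show ?thesis by simp
      qed
      finally show "(\<Sum>k=2..N. ln (real p) / real p ^ k) \<le> ?b p" .
    qed
    also have "\<dots> \<le> suminf ?b" by (intro sum_le_suminf sb) auto
    finally show ?thesis .
  qed
  then show ?thesis using that by blast
qed

definition primes14 :: "nat set" where
  "primes14 = {q. prime q \<and> q mod 4 = 1}"

text \<open>The weight 1 + \<open>chi4\<close> is 2 on the class 1 and 0 on the class 3 modulo 4, so
  the two Mertens estimates add up to twice the wanted sum; the prime 2 and the nonprime prime
  powers contribute a bounded amount.\<close>

lemma mertens_primes14:
  obtains C :: real where "\<And>N. N \<ge> 1 \<Longrightarrow> \<bar>(\<Sum>q | q \<in> primes14 \<and> q \<le> N. ln (real q) / real q) - ln (real N) / 2\<bar> \<le> C"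
proof -
  obtain C where C: "\<And>N. (\<Sum>d | d \<in> {1..N} \<and> \<not> prime d. mangoldt d / real d) \<le> C"
    by (rule nonprime_mangoldt_sum_bounded) blast
  have "\<bar>(\<Sum>q | q \<in> primes14 \<and> q \<le> N. ln (real q) / real q) - ln (real N) / 2\<bar> \<le> C + 10" if N: "N \<ge> 1" for N
  proof -
    let ?P = "\<Sum>q | q \<in> primes14 \<and> q \<le> N. ln (real q) / real q"
    let ?f = "\<lambda>d. (1 + chi4 d) * (mangoldt d / real d)"
    have f0: "?f d \<ge> 0" for d
      using mangoldt_nonneg[of d] by (auto simp: chi4_def)
    have eq: "(\<Sum>d=1..N. ?f d) = (\<Sum>d=1..N. mangoldt d / real d) + (\<Sum>d=1..N. chi4 d * mangoldt d / real d)"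
      unfolding sum.distrib[symmetric] by (intro sum.cong refl) (simp add: distrib_right add_divide_distrib)
    have P: "2 * ?P = (\<Sum>d | d \<in> primes14 \<and> d \<le> N. ?f d)"
      unfolding sum_distrib_left by (intro sum.cong refl) (auto simp: primes14_def chi4_def)
    have low: "2 * ?P \<le> (\<Sum>d=1..N. ?f d)"
      unfolding P using f0 by (intro sum_mono2) (auto simp: primes14_def dest: prime_gt_0_nat)
    have "(\<Sum>d=1..N. ?f d) = (\<Sum>d | d \<in> {1..N} \<and> prime d. ?f d) + (\<Sum>d | d \<in> {1..N} \<and> \<not> prime d. ?f d)"
      by (subst sum.union_disjoint[symmetric]) (auto intro!: sum.cong)
    also have "(\<Sum>d | d \<in> {1..N} \<and> \<not> prime d. ?f d) \<le> (\<Sum>d | d \<in> {1..N} \<and> \<not> prime d. 2 * (mangoldt d / real d))"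
      using mangoldt_nonneg by (intro sum_mono mult_right_mono) (auto simp: chi4_def)
    also have "\<dots> \<le> 2 * C" unfolding sum_distrib_left[symmetric] using C[of N] by simp
    \<comment> \<open>The prime 2 is adjoined since \<open>chi4 2 = 0\<close> gives it weight 1;
      primes congruent to 3 have weight 0.\<close>
    also have "(\<Sum>d | d \<in> {1..N} \<and> prime d. ?f d) \<le> (\<Sum>d\<in>{d. d \<in> primes14 \<and> d \<le> N} \<union> {2}. ?f d)"
    proof -
      have "?f d = 0" if "d \<in> {d. d \<in> {1..N} \<and> prime d}" "d \<notin> {d. d \<in> primes14 \<and> d \<le> N} \<union> {2}" for d
      proof -
        have "odd d" using that prime_odd_nat[of d] prime_ge_2_nat[of d] by force
        then have "d mod 4 = 1 \<or> d mod 4 = 3" by presburger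
        then have "d mod 4 = 3" using that by (auto simp: primes14_def)
        then show ?thesis by (simp add: chi4_def)
      qed
      then have "(\<Sum>d | d \<in> {1..N} \<and> prime d. ?f d) = (\<Sum>d\<in>{d. d \<in> {1..N} \<and> prime d} \<inter> ({d. d \<in> primes14 \<and> d \<le> N} \<union> {2}). ?f d)"
        by (intro sum.mono_neutral_right) auto
      also have "\<dots> \<le> (\<Sum>d\<in>{d. d \<in> primes14 \<and> d \<le> N} \<union> {2}. ?f d)"
        using f0 by (intro sum_mono2) auto
      finally show ?thesis .
    qed
    also have "\<dots> = 2 * ?P + ?f 2"
      unfolding P by (subst sum.union_disjoint) (auto simp: primes14_def)
    also have "?f 2 \<le> 1" using ln_le_minus_one[of "2::real"] by (simp add: chi4_def)
    finally have high: "(\<Sum>d=1..N. ?f d) \<le> 2 * ?P + 1 + 2 * C" by simp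
    have "C \<ge> 0" using C[of 0] by simp
    then show ?thesis using low high eq mertens_mangoldt[OF N] mertens_chi4[OF N]
      unfolding abs_le_iff by linarith
  qed
  then show ?thesis using that by blast
qed

lemma primes14_interval:
  obtains C :: nat where "C \<ge> 2"
    "\<And>u v. u \<ge> 1 \<Longrightarrow> v \<ge> C * u \<Longrightarrow> (\<Sum>q | q \<in> primes14 \<and> u < q \<and> q \<le> v. ln (real q) / real q) \<ge> 1"
proof -
  obtain M where M: "\<And>N. N \<ge> 1 \<Longrightarrow> \<bar>(\<Sum>q | q \<in> primes14 \<and> q \<le> N. ln (real q) / real q) - ln (real N) / 2\<bar> \<le> M"
    by (rule mertens_primes14) blast
  \<comment> \<open>Two Mertens estimates, each with error M, differ by at least ln C / 2 - 2 M, and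
    ln C >= 4 M + 2 makes this at least 1.\<close>
  define C where "C = nat \<lceil>exp (4 * M + 2)\<rceil> + 2"
  have "real C \<ge> exp (4 * M + 2)" unfolding C_def by linarith
  then have lnC: "ln (real C) \<ge> 4 * M + 2"
    by (metis exp_gt_zero ln_exp ln_le_cancel_iff order_less_le_trans)
  have "C \<ge> 2" by (simp add: C_def)
  have "(\<Sum>q | q \<in> primes14 \<and> u < q \<and> q \<le> v. ln (real q) / real q) \<ge> 1"
    if uv: "u \<ge> 1" "v \<ge> C * u" for u v
  proof -
    have Cu: "u \<le> C * u" "1 \<le> C * u" using uv by (auto simp: C_def)
    have "(\<Sum>q | q \<in> primes14 \<and> q \<le> u. ln (real q) / real q) + (\<Sum>q | q \<in> primes14 \<and> u < q \<and> q \<le> C * u. ln (real q) / real q)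
        = (\<Sum>q | q \<in> primes14 \<and> q \<le> C * u. ln (real q) / real q)"
      using Cu by (subst sum.union_disjoint[symmetric]) (auto intro!: sum.cong intro: order_trans)
    moreover have "ln (real (C * u)) = ln (real C) + ln (real u)"
      using uv \<open>C \<ge> 2\<close> by (simp add: ln_mult_pos)
    ultimately have "(\<Sum>q | q \<in> primes14 \<and> u < q \<and> q \<le> C * u. ln (real q) / real q) \<ge> 1"
      using M[OF uv(1)] M[OF Cu(2)] lnC unfolding abs_le_iff by argo
    also have "(\<Sum>q | q \<in> primes14 \<and> u < q \<and> q \<le> C * u. ln (real q) / real q)
       \<le> (\<Sum>q | q \<in> primes14 \<and> u < q \<and> q \<le> v. ln (real q) / real q)"
      using uv by (intro sum_mono2) (auto intro!: divide_nonneg_nonneg ln_ge_zero)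
    finally show ?thesis .
  qed
  then show ?thesis using that \<open>C \<ge> 2\<close> by blast
qed

subsection \<open>Primes in arithmetic progressions to a small modulus\<close>

text \<open>The sum is ln p times the exponent of p in N!, and that exponent is at most N (1/2 + 1/4
  + ...) <= N.\<close>

lemma mangoldt_multiples_sum_le:
  assumes "prime p"
  shows "(\<Sum>d | d \<in> {1..N} \<and> p dvd d. mangoldt d * real (N div d)) \<le> real N * ln (real p)"
proof -
  have p: "p \<ge> 2" "p > 0" using assms prime_ge_2_nat by (auto simp: prime_gt_0_nat)
  have "(\<Sum>d | d \<in> {1..N} \<and> p dvd d. mangoldt d * real (N div d))
      = (\<Sum>d | d \<in> {1..N} \<and> p dvd d \<and> primepow d. mangoldt d * real (N div d))"
    by (rule sum.mono_neutral_right) (auto simp: mangoldt_def)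
  also have "\<dots> \<le> (\<Sum>d\<in>(\<lambda>j. p ^ j) ` {1..N}. mangoldt d * real (N div d))"
  proof (rule sum_mono2)
    show "{d \<in> {1..N}. p dvd d \<and> primepow d} \<subseteq> (\<lambda>j. p ^ j) ` {1..N}"
    proof
      fix d assume "d \<in> {d \<in> {1..N}. p dvd d \<and> primepow d}"
      then have d: "d \<le> N" "p dvd d" "primepow d" by auto
      then obtain r k where rk: "prime r" "k > 0" "d = r ^ k" by (auto simp: primepow_def)
      then have "p = r" using d assms by (metis prime_dvd_power primes_dvd_imp_eq)
      moreover have "k < p ^ k" using p power_gt_expt[of p k] by simp
      ultimately show "d \<in> (\<lambda>j. p ^ j) ` {1..N}" using rk d by auto
    qed
  qed (auto intro!: mult_nonneg_nonneg mangoldt_nonneg)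
  also have "\<dots> = (\<Sum>j=1..N. mangoldt (p ^ j) * real (N div p ^ j))"
    using p by (subst sum.reindex) (auto intro!: inj_onI)
  also have "\<dots> \<le> (\<Sum>j=1..N. ln (real p) * (real N * (1 / 2) ^ j))"
  proof (rule sum_mono)
    fix j assume j: "j \<in> {1..N}"
    have "real (N div p ^ j) \<le> real N / real (p ^ j)" by (rule of_nat_div_le_of_nat)
    also have "\<dots> \<le> real N / 2 ^ j"
      using p by (intro divide_left_mono) (auto intro!: power_mono)
    finally have "real (N div p ^ j) \<le> real N * (1 / 2) ^ j" by (simp add: power_one_over)
    then show "mangoldt (p ^ j) * real (N div p ^ j) \<le> ln (real p) * (real N * (1 / 2) ^ j)"
      using j assms p by (simp add: mangoldt_primepow mult_left_mono)
  qed
  also have "\<dots> = real N * ln (real p) * (\<Sum>j=1..N. (1 / 2) ^ j)"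
    by (simp add: sum_distrib_left mult_ac)
  also have "\<dots> \<le> real N * ln (real p) * 1"
  proof (rule mult_left_mono)
    have "(\<Sum>j=1..N. (1 / 2 :: real) ^ j) = 1 - (1 / 2) ^ N" by (induction N) auto
    then show "(\<Sum>j=1..N. (1 / 2 :: real) ^ j) \<le> 1" by simp
  qed (use p in auto)
  finally show ?thesis by simp
qed

text \<open>Since p is invertible modulo d, divisibility holds on one residue class of k modulo d,
  which meets each full block of length d.\<close>

lemma card_progression_multiples_ge:
  fixes p b d N :: nat
  assumes "coprime d p" "d > 0"
  shows "N div d \<le> card {k. k < N \<and> d dvd p * k + b}"
proof -
  obtain y where y: "[p * y = 1] (mod d)"
    using cong_solve_coprime_nat[of p d] assms by (auto simp: coprime_commute)
  obtain c where c: "[p * c + b = 0] (mod d)"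
  proof -
    \<comment> \<open>The root is -b / p modulo d; over \<open>nat\<close> the factor
      \<open>d - 1\<close> plays the role of -1.\<close>
    have "[p * (y * (b * (d - 1))) + b = (p * y) * (b * (d - 1)) + b] (mod d)" by (simp add: mult_ac)
    also have "[(p * y) * (b * (d - 1)) + b = 1 * (b * (d - 1)) + b] (mod d)"
      by (intro cong_add cong_mult y cong_refl)
    also have "1 * (b * (d - 1)) + b = b * d" using assms(2) by (cases d) auto
    also have "[b * d = 0] (mod d)" by (simp add: cong_0_iff)
    finally show ?thesis using that by blast
  qed
  define r where "r = c mod d"
  have r: "r < d" using assms by (simp add: r_def)
  have "(\<lambda>i. i * d + r) ` {..<N div d} \<subseteq> {k. k < N \<and> d dvd p * k + b}"
  proof clarify
    fix i assume i: "i < N div d"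
    have "i * d + r < (Suc i) * d" using r by simp
    also have "\<dots> \<le> (N div d) * d" using i by (intro mult_right_mono) auto
    also have "\<dots> \<le> N" by simp
    finally have "i * d + r < N" .
    moreover have "[p * (i * d + r) + b = 0] (mod d)"
    proof -
      have "[i * d + r = c] (mod d)" by (simp add: Cong.cong_def r_def)
      then have "[p * (i * d + r) + b = p * c + b] (mod d)" by (intro cong_add cong_mult cong_refl)
      then show ?thesis using c cong_trans by blast
    qed
    ultimately show "i * d + r < N \<and> d dvd p * (i * d + r) + b" by (simp add: cong_0_iff)
  qed
  then have "card ((\<lambda>i. i * d + r) ` {..<N div d}) \<le> card {k. k < N \<and> d dvd p * k + b}"
    by (intro card_mono) auto
  moreover have "inj_on (\<lambda>i. i * d + r) {..<N div d}" using assms by (auto intro!: inj_onI)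
  ultimately show ?thesis by (simp add: card_image)
qed

text \<open>The product of \<open>p * k + b\<close> over \<open>k < N\<close> is divisible by the part of \<open>N!\<close> prime to \<open>p\<close>
  and by every prime of the progression in \<open>{N<..X}\<close>; its size is at most \<open>p ^ N * N!\<close>.\<close>

lemma theta_progression_le:
  assumes p: "prime p" "p \<le> X"
  shows "(\<Sum>q | prime q \<and> q \<le> X \<and> q mod p = b. ln (real q)) \<le> 16 * real X * (ln (real p) / real p)"
proof -
  have p2: "p \<ge> 2" "p > 0" using p prime_ge_2_nat by (auto simp: prime_gt_0_nat)
  have lnp: "ln (real p) \<ge> 2/3"
  proof -
    have "ln (2::real) \<ge> 2/3" using ln2_ge_two_thirds by simp
    also have "ln (2::real) \<le> ln (real p)" using p2 by (subst ln_le_cancel_iff) auto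
    finally show ?thesis .
  qed
  show ?thesis
  proof (cases "0 < b \<and> b < p")
    case False
    \<comment> \<open>A residue is less than p, so b >= p leaves no prime, and b = 0 leaves only p
      itself.\<close>
    have "{q. prime q \<and> q \<le> X \<and> q mod p = b} \<subseteq> {p}"
    proof
      fix q assume q: "q \<in> {q. prime q \<and> q \<le> X \<and> q mod p = b}"
      then have "q mod p = 0" using False p2 mod_less_divisor[of p q] by auto
      then have "p dvd q" by auto
      then show "q \<in> {p}" using q p primes_dvd_imp_eq by auto
    qed
    then have "(\<Sum>q | prime q \<and> q \<le> X \<and> q mod p = b. ln (real q)) \<le> (\<Sum>q\<in>{p}. ln (real q))"
      using p2 by (intro sum_mono2) auto
    also have "\<dots> = 1 * ln (real p)" by simp
    also have "\<dots> \<le> (16 * (real X / real p)) * ln (real p)"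
      using p p2 lnp by (intro mult_right_mono) (auto simp: field_simps)
    finally show ?thesis by simp
  next
    case True
    \<comment> \<open>With N terms the progression p k + b reaches every member of the class up to
      X.\<close>
    define N where "N = X div p + 1"
    have N: "N \<ge> 1" by (simp add: N_def)
    let ?Q = "{q. prime q \<and> q \<le> X \<and> q mod p = b \<and> N < q}"
    let ?c = "\<lambda>d. card {k. k < N \<and> d dvd p * k + b}"
    define Y where "Y = p * N"
    have fin: "finite ?Q" by (rule finite_subset[of _ "{..X}"]) auto
    have Yb: "p * k + b \<le> Y" if "k < N" for k
    proof -
      have "p * k + b \<le> p * Suc k" using True by simp
      also have "\<dots> \<le> Y" unfolding Y_def using that by (intro mult_left_mono) auto
      finally show ?thesis .
    qed
    have XY: "X \<le> Y"
    proof -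
      have "X = p * (X div p) + X mod p" by simp
      also have "X mod p \<le> p" using p2 by (intro less_imp_le mod_less_divisor) auto
      finally show ?thesis by (simp add: Y_def N_def)
    qed
    have NY: "N \<le> Y" using p2 by (simp add: Y_def)
    have "(\<Sum>k<N. ln (real (p * k + b))) = (\<Sum>k<N. \<Sum>d | d dvd p * k + b. mangoldt d)"
      using True by (intro sum.cong refl, subst mangoldt_sum) auto
    also have "\<dots> = (\<Sum>k<N. \<Sum>d=1..Y. if d dvd p * k + b then mangoldt d else 0)"
    proof (rule sum.cong[OF refl])
      fix k assume k: "k \<in> {..<N}"
      have "{d. d dvd p * k + b} = {d \<in> {1..Y}. d dvd p * k + b}"
        using True Yb[of k] k by (auto simp: Suc_le_eq intro!: Nat.gr0I dest: dvd_imp_le)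
      then show "(\<Sum>d | d dvd p * k + b. mangoldt d) = (\<Sum>d=1..Y. if d dvd p * k + b then mangoldt d else 0 :: real)"
        by (simp only: sum.inter_filter[OF finite_atLeastAtMost])
    qed
    also have "\<dots> = (\<Sum>d=1..Y. \<Sum>k<N. if d dvd p * k + b then mangoldt d else 0)"
      by (rule sum.swap)
    also have "\<dots> = (\<Sum>d=1..Y. mangoldt d * real (?c d))"
    proof (rule sum.cong[OF refl])
      fix d
      have "(\<Sum>k<N. if d dvd p * k + b then mangoldt d else 0 :: real) = (\<Sum>k | k \<in> {..<N} \<and> d dvd p * k + b. mangoldt d)"
        by (rule sum.inter_filter[symmetric]) auto
      then show "(\<Sum>k<N. if d dvd p * k + b then mangoldt d else 0 :: real) = mangoldt d * real (?c d)"
        by (simp add: mult.commute)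
    qed
    also have "\<dots> \<ge> (\<Sum>d\<in>{d \<in> {1..N}. \<not> p dvd d} \<union> ?Q. mangoldt d * real (?c d))"
      using NY XY by (intro sum_mono2) (auto intro!: mangoldt_nonneg mult_nonneg_nonneg dest: prime_gt_0_nat)
    also have "(\<Sum>d\<in>{d \<in> {1..N}. \<not> p dvd d} \<union> ?Q. mangoldt d * real (?c d))
       = (\<Sum>d | d \<in> {1..N} \<and> \<not> p dvd d. mangoldt d * real (?c d)) + (\<Sum>q\<in>?Q. mangoldt q * real (?c q))"
      using fin by (intro sum.union_disjoint) auto
    finally have 1: "(\<Sum>d | d \<in> {1..N} \<and> \<not> p dvd d. mangoldt d * real (?c d)) + (\<Sum>q\<in>?Q. mangoldt q * real (?c q))
       \<le> (\<Sum>k<N. ln (real (p * k + b)))" by simp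
    have 2: "(\<Sum>d | d \<in> {1..N} \<and> \<not> p dvd d. mangoldt d * real (?c d))
       \<ge> (\<Sum>d | d \<in> {1..N} \<and> \<not> p dvd d. mangoldt d * real (N div d))"
    proof (intro sum_mono mult_left_mono mangoldt_nonneg)
      fix d assume d: "d \<in> {d. d \<in> {1..N} \<and> \<not> p dvd d}"
      then have "coprime d p" using p prime_imp_coprime[of p d] by (auto simp: coprime_commute)
      with d show "real (N div d) \<le> real (?c d)"
        using card_progression_multiples_ge[of d p N b] by simp
    qed
    have 3: "(\<Sum>q\<in>?Q. mangoldt q * real (?c q)) \<ge> (\<Sum>q\<in>?Q. ln (real q))"
    proof (rule sum_mono)
      fix q assume q: "q \<in> ?Q"
      have "q div p < N" unfolding N_def using q div_le_mono[of q X p] by simp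
      moreover have "p * (q div p) + b = q" using q by auto
      ultimately have "q div p \<in> {k. k < N \<and> q dvd p * k + b}" by simp
      moreover have "finite {k. k < N \<and> q dvd p * k + b}" by simp
      ultimately have "?c q > 0" by (subst card_gt_0_iff) blast
      then have "?c q \<ge> 1" by simp
      moreover have "ln (real q) \<ge> 0" using q prime_ge_1_nat by (auto intro!: ln_ge_zero)
      ultimately show "ln (real q) \<le> mangoldt q * real (?c q)"
        using q mult_left_mono[of 1 "real (?c q)" "ln (real q)"] by simp
    qed
    have 4: "(\<Sum>k<N. ln (real (p * k + b))) \<le> real N * ln (real p) + ln (fact N)"
    proof -
      have "(\<Sum>k<N. ln (real (p * k + b))) \<le> (\<Sum>k<N. ln (real p) + ln (real (Suc k)))"
      proof (rule sum_mono)
        fix k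
        have "ln (real (p * k + b)) \<le> ln (real (p * Suc k))"
          using True by (subst ln_le_cancel_iff) (auto simp: of_nat_le_iff simp del: of_nat_mult of_nat_add)
        also have "\<dots> = ln (real p) + ln (real (Suc k))"
          unfolding of_nat_mult using p2 by (intro ln_mult_pos) auto
        finally show "ln (real (p * k + b)) \<le> ln (real p) + ln (real (Suc k))" .
      qed
      also have "\<dots> = real N * ln (real p) + (\<Sum>k<N. ln (real (Suc k)))" by (simp add: sum.distrib)
      also have "(\<Sum>k<N. ln (real (Suc k))) = ln (fact N)"
        by (induction N) (auto simp: ln_mult simp del: of_nat_Suc)
      finally show ?thesis .
    qed
    have 5: "ln (fact N) = (\<Sum>d | d \<in> {1..N} \<and> \<not> p dvd d. mangoldt d * real (N div d))
        + (\<Sum>d | d \<in> {1..N} \<and> p dvd d. mangoldt d * real (N div d))"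
      unfolding ln_fact_eq_sum_mangoldt by (subst sum.union_disjoint[symmetric]) (auto intro!: sum.cong)
    \<comment> \<open>ln N! cancels up to its p-part. One N ln p comes from the size of the product,
      the other from the p-part of N!, which the progression need not contain.\<close>
    have 6: "(\<Sum>q\<in>?Q. ln (real q)) \<le> 2 * real N * ln (real p)"
      using 1 2 3 4 5 mangoldt_multiples_sum_le[OF p(1), of N] by linarith
    have "(\<Sum>q | prime q \<and> q \<le> X \<and> q mod p = b. ln (real q)) \<le> (\<Sum>q\<in>?Q \<union> {q \<in> {1..N}. prime q}. ln (real q))"
      using fin by (intro sum_mono2) (auto dest: prime_gt_0_nat intro!: ln_ge_zero simp: Suc_le_eq)
    also have "\<dots> = (\<Sum>q\<in>?Q. ln (real q)) + (\<Sum>q | q \<in> {1..N} \<and> prime q. ln (real q))"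
      using fin by (intro sum.union_disjoint) auto
    also have "(\<Sum>q | q \<in> {1..N} \<and> prime q. ln (real q)) = (\<Sum>q | q \<in> {1..N} \<and> prime q. mangoldt q)"
      by (intro sum.cong refl) auto
    also have "\<dots> \<le> cheb_psi N"
      unfolding cheb_psi_def by (intro sum_mono2) (auto intro: mangoldt_nonneg)
    also have "\<dots> \<le> 4 * real N" by (rule cheb_psi_le)
    also have "4 * real N \<le> 6 * real N * ln (real p)" using lnp N by (simp add: field_simps)
    also have "(\<Sum>q\<in>?Q. ln (real q)) + 6 * real N * ln (real p) \<le> 8 * real N * ln (real p)" using 6 by simp
    \<comment> \<open>Here p <= X enters: N <= X / p + 1 <= 2 X / p.\<close>
    also have "\<dots> \<le> 8 * (2 * real X / real p) * ln (real p)"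
    proof (intro mult_right_mono mult_left_mono)
      have "real N \<le> real X / real p + 1" unfolding N_def using of_nat_div_le_of_nat[of X p, where ?'a=real] by simp
      also have "1 \<le> real X / real p" using p p2 by (simp add: field_simps)
      finally show "real N \<le> 2 * real X / real p" by simp
    qed (use lnp in auto)
    finally show ?thesis by simp
  qed
qed

subsection \<open>Numbers composed of primes congruent to 1 modulo 4\<close>

definition D14 :: "nat set" where
  "D14 = {n. n > 0 \<and> (\<forall>p. prime p \<longrightarrow> p dvd n \<longrightarrow> p mod 4 = 1)}"

lemma D14_mult: "m \<in> D14 \<Longrightarrow> n \<in> D14 \<Longrightarrow> m * n \<in> D14"
  by (auto simp: D14_def prime_dvd_mult_iff)

lemma D14_dvd: "m \<in> D14 \<Longrightarrow> d dvd m \<Longrightarrow> d \<in> D14"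
  unfolding D14_def using dvd_trans dvd_pos_nat by blast

lemma one_in_D14: "1 \<in> D14"
  by (auto simp: D14_def)

lemma primes14_subset_D14: "q \<in> primes14 \<Longrightarrow> q \<in> D14"
  by (auto simp: D14_def primes14_def prime_gt_0_nat dest: primes_dvd_imp_eq)

lemma D14_pos: "m \<in> D14 \<Longrightarrow> m > 0"
  by (auto simp: D14_def)

text \<open>Brahmagupta's identity, computed over \<open>int\<close> because a c - b d may be
  negative.\<close>

lemma sums_of_two_squares_mult:
  assumes "m \<in> sums_of_two_squares" "n \<in> sums_of_two_squares"
  shows "m * n \<in> sums_of_two_squares"
proof -
  obtain a b c d where ab: "m = a\<^sup>2 + b\<^sup>2" "n = c\<^sup>2 + d\<^sup>2"
    using assms by (auto simp: sums_of_two_squares_def)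
  have "int (m * n) = (int a * int c - int b * int d)\<^sup>2 + (int a * int d + int b * int c)\<^sup>2"
    unfolding ab by (simp add: power2_eq_square algebra_simps)
  also have "(int a * int c - int b * int d)\<^sup>2 = int ((nat \<bar>int a * int c - int b * int d\<bar>)\<^sup>2)"
    by simp
  also have "(int a * int d + int b * int c)\<^sup>2 = int ((a * d + b * c)\<^sup>2)" by simp
  finally have "m * n = (nat \<bar>int a * int c - int b * int d\<bar>)\<^sup>2 + (a * d + b * c)\<^sup>2"
    unfolding of_nat_add[symmetric] of_nat_eq_iff .
  moreover have "m * n > 0" using assms by (auto simp: sums_of_two_squares_def)
  ultimately show ?thesis unfolding sums_of_two_squares_def by blast
qed

text \<open>Euler's criterion with the even exponent (q - 1) / 2; since q > 2, the Legendre values 0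
  and -1 are excluded.\<close>

lemma minus_one_square_mod_prime14:
  assumes "q \<in> primes14"
  obtains x :: int where "int q dvd x\<^sup>2 + 1"
proof -
  have q: "prime q" "q mod 4 = 1" using assms by (auto simp: primes14_def)
  have q2: "2 < q" using q prime_ge_2_nat[of q] by (cases "q = 2") auto
  have ev: "even ((q - 1) div 2)" using q(2) by presburger
  have "[Legendre (-1) (int q) = (-1) ^ ((q - 1) div 2)] (mod int q)"
    using euler_criterion[of q "-1"] q q2 by simp
  then have "[Legendre (-1) (int q) = 1] (mod int q)" using ev by simp
  moreover have "\<not> [0 = (1::int)] (mod int q)"
    using q2 zdvd_imp_le[of "int q" 1] by (auto simp: cong_iff_dvd_diff)
  moreover have "\<not> [-1 = (1::int)] (mod int q)"
  proof
    assume "[-1 = (1::int)] (mod int q)"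
    then have "int q dvd 2" by (simp add: cong_iff_dvd_diff)
    then show False using q2 zdvd_imp_le[of "int q" 2] by simp
  qed
  ultimately have "QuadRes (int q) (-1)" unfolding Legendre_def by (auto split: if_splits)
  then obtain x where "[x\<^sup>2 = -1] (mod int q)" by (auto simp: QuadRes_def)
  then have "int q dvd x\<^sup>2 + 1" by (simp add: cong_iff_dvd_diff)
  then show ?thesis using that by blast
qed

text \<open>Thue's pigeonhole argument: two of the pairs \<open>(u, v)\<close> with entries at most the square root of
  \<open>q\<close> have the same residue of \<open>u - x v\<close>, where \<open>x\<close> is a square root of \<open>-1\<close>.\<close>

lemma primes14_sum_of_two_squares:
  assumes "q \<in> primes14"
  shows "q \<in> sums_of_two_squares"
proof -
  obtain x :: int where x: "int q dvd x\<^sup>2 + 1" using minus_one_square_mod_prime14[OF assms] .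
  have q: "prime q" "q > 0" using assms by (auto simp: primes14_def prime_gt_0_nat)
  define k where "k = floor_sqrt q"
  have k: "k\<^sup>2 \<le> q" "q < (Suc k)\<^sup>2" by (auto simp: k_def Suc_floor_sqrt_power2_gt)
  \<comment> \<open>A prime is not a square, so both squares below are strictly less than q and the
    positive multiple a^2 + b^2 < 2 q of q must be q itself.\<close>
  have knq: "k\<^sup>2 \<noteq> q"
    using q(1) by (metis prime_power_iff numeral_One numeral_eq_iff semiring_norm(85) zero_neq_numeral)
  define g where "g = (\<lambda>(u,v). (int u - x * int v) mod int q)"
  have "g ` ({..k} \<times> {..k}) \<subseteq> {0..<int q}" unfolding g_def using q by auto
  then have "card (g ` ({..k} \<times> {..k})) \<le> q"
    using card_mono[of "{0..<int q}"] by fastforce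
  also have "\<dots> < card ({..k} \<times> {..k})" using k(2) by (simp add: card_cartesian_product power2_eq_square)
  finally have "\<not> inj_on g ({..k} \<times> {..k})" by (intro pigeonhole) auto
  then obtain u v u' v' where uv: "u \<le> k" "v \<le> k" "u' \<le> k" "v' \<le> k" "(u,v) \<noteq> (u',v')"
    "g (u,v) = g (u',v')" unfolding inj_on_def by auto
  define a b where "a = int u - int u'" and "b = int v - int v'"
  have "int q dvd (int u - x * int v) - (int u' - x * int v')"
    using uv(6) unfolding g_def by (simp add: mod_eq_dvd_iff)
  then have "int q dvd a - x * b" by (simp add: a_def b_def algebra_simps)
  then have "int q dvd (a - x * b) * (a + x * b) + (x\<^sup>2 + 1) * b\<^sup>2"
    by (rule dvd_add[OF dvd_mult2 dvd_mult2[OF x]])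
  also have "(a - x * b) * (a + x * b) + (x\<^sup>2 + 1) * b\<^sup>2 = a\<^sup>2 + b\<^sup>2"
    by (simp add: power2_eq_square algebra_simps)
  finally have dvd: "int q dvd a\<^sup>2 + b\<^sup>2" .
  have ab: "\<bar>a\<bar> \<le> int k" "\<bar>b\<bar> \<le> int k" using uv by (auto simp: a_def b_def)
  then have "a\<^sup>2 \<le> (int k)\<^sup>2" "b\<^sup>2 \<le> (int k)\<^sup>2"
    using power_mono[of "\<bar>a\<bar>" "int k" 2] power_mono[of "\<bar>b\<bar>" "int k" 2] by auto
  moreover have "(int k)\<^sup>2 < int q" using k(1) knq by (metis le_neq_implies_less of_nat_less_iff of_nat_power)
  ultimately have lt: "a\<^sup>2 + b\<^sup>2 < 2 * int q" by linarith
  have "a \<noteq> 0 \<or> b \<noteq> 0" using uv(5) by (auto simp: a_def b_def)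
  then have pos: "a\<^sup>2 + b\<^sup>2 > 0" by (auto simp: sum_power2_gt_zero_iff)
  obtain c where c: "a\<^sup>2 + b\<^sup>2 = int q * c" using dvd by (auto elim: dvdE)
  have "c > 0" using pos c q by (metis of_nat_0_less_iff zero_less_mult_pos)
  moreover have "c < 2" using lt c q by (metis mult.commute mult_less_cancel_left_pos of_nat_0_less_iff)
  ultimately have "c = 1" by simp
  then have "int q = int ((nat \<bar>a\<bar>)\<^sup>2 + (nat \<bar>b\<bar>)\<^sup>2)" using c by simp
  then have "q = (nat \<bar>a\<bar>)\<^sup>2 + (nat \<bar>b\<bar>)\<^sup>2" unfolding of_nat_eq_iff .
  then show ?thesis using q unfolding sums_of_two_squares_def by blast
qed

lemma D14_subset: "m \<in> D14 \<Longrightarrow> m \<in> sums_of_two_squares"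
proof (induction m rule: less_induct)
  case (less m)
  show ?case
  proof (cases "m = 1")
    case True
    moreover have "1 = 1\<^sup>2 + (0::nat)\<^sup>2" by simp
    ultimately show ?thesis unfolding sums_of_two_squares_def by blast
  next
    case False
    then obtain p where p: "prime p" "p dvd m" using prime_factor_nat[of m] by auto
    then obtain n where n: "m = p * n" by (auto elim: dvdE)
    have "p \<in> primes14" using less.prems p by (auto simp: D14_def primes14_def)
    moreover have "n \<in> D14" using D14_dvd[OF less.prems] n by simp
    moreover have "n < m" using n D14_pos[OF less.prems] prime_gt_1_nat[OF p(1)] by simp
    ultimately have "p \<in> sums_of_two_squares" "n \<in> sums_of_two_squares"
      using less.IH primes14_sum_of_two_squares by auto
    then show ?thesis unfolding n by (rule sums_of_two_squares_mult)
  qed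
qed

section \<open>The divisor sum of the character and a lower bound for the sum of 1/m over
  \<open>D14\<close>\<close>

definition chi4_conv :: "nat \<Rightarrow> real" where
  "chi4_conv n = (\<Sum>d | d dvd n. chi4 d)"

lemma chi4_power: "chi4 (p ^ k) = chi4 p ^ k"
proof (induction k)
  case 0
  show ?case by (simp add: chi4_def)
qed (simp add: chi4_mult)

text \<open>Divisors of p^k m are uniquely p^j d with d dividing m. This is the multiplicativity of
  \<open>chi4_conv\<close>, a quarter of Jacobi's number of representations by two squares, in the
  form that strips one prime at a time.\<close>

lemma chi4_conv_prime_power_mult:
  assumes p: "prime p" "\<not> p dvd m" "m > 0"
  shows "chi4_conv (p ^ k * m) = (\<Sum>j\<le>k. chi4 p ^ j) * chi4_conv m"
proof -
  have cop: "coprime (p ^ j) d" if "d dvd m" for j d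
    using p that by (metis coprime_power_left_iff dvd_trans prime_imp_coprime)
  have "bij_betw (\<lambda>(j,d). p ^ j * d) ({..k} \<times> {d. d dvd m}) {d. d dvd p ^ k * m}"
  proof (rule bij_betwI')
    fix x y assume "x \<in> {..k} \<times> {d. d dvd m}" "y \<in> {..k} \<times> {d. d dvd m}"
    then obtain i c j d where xy: "x = (i,c)" "y = (j,d)" "c dvd m" "d dvd m" by auto
    have nd: "\<not> p dvd c" "\<not> p dvd d" using xy p dvd_trans by blast+
    have p0: "p > 0" using p(1) prime_gt_0_nat by simp
    have "i = j \<and> c = d" if eq: "p ^ i * c = p ^ j * d"
    proof -
      have "p ^ i dvd p ^ j * d" "p ^ j dvd p ^ i * c" using eq by (metis dvd_triv_left)+
      then have "p ^ i dvd p ^ j" "p ^ j dvd p ^ i"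
        using cop xy by (auto simp: coprime_dvd_mult_left_iff)
      then have "i = j" using prime_gt_1_nat[OF p(1)] by (simp add: dvd_power_iff_le order_antisym)
      then show ?thesis using eq p0 by simp
    qed
    then show "((case x of (j,d) \<Rightarrow> p ^ j * d) = (case y of (j,d) \<Rightarrow> p ^ j * d)) = (x = y)"
      using xy by auto
  next
    fix x assume "x \<in> {..k} \<times> {d. d dvd m}"
    then show "(case x of (j,d) \<Rightarrow> p ^ j * d) \<in> {d. d dvd p ^ k * m}"
      by (auto intro!: mult_dvd_mono le_imp_power_dvd)
  next
    fix y assume "y \<in> {d. d dvd p ^ k * m}"
    then have y: "y dvd p ^ k * m" by simp
    have "p ^ k * m \<noteq> 0" using p not_prime_0 by auto
    then have "y \<noteq> 0" using y by (metis dvd_0_left)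
    moreover have "\<not> is_unit p" using p(1) by (auto simp: prime_nat_iff)
    ultimately obtain d where d: "y = p ^ multiplicity p y * d" "\<not> p dvd d"
      using multiplicity_decompose' by blast
    define j where "j = multiplicity p y"
    have dj: "y = p ^ j * d" using d by (simp add: j_def)
    have "coprime d (p ^ k)" using p d by (metis coprime_commute coprime_power_left_iff prime_imp_coprime)
    moreover have "d dvd p ^ k * m" using y dj by (metis dvd_mult_right)
    ultimately have "d dvd m" by (simp add: coprime_dvd_mult_right_iff)
    moreover have "p ^ j dvd p ^ k" using y dj cop[of m j]
      by (metis coprime_dvd_mult_left_iff dvd_mult_left dvd_refl)
    then have "j \<le> k" using prime_gt_1_nat[OF p(1)] by (simp add: dvd_power_iff_le)
    ultimately show "\<exists>x\<in>{..k} \<times> {d. d dvd m}. y = (case x of (j,d) \<Rightarrow> p ^ j * d)"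
      using dj by (intro bexI[of _ "(j,d)"]) auto
  qed
  from sum.reindex_bij_betw[OF this, of chi4]
  have "chi4_conv (p ^ k * m) = (\<Sum>(j,d)\<in>{..k} \<times> {d. d dvd m}. chi4 (p ^ j * d))"
    unfolding chi4_conv_def by (simp add: case_prod_beta)
  also have "\<dots> = (\<Sum>j\<le>k. \<Sum>d | d dvd m. chi4 (p ^ j * d))"
    by (rule sum.cartesian_product[symmetric])
  also have "\<dots> = (\<Sum>j\<le>k. chi4 p ^ j) * chi4_conv m"
    unfolding chi4_conv_def sum_product by (simp add: chi4_mult chi4_power)
  finally show ?thesis .
qed

text \<open>The power of 2 absorbs the prime 2, the square absorbs even powers of primes congruent
  to 3. The set is closed under products, and its reciprocals have a bounded sum.\<close>

definition W14 :: "nat set" where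
  "W14 = {w. \<exists>a k. k > 0 \<and> w = 2 ^ a * k\<^sup>2}"

definition triples14 :: "nat \<Rightarrow> (nat \<times> nat \<times> nat) set" where
  "triples14 n = {(d,e,w). d \<in> D14 \<and> e \<in> D14 \<and> w \<in> W14 \<and> d * e * w = n}"

lemma finite_triples14:
  assumes "n > 0"
  shows "finite (triples14 n)"
proof (rule finite_subset)
  show "triples14 n \<subseteq> {d. d dvd n} \<times> {d. d dvd n} \<times> {d. d dvd n}"
    by (auto simp: triples14_def)
  show "finite ({d. d dvd n} \<times> {d. d dvd n} \<times> {d. d dvd n})"
    using assms by auto
qed

lemma alternating_power_sum: "(\<Sum>j\<le>k. (-1::real) ^ j) = (if even k then 1 else 0)"
  by (induction k) auto

text \<open>Compared prime by prime. For p = 2 the local factor is 1 and p^k goes into w; for p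
  congruent to 3 it is 1 or 0 as k is even or odd, and even powers go into w; for p congruent to 1
  it is k + 1. Equality can fail, since w may also contain squares of primes of the last
  kind.\<close>

lemma chi4_conv_le_card_triples: "n > 0 \<Longrightarrow> chi4_conv n \<le> real (card (triples14 n))"
proof (induction n rule: less_induct)
  case (less n)
  show ?case
  proof (cases "n = 1")
    case True
    have "(1,1,1) \<in> triples14 1"
      using one_in_D14 by (auto simp: triples14_def W14_def intro!: exI[of _ 0] exI[of _ 1])
    then have "card (triples14 1) > 0" using finite_triples14[of 1] by (auto simp: card_gt_0_iff)
    moreover have "chi4_conv 1 = 1" by (simp add: chi4_conv_def chi4_def)
    ultimately show ?thesis using True by simp
  next
    case False
    then obtain p where p: "prime p" "p dvd n" using prime_factor_nat[of n] by auto
    have "\<not> is_unit p" using p(1) by (auto simp: prime_nat_iff)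
    moreover have "n \<noteq> 0" using less.prems by simp
    ultimately obtain m where m: "n = p ^ multiplicity p n * m" "\<not> p dvd m"
      using multiplicity_decompose' by blast
    define k where "k = multiplicity p n"
    have k: "k > 0" unfolding k_def using p less.prems by (simp add: prime_multiplicity_gt_zero_iff)
    have n: "n = p ^ k * m" using m by (simp add: k_def)
    have p1: "p > 1" using p(1) prime_gt_1_nat by simp
    have m0: "m > 0" using less.prems n by (auto intro: Nat.gr0I)
    have "m < n" using n k p1 m0 one_less_power[of p k] by simp
    then have IH: "chi4_conv m \<le> real (card (triples14 m))" using less.IH m0 by simp
    have conv: "chi4_conv n = (\<Sum>j\<le>k. chi4 p ^ j) * chi4_conv m"
      unfolding n by (rule chi4_conv_prime_power_mult) (use p m m0 in auto)
    have fin: "finite (triples14 m)" "finite (triples14 n)" using m0 less.prems finite_triples14 by auto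
    have trivial_factor: "chi4_conv n \<le> real (card (triples14 n))" if "p ^ k \<in> W14" "(\<Sum>j\<le>k. chi4 p ^ j) = 1"
    proof -
      have "(\<lambda>(d,e,w). (d,e,p ^ k * w)) ` triples14 m \<subseteq> triples14 n"
      proof -
        have "p ^ k * w \<in> W14" if "w \<in> W14" for w
        proof -
          obtain a x where "p ^ k = 2 ^ a * x\<^sup>2" "x > 0"
            using \<open>p ^ k \<in> W14\<close> unfolding W14_def by blast
          moreover obtain b y where "w = 2 ^ b * y\<^sup>2" "y > 0"
            using \<open>w \<in> W14\<close> unfolding W14_def by blast
          ultimately have "p ^ k * w = 2 ^ (a + b) * (x * y)\<^sup>2 \<and> x * y > 0"
            by (simp add: power_add power_mult_distrib)
          then show ?thesis unfolding W14_def by blast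
        qed
        then show ?thesis by (auto simp: triples14_def n)
      qed
      moreover have "inj_on (\<lambda>(d,e,w). (d,e,p ^ k * w)) (triples14 m)"
        using p1 by (auto intro!: inj_onI)
      ultimately have "card (triples14 m) \<le> card (triples14 n)"
        using fin card_inj_on_le by blast
      then show ?thesis using IH that(2) conv by simp
    qed
    have "p mod 4 \<in> {0,1,2,3}" by auto
    moreover have "p = 2 \<or> odd p" using prime_odd_nat[OF p(1)] p1 by force
    ultimately consider "p = 2" | "p mod 4 = 1" | "p mod 4 = 3" by (auto, presburger+)
    then show ?thesis
    proof cases
      case 1
      \<comment> \<open>As \<open>chi4 2 = 0\<close> and \<open>0 ^ 0 = 1\<close>, only j = 0
        survives.\<close>
      have "(\<Sum>j\<le>k. chi4 p ^ j) = (\<Sum>j\<in>{0}. chi4 p ^ j)"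
        using 1 by (intro sum.mono_neutral_right) (auto simp: chi4_def)
      moreover have "p ^ k \<in> W14" unfolding W14_def using 1
        by (intro CollectI exI[of _ k] exI[of _ 1]) simp
      ultimately show ?thesis by (intro trivial_factor) auto
    next
      case 3
      then have s: "(\<Sum>j\<le>k. chi4 p ^ j) = (if even k then 1 else 0)"
        by (simp add: chi4_def alternating_power_sum)
      show ?thesis
      proof (cases "even k")
        case True
        then have "p ^ k = 2 ^ 0 * (p ^ (k div 2))\<^sup>2" by (simp add: power_mult[symmetric])
        moreover have "p ^ (k div 2) > 0" using p1 by simp
        ultimately have "p ^ k \<in> W14" unfolding W14_def by blast
        then show ?thesis using s True by (intro trivial_factor) auto
      next
        case False
        then show ?thesis using s conv by simp
      qed
    next
      case 2
      have pD: "p \<in> D14" using 2 p by (intro primes14_subset_D14) (auto simp: primes14_def)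
      have pjD: "p ^ j \<in> D14" for j
      proof (induction j)
        case 0
        then show ?case using one_in_D14 by simp
      next
        case (Suc j)
        then show ?case using pD D14_mult by simp
      qed
      \<comment> \<open>The k + 1 ways to share p^k between the two \<open>D14\<close> components.
        The exponent j can be read off the first component because p does not divide d.\<close>
      let ?f = "\<lambda>(j,(d,e,w)). (p ^ j * d, p ^ (k - j) * e, w)"
      have "?f ` ({..k} \<times> triples14 m) \<subseteq> triples14 n"
      proof -
        have "p ^ j * d * (p ^ (k - j) * e) * w = n" if "j \<le> k" "d * e * w = m" for j d e w
        proof -
          have "p ^ j * d * (p ^ (k - j) * e) * w = p ^ (j + (k - j)) * (d * e * w)"
            by (simp add: power_add mult_ac)
          then show ?thesis using that n by simp
        qed
        then show ?thesis using D14_mult pjD by (auto simp: triples14_def)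
      qed
      moreover have "inj_on ?f ({..k} \<times> triples14 m)"
      proof (rule inj_onI)
        fix x y assume xy: "x \<in> {..k} \<times> triples14 m" "y \<in> {..k} \<times> triples14 m" "?f x = ?f y"
        obtain i d e w where x: "x = (i,d,e,w)" by (metis surj_pair)
        obtain j d' e' w' where y: "y = (j,d',e',w')" by (metis surj_pair)
        have "m = d * (e * w)" "m = d' * (e' * w')"
          using xy(1,2) by (auto simp: triples14_def x y mult.assoc)
        then have "d dvd m" "d' dvd m" by (metis dvd_triv_left)+
        then have nd: "\<not> p dvd d" "\<not> p dvd d'" using m(2) dvd_trans by blast+
        have eqs: "p ^ i * d = p ^ j * d'" "p ^ (k - i) * e = p ^ (k - j) * e'" "w = w'"
          using xy(3) x y by auto
        have "multiplicity p (p ^ i * d) = i" "multiplicity p (p ^ j * d') = j"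
          using nd p1 by (auto intro!: multiplicity_eqI)
        then have "i = j" using eqs by simp
        then show "x = y" using eqs x y p1 by auto
      qed
      ultimately have "card ({..k} \<times> triples14 m) \<le> card (triples14 n)"
        using fin card_inj_on_le by blast
      then have "real (Suc k) * real (card (triples14 m)) \<le> real (card (triples14 n))"
        by (metis card_atMost card_cartesian_product of_nat_le_iff of_nat_mult)
      moreover have "chi4_conv n = real (Suc k) * chi4_conv m"
        using 2 conv by (simp add: chi4_def)
      moreover have "real (Suc k) * chi4_conv m \<le> real (Suc k) * real (card (triples14 m))"
        using IH by (intro mult_left_mono) auto
      ultimately show ?thesis by linarith
    qed
  qed
qed

definition D14_harm :: "nat \<Rightarrow> real" where
  "D14_harm N = (\<Sum>m | m \<in> D14 \<and> m \<le> N. 1 / real m)"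

text \<open>The character is moved to the complementary divisor, so that after the swap the inner
  sums are partial Leibniz sums, each at least 2/3, weighted by 1/d.\<close>

lemma chi4_conv_sum_ge:
  assumes "N \<ge> 1"
  shows "(\<Sum>n=1..N. chi4_conv n / real n) \<ge> 2/3 * ln (real N)"
proof -
  have "(\<Sum>n=1..N. chi4_conv n / real n) = (\<Sum>n=1..N. \<Sum>d | d dvd n. chi4 (n div d) / (real d * real (n div d)))"
  proof (intro sum.cong refl)
    fix n assume n: "n \<in> {1..N}"
    have "chi4_conv n / real n = (\<Sum>d | d dvd n. chi4 d / real n)"
      by (simp add: chi4_conv_def sum_divide_distrib)
    also have "\<dots> = (\<Sum>d | d dvd n. chi4 (n div d) / (real d * real (n div d)))"
      using n by (intro sum.reindex_bij_witness[of _ "\<lambda>d. n div d" "\<lambda>d. n div d"])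
        (auto elim!: dvdE simp: field_simps)
    finally show "chi4_conv n / real n = \<dots>" .
  qed
  also have "\<dots> = (\<Sum>d=1..N. \<Sum>e=1..N div d. chi4 e / (real d * real e))"
    by (rule sum_divisors_swap[of "\<lambda>d e. chi4 e / (real d * real e)"])
  also have "\<dots> = (\<Sum>d=1..N. chi4_harm (N div d) / real d)"
    by (simp add: chi4_harm_def sum_divide_distrib mult.commute)
  also have "\<dots> \<ge> (\<Sum>d=1..N. (2/3) / real d)"
    by (intro sum_mono divide_right_mono chi4_harm_ge) (auto simp: Suc_le_eq div_greater_zero_iff)
  also have "(\<Sum>d=1..N. (2/3) / real d) = 2/3 * harm N"
    unfolding harm_def sum_distrib_left by (intro sum.cong refl divide_inverse)
  also have "\<dots> \<ge> 2/3 * ln (real N)"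
  proof -
    have "ln (real N) \<le> ln (real N + 1)" using assms by (subst ln_le_cancel_iff) auto
    also have "\<dots> \<le> harm N" by (rule ln_le_harm)
    finally show ?thesis by simp
  qed
  finally show ?thesis by linarith
qed

text \<open>A geometric series times the sum of 1 / k^2, each at most 2. Representations 2^a k^2 are
  not unique, hence \<open>sum_image_le\<close> and not a reindexing.\<close>

lemma W14_sum_le: "(\<Sum>w | w \<in> W14 \<and> w \<le> N. 1 / real w) \<le> 4"
proof -
  let ?P = "{..N} \<times> {1..N}"
  let ?f = "\<lambda>(a,k). 2 ^ a * k\<^sup>2 :: nat"
  have "(\<Sum>w | w \<in> W14 \<and> w \<le> N. 1 / real w) \<le> (\<Sum>w\<in>?f ` ?P. 1 / real w)"
  proof (rule sum_mono2)
    show "{w. w \<in> W14 \<and> w \<le> N} \<subseteq> ?f ` ?P"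
    proof clarify
      fix w assume w: "w \<in> W14" "w \<le> N"
      then obtain a k where ak: "k > 0" "w = 2 ^ a * k\<^sup>2" by (auto simp: W14_def)
      have "2 ^ a \<le> w" "k\<^sup>2 \<le> w" using ak by auto
      moreover have "a < 2 ^ a" by simp
      moreover have "k \<le> k\<^sup>2" by (simp add: power2_eq_square)
      ultimately have "a \<le> N" "k \<le> N" using w by linarith+
      then show "w \<in> ?f ` ?P" using ak by (intro image_eqI[of _ _ "(a,k)"]) auto
    qed
  qed auto
  also have "\<dots> \<le> (\<Sum>x\<in>?P. 1 / real (?f x))"
    using sum_image_le[of ?P "\<lambda>w. 1 / real w" ?f] by (simp add: o_def)
  also have "\<dots> = (\<Sum>(a,k)\<in>?P. (1/2) ^ a * (1 / (real k)\<^sup>2))"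
    by (intro sum.cong refl) (auto simp: power_one_over)
  also have "\<dots> = (\<Sum>a\<le>N. \<Sum>k=1..N. (1/2) ^ a * (1 / (real k)\<^sup>2))"
    by (rule sum.cartesian_product[symmetric])
  also have "\<dots> = (\<Sum>a\<le>N. (1/2) ^ a) * (\<Sum>k=1..N. 1 / (real k)\<^sup>2)"
    by (rule sum_product[symmetric])
  also have "\<dots> \<le> 2 * 2"
  proof (rule mult_mono)
    have "(\<Sum>a\<le>N. (1/2 :: real) ^ a) = 2 - (1/2) ^ N" by (induction N) auto
    then show "(\<Sum>a\<le>N. (1/2 :: real) ^ a) \<le> 2" by simp
    have "(\<Sum>k=1..N. 1 / (real k)\<^sup>2) \<le> 2 - 1 / real N" if "N \<ge> 1"
      using that
    proof (induction N rule: dec_induct)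
      case (step n)
      have "1 / (real (Suc n))\<^sup>2 \<le> 1 / (real n * real (Suc n))"
        using step by (intro divide_left_mono) (auto simp: power2_eq_square)
      also have "\<dots> = 1 / real n - 1 / real (Suc n)" using step by (simp add: field_simps)
      finally show ?case using step by simp
    qed simp
    moreover have "1 / real N \<ge> 0" by simp
    ultimately have "(\<Sum>k=1..N. 1 / (real k)\<^sup>2) \<le> 2" if "N \<ge> 1" using that by linarith
    then show "(\<Sum>k=1..N. 1 / (real k)\<^sup>2) \<le> 2" by (cases "N = 0") simp_all
  qed (auto intro: sum_nonneg)
  finally show ?thesis by simp
qed

lemma D14_harm_nonneg: "D14_harm N \<ge> 0"
  unfolding D14_harm_def by (intro sum_nonneg) auto

lemma D14_harm_ge:
  assumes "N \<ge> 1"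
  shows "(D14_harm N)\<^sup>2 \<ge> ln (real N) / 6"
proof -
  let ?D = "{m. m \<in> D14 \<and> m \<le> N}" and ?W = "{w. w \<in> W14 \<and> w \<le> N}"
  let ?g = "\<lambda>(d,e,w). (1 / real d) * ((1 / real e) * (1 / real w))"
  have "2/3 * ln (real N) \<le> (\<Sum>n=1..N. chi4_conv n / real n)" using chi4_conv_sum_ge[OF assms] .
  also have "\<dots> \<le> (\<Sum>n=1..N. \<Sum>t\<in>triples14 n. ?g t)"
  proof (rule sum_mono)
    fix n assume n: "n \<in> {1..N}"
    have "(\<Sum>t\<in>triples14 n. ?g t) = (\<Sum>t\<in>triples14 n. 1 / real n)"
      by (intro sum.cong refl) (auto simp: triples14_def)
    then show "chi4_conv n / real n \<le> (\<Sum>t\<in>triples14 n. ?g t)"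
      using chi4_conv_le_card_triples[of n] n by (simp add: divide_right_mono)
  qed
  also have "\<dots> = (\<Sum>t\<in>(\<Union>n\<in>{1..N}. triples14 n). ?g t)"
    using finite_triples14 by (intro sum.UNION_disjoint[symmetric]) (auto simp: triples14_def)
  \<comment> \<open>Relaxing d e w <= N to a bound on each factor makes the sum a product, at most 4
    times the square of \<open>D14_harm N\<close>; then (2/3) / 4 = 1/6.\<close>
  also have "\<dots> \<le> (\<Sum>t\<in>?D \<times> ?D \<times> ?W. ?g t)"
  proof (rule sum_mono2)
    show "(\<Union>n\<in>{1..N}. triples14 n) \<subseteq> ?D \<times> ?D \<times> ?W"
    proof
      fix x assume "x \<in> (\<Union>n\<in>{1..N}. triples14 n)"
      then obtain n where n: "n \<in> {1..N}" and "x \<in> triples14 n" by blast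
      moreover obtain d e w where x: "x = (d,e,w)" by (metis surj_pair)
      ultimately have t: "(d,e,w) \<in> triples14 n" by simp
      then have "d dvd n" "e dvd n" "w dvd n" by (auto simp: triples14_def)
      then have "d \<le> n" "e \<le> n" "w \<le> n" using n by (auto intro!: dvd_imp_le)
      then show "x \<in> ?D \<times> ?D \<times> ?W" using t n x by (auto simp: triples14_def)
    qed
  qed auto
  also have "\<dots> = (\<Sum>d\<in>?D. \<Sum>y\<in>?D \<times> ?W. (1 / real d) * (case y of (e,w) \<Rightarrow> (1 / real e) * (1 / real w)))"
    by (subst sum.cartesian_product) (auto intro!: sum.cong)
  also have "\<dots> = D14_harm N * (\<Sum>(e,w)\<in>?D \<times> ?W. (1 / real e) * (1 / real w))"
    unfolding D14_harm_def by (rule sum_product[symmetric])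
  also have "(\<Sum>(e,w)\<in>?D \<times> ?W. (1 / real e) * (1 / real w)) = D14_harm N * (\<Sum>w\<in>?W. 1 / real w)"
    unfolding D14_harm_def sum_product by (rule sum.cartesian_product[symmetric])
  also have "D14_harm N * (D14_harm N * (\<Sum>w\<in>?W. 1 / real w)) \<le> D14_harm N * (D14_harm N * 4)"
    using W14_sum_le D14_harm_nonneg by (intro mult_left_mono) auto
  finally show ?thesis by (simp add: power2_eq_square)
qed

subsection \<open>A pointwise bound for \<open>n / \<phi>(n)\<close>\<close>

text \<open>On a dyadic block beyond 2^J one writes 1 / (p ln p) = ln p / (p (ln p)^2) and sums the
  numerators by Chebyshev's bound. The block is at most 32 / J^2, which is dominated by the
  telescoping 64 (1/J - 1/(J+1)).\<close>

lemma summable_prime_inverse_ln: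
  "summable (\<lambda>n::nat. if prime n then 1 / (real n * ln (real n)) else 0)" (is "summable ?f")
proof (rule summableI_nonneg_bounded)
  show f0: "?f n \<ge> 0" for n
    by (cases "n = 0") (auto intro!: divide_nonneg_nonneg mult_nonneg_nonneg ln_ge_zero)
  have dyadic: "(\<Sum>n\<in>{..2^J}. ?f n) \<le> 1 + 64 * (1 - 1 / real J)" if "J \<ge> 1" for J
    using that
  proof (induction J rule: dec_induct)
    case base
    have "{..2::nat} = {0,1,2}" by auto
    moreover have "2 * ln (2::real) \<ge> 1" using ln2_ge_two_thirds by simp
    ultimately show ?case by simp
  next
    case (step J)
    have "(\<Sum>n\<in>{..2^Suc J}. ?f n) = (\<Sum>n\<in>{..2^J}. ?f n) + (\<Sum>n\<in>{2^J<..2^Suc J}. ?f n)"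
      by (subst sum.union_disjoint[symmetric]) (auto intro!: sum.cong)
    also have "(\<Sum>n\<in>{2^J<..2^Suc J}. ?f n) \<le> (\<Sum>n\<in>{2^J<..2^Suc J}. mangoldt n * (1 / (2^J * (real J * ln 2)\<^sup>2)))"
    proof (rule sum_mono)
      fix n :: nat assume n: "n \<in> {2^J<..2^Suc J}"
      show "?f n \<le> mangoldt n * (1 / (2^J * (real J * ln 2)\<^sup>2))"
      proof (cases "prime n")
        case True
        have n1: "real n > 1" using True prime_gt_1_nat by simp
        have nJ: "real n \<ge> 2 ^ J" using n by (metis greaterThanAtMost_iff less_imp_le numeral_power_le_of_nat_cancel_iff)
        then have "ln (2 ^ J) \<le> ln (real n)" using n1 by (subst ln_le_cancel_iff) auto
        then have "real J * ln 2 \<le> ln (real n)" by (simp add: ln_realpow)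
        then have "2^J * (real J * ln 2)\<^sup>2 \<le> real n * (ln (real n))\<^sup>2"
          using nJ by (intro mult_mono power_mono) auto
        moreover have "2^J * (real J * ln 2)\<^sup>2 > 0" using step.hyps by simp
        ultimately have "ln (real n) * (1 / (real n * (ln (real n))\<^sup>2)) \<le> ln (real n) * (1 / (2^J * (real J * ln 2)\<^sup>2))"
          using n1 step.hyps by (intro mult_left_mono divide_left_mono mult_pos_pos) auto
        moreover have "ln (real n) * (1 / (real n * (ln (real n))\<^sup>2)) = ?f n"
          using n1 True by (simp add: power2_eq_square)
        ultimately show ?thesis using True by simp
      next
        case False
        then show ?thesis by (auto intro!: divide_nonneg_nonneg mangoldt_nonneg)
      qed
    qed
    also have "\<dots> = (\<Sum>n\<in>{2^J<..2^Suc J}. mangoldt n) * (1 / (2^J * (real J * ln 2)\<^sup>2))"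
      by (rule sum_distrib_right[symmetric])
    also have "\<dots> \<le> (4 * real (2 ^ Suc J)) * (1 / (2^J * (real J * ln 2)\<^sup>2))"
    proof (rule mult_right_mono)
      have "(\<Sum>n\<in>{2^J<..2^Suc J}. mangoldt n) \<le> cheb_psi (2 ^ Suc J)"
        unfolding cheb_psi_def by (intro sum_mono2) (auto intro: mangoldt_nonneg)
      then show "(\<Sum>n\<in>{2^J<..2^Suc J}. mangoldt n) \<le> 4 * real (2 ^ Suc J)"
        using cheb_psi_le[of "2 ^ Suc J"] by linarith
    qed auto
    also have "\<dots> = 8 / (real J * ln 2)\<^sup>2" by simp
    also have "\<dots> \<le> 8 / (real J * (1/2))\<^sup>2"
      using ln2_ge_two_thirds step by (intro divide_left_mono power_mono mult_left_mono) auto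
    also have "\<dots> = 32 / (real J * real J)" by (simp add: power2_eq_square)
    also have "\<dots> \<le> 64 / (real J * real (Suc J))"
    proof -
      have "real J * real (Suc J) * 32 \<le> 64 * (real J * real J)" using step by (simp add: algebra_simps)
      then show ?thesis using step by (simp add: divide_simps)
    qed
    also have "\<dots> = 64 * (1 / real J - 1 / real (Suc J))"
      using step by (simp add: field_simps)
    finally show ?case using step.IH by simp
  qed
  show "(\<Sum>n<N. ?f n) \<le> 65" for N
  proof -
    have "N < 2 ^ Suc N" by (rule less_trans[OF less_exp]) simp
    then have "(\<Sum>n<N. ?f n) \<le> (\<Sum>n\<in>{..2^Suc N}. ?f n)"
      using f0 by (intro sum_mono2) auto
    also have "\<dots> \<le> 1 + 64 * (1 - 1 / real (Suc N))" by (rule dyadic) simp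
    also have "\<dots> \<le> 65" by simp
    finally show ?thesis .
  qed
qed

text \<open>Jensen's inequality through the tangent at the mean; the missing mass 1 -
  \<open>sum w S\<close> is placed at 0, where exp is 1, and accounts for the leading 1.\<close>

lemma exp_weighted_sum_le:
  fixes w t :: "'a \<Rightarrow> real"
  assumes "\<And>i. i \<in> S \<Longrightarrow> w i \<ge> 0" "sum w S \<le> 1"
  shows "exp (\<Sum>i\<in>S. w i * t i) \<le> 1 + (\<Sum>i\<in>S. w i * exp (t i))"
proof -
  define m where "m = (\<Sum>i\<in>S. w i * t i)"
  have tangent: "exp m * (1 + (y - m)) \<le> exp y" for y
    using mult_left_mono[OF exp_ge_add_one_self[of "y - m"], of "exp m"]
    by (simp add: exp_diff)
  have "exp m = (1 - sum w S) * (exp m * (1 + (0 - m))) + (\<Sum>i\<in>S. w i * (exp m * (1 + (t i - m))))"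
  proof -
    have "(\<Sum>i\<in>S. w i * (exp m * (1 + (t i - m)))) = (\<Sum>i\<in>S. exp m * (1 - m) * w i + exp m * (w i * t i))"
      by (intro sum.cong refl) (simp add: algebra_simps)
    also have "\<dots> = exp m * (1 - m) * sum w S + exp m * m"
      unfolding m_def sum.distrib sum_distrib_left[symmetric] by simp
    finally have "(\<Sum>i\<in>S. w i * (exp m * (1 + (t i - m)))) = exp m * (1 - m) * sum w S + exp m * m" .
    then show ?thesis by (simp add: algebra_simps)
  qed
  also have "\<dots> \<le> (1 - sum w S) * exp 0 + (\<Sum>i\<in>S. w i * exp (t i))"
    using assms by (intro add_mono mult_left_mono sum_mono tangent) auto
  also have "\<dots> \<le> 1 + (\<Sum>i\<in>S. w i * exp (t i))"
    using sum_nonneg[of S w] assms by simp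
  finally show ?thesis by (simp add: m_def)
qed

text \<open>Jensen's inequality with weights \<open>4 / (p ln p)\<close>, summable over the primes, linearizes the product
  over \<open>p\<close> dividing \<open>r\<close>; hence only prime moduli occur later on.\<close>

lemma ratio_totient_le:
  obtains C :: real where "C > 0"
    "\<And>r. r \<ge> 1 \<Longrightarrow> real r / real (totient r) \<le> C * (1 + (\<Sum>p\<in>prime_factors r. 1 / sqrt (real p)))"
proof -
  let ?f = "\<lambda>n::nat. if prime n then 1 / (real n * ln (real n)) else 0"
  \<comment> \<open>A tail below 1/4 makes the weights 4 / (p ln p) over p >= P sum to at most 1.
    Primes below P are bounded trivially and only affect the constant.\<close>
  obtain P where PP: "\<And>m n. m \<ge> P \<Longrightarrow> norm (sum ?f {m..<n}) < 1/4"
    using summable_prime_inverse_ln[unfolded summable_Cauchy, rule_format, of "1/4"] by auto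
  then have P: "sum ?f {P..<n} < 1/4" for n
    using PP[OF order_refl, of n] unfolding real_norm_def by linarith
  have "real r / real (totient r) \<le> 8 * exp (2 * real P) * (1 + (\<Sum>p\<in>prime_factors r. 1 / sqrt (real p)))"
    if r: "r \<ge> 1" for r
  proof -
    let ?A = "{p \<in> prime_factors r. p < P}" and ?B = "{p \<in> prime_factors r. P \<le> p}"
    have pf: "prime p" "real p \<ge> 2" if "p \<in> prime_factors r" for p
      using that prime_ge_2_nat[of p] by (auto simp: in_prime_factors_iff)
    have "real r / real (totient r) = (\<Prod>p\<in>prime_factors r. 1 / (1 - 1 / real p))"
      using r by (simp add: totient_formula2 prod_dividef)
    also have "\<dots> \<le> (\<Prod>p\<in>prime_factors r. exp (2 / real p))"
    proof (rule prod_mono)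
      fix p assume p: "p \<in> prime_factors r"
      define x where "x = 1 / real p"
      have x: "0 < x" "x \<le> 1/2" using pf[OF p] by (auto simp: x_def field_simps)
      \<comment> \<open>The product is 1 + x - 2 x^2, and x <= 1/2.\<close>
      have "1 \<le> (1 - x) * (1 + 2 * x)"
        using mult_left_mono[of x "1/2" x] x by (simp add: algebra_simps)
      also have "\<dots> \<le> (1 - x) * exp (2 * x)" using x exp_ge_add_one_self[of "2 * x"] by (intro mult_left_mono) auto
      finally have "1 / (1 - x) \<le> exp (2 * x)" using x by (simp add: field_simps)
      then show "0 \<le> 1 / (1 - 1 / real p) \<and> 1 / (1 - 1 / real p) \<le> exp (2 / real p)"
        using x by (simp add: x_def)
    qed
    also have "\<dots> = exp (\<Sum>p\<in>prime_factors r. 2 / real p)" by (simp add: exp_sum)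
    also have "(\<Sum>p\<in>prime_factors r. 2 / real p) = (\<Sum>p\<in>?A. 2 / real p) + (\<Sum>p\<in>?B. 2 / real p)"
      by (subst sum.union_disjoint[symmetric]) (auto intro!: sum.cong)
    also have "exp \<dots> = exp (\<Sum>p\<in>?A. 2 / real p) * exp (\<Sum>p\<in>?B. 2 / real p)" by (rule exp_add)
    also have "\<dots> \<le> exp (2 * real P) * (1 + (\<Sum>p\<in>?B. 8 / sqrt (real p)))"
    proof (rule mult_mono)
      have "(\<Sum>p\<in>?A. 2 / real p) \<le> (\<Sum>p\<in>?A. 2)"
        using pf by (intro sum_mono) (force simp: field_simps)
      also have "\<dots> \<le> (\<Sum>p<P. 2)" by (intro sum_mono2) auto
      finally show "exp (\<Sum>p\<in>?A. 2 / real p) \<le> exp (2 * real P)" by simp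
      have lnp: "ln (real p) \<ge> 1/2" if "p \<in> prime_factors r" for p
      proof -
        have "ln 2 \<le> ln (real p)" using pf[OF that] by (subst ln_le_cancel_iff) auto
        then show ?thesis using ln2_ge_two_thirds by simp
      qed
      \<comment> \<open>The exponent ln p / 2 is chosen so that its exponential is sqrt p; the
        weight then leaves 4 / (ln p sqrt p) <= 8 / sqrt p.\<close>
      have "(\<Sum>p\<in>?B. 2 / real p) = (\<Sum>p\<in>?B. 4 * ?f p * (ln (real p) / 2))"
      proof (rule sum.cong[OF refl])
        fix p assume "p \<in> ?B"
        then have "prime p" "real p \<ge> 2" "ln (real p) \<ge> 1/2" using pf lnp by auto
        then show "2 / real p = 4 * ?f p * (ln (real p) / 2)" by (simp add: field_simps)
      qed
      also have "exp \<dots> \<le> 1 + (\<Sum>p\<in>?B. 4 * ?f p * exp (ln (real p) / 2))"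
      proof (rule exp_weighted_sum_le)
        fix p assume "p \<in> ?B"
        then have "real p \<ge> 2" "ln (real p) \<ge> 1/2" using pf lnp by auto
        then show "0 \<le> 4 * ?f p" by auto
      next
        have "(\<Sum>p\<in>?B. ?f p) \<le> sum ?f {P..<Suc r}"
          using r by (intro sum_mono2)
            (auto dest!: in_prime_factors_imp_dvd dvd_imp_le intro!: divide_nonneg_nonneg mult_nonneg_nonneg ln_ge_zero
              simp: Suc_le_eq prime_gt_0_nat)
        then show "(\<Sum>p\<in>?B. 4 * ?f p) \<le> 1" using P[of "Suc r"] unfolding sum_distrib_left[symmetric] by linarith
      qed
      also have "\<dots> \<le> 1 + (\<Sum>p\<in>?B. 8 / sqrt (real p))"
      proof (intro add_left_mono sum_mono)
        fix p assume "p \<in> ?B"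
        then have p: "prime p" "real p \<ge> 2" "ln (real p) \<ge> 1/2" using pf lnp by auto
        have "exp (ln (real p) / 2) = sqrt (real p)"
        proof -
          have "ln (real p) / 2 = ln (sqrt (real p))" using p by (simp add: ln_sqrt)
          moreover have "sqrt (real p) > 0" using p by simp
          ultimately show ?thesis by (simp only: exp_ln)
        qed
        then have "4 * ?f p * exp (ln (real p) / 2) = (4 / ln (real p)) * (sqrt (real p) / real p)"
          using p by simp
        also have "sqrt (real p) / real p = 1 / sqrt (real p)"
          using p by (simp add: field_simps)
        also have "4 / ln (real p) \<le> 8" using p by (simp add: field_simps)
        finally show "4 * ?f p * exp (ln (real p) / 2) \<le> 8 / sqrt (real p)"
          by (simp add: mult_right_mono divide_right_mono)
      qed
      finally show "exp (\<Sum>p\<in>?B. 2 / real p) \<le> 1 + (\<Sum>p\<in>?B. 8 / sqrt (real p))" .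
    qed auto
    also have "\<dots> \<le> exp (2 * real P) * (8 * (1 + (\<Sum>p\<in>prime_factors r. 1 / sqrt (real p))))"
    proof (rule mult_left_mono)
      have "(\<Sum>p\<in>?B. 8 / sqrt (real p)) \<le> (\<Sum>p\<in>prime_factors r. 8 / sqrt (real p))"
        by (intro sum_mono2) auto
      then show "1 + (\<Sum>p\<in>?B. 8 / sqrt (real p)) \<le> 8 * (1 + (\<Sum>p\<in>prime_factors r. 1 / sqrt (real p)))"
        by (simp add: sum_distrib_left algebra_simps)
    qed simp
    finally show ?thesis by (simp add: algebra_simps)
  qed
  moreover have "8 * exp (2 * real P) > 0" by simp
  ultimately show ?thesis using that by blast
qed

subsection \<open>Polynomial congruences to a prime modulus\<close>

text \<open>Lagrange's theorem modulo p: synthetic division by a root works over the integers and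
  preserves the leading coefficient, so the induction hypothesis applies to the quotient.\<close>

lemma card_poly_roots_mod_prime_le:
  fixes f :: "int poly" and p :: nat
  assumes "prime p" "\<not> int p dvd lead_coeff f"
  shows "card {b \<in> {0..<int p}. int p dvd poly f b} \<le> degree f"
  using assms(2)
proof (induction "degree f" arbitrary: f)
  case 0
  then obtain c where c: "f = [:c:]" by (metis degree_eq_zeroE)
  then have "{b \<in> {0..<int p}. int p dvd poly f b} = {}" using 0 by auto
  then show ?case by (simp only: card.empty)
next
  case (Suc n)
  let ?R = "\<lambda>f. {b \<in> {0..<int p}. int p dvd poly f b}"
  show ?case
  proof (cases "?R f = {}")
    case True
    then show ?thesis by (simp only: card.empty)
  next
    case False
    then obtain a where a: "a \<in> {0..<int p}" "int p dvd poly f a" by blast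
    define q where "q = synthetic_div f a"
    have f: "f = [:-a, 1:] * q + [:poly f a:]" unfolding q_def by (simp only: synthetic_div_correct')
    have dq: "degree q = n" unfolding q_def degree_synthetic_div using Suc.hyps by simp
    have "q \<noteq> 0"
    proof
      assume "q = 0"
      then have "degree f = 0" using f by (metis add_0 degree_pCons_0 mult_zero_right)
      then show False using Suc.hyps by simp
    qed
    then have dm: "degree ([:-a, 1:] * q) = Suc n" using dq by (subst degree_mult_eq) auto
    have "lead_coeff f = Polynomial.coeff ([:-a, 1:] * q + [:poly f a:]) (Suc n)" using f Suc.hyps by simp
    also have "\<dots> = Polynomial.coeff ([:-a, 1:] * q) (Suc n)" by simp
    also have "\<dots> = lead_coeff ([:-a, 1:] * q)" using dm by simp
    also have "\<dots> = lead_coeff q" by (subst lead_coeff_mult) simp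
    finally have "\<not> int p dvd lead_coeff q" using Suc.prems by simp
    then have IH: "card (?R q) \<le> n" using Suc.hyps(1)[of q] dq by simp
    have "?R f \<subseteq> insert a (?R q)"
    proof
      fix b assume b: "b \<in> ?R f"
      have "poly f b = poly ([:-a, 1:] * q + [:poly f a:]) b" using f by simp
      then have "poly f b = (b - a) * poly q b + poly f a" by (simp add: algebra_simps)
      then have "int p dvd (b - a) * poly q b" using a b by (metis (no_types, lifting) add_diff_cancel_right' dvd_diff mem_Collect_eq)
      then have "int p dvd b - a \<or> int p dvd poly q b"
        using assms(1) by (simp add: prime_dvd_mult_iff)
      moreover have "b = a" if "int p dvd b - a"
        using that a b by (metis (no_types, lifting) atLeastLessThan_iff mem_Collect_eq mod_eq_dvd_iff mod_pos_pos_trivial)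
      ultimately show "b \<in> insert a (?R q)" using b by auto
    qed
    moreover have "finite (?R q)" by (rule finite_subset[of _ "{0..<int p}"]) auto
    ultimately have "card (?R f) \<le> card (insert a (?R q))" by (intro card_mono) auto
    also have "\<dots> \<le> Suc (card (?R q))" using \<open>finite (?R q)\<close> by (simp add: card_insert_if)
    finally show ?thesis using IH Suc.hyps by simp
  qed
qed

subsection \<open>A well-distributed set of sums of two squares\<close>

lemma D14_harm_multiples_le:
  assumes "prime p"
  shows "(\<Sum>m | m \<in> D14 \<and> m \<le> N \<and> p dvd m. 1 / real m) \<le> D14_harm N / real p"
proof -
  have p0: "p > 0" using assms prime_gt_0_nat by simp
  have "(\<Sum>m | m \<in> D14 \<and> m \<le> N \<and> p dvd m. 1 / real m) \<le> (\<Sum>m\<in>(\<lambda>m. p * m) ` {m. m \<in> D14 \<and> m \<le> N}. 1 / real m)"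
  proof (rule sum_mono2)
    show "{m. m \<in> D14 \<and> m \<le> N \<and> p dvd m} \<subseteq> (\<lambda>m. p * m) ` {m. m \<in> D14 \<and> m \<le> N}"
    proof
      fix m assume "m \<in> {m. m \<in> D14 \<and> m \<le> N \<and> p dvd m}"
      then obtain k where k: "m = p * k" and m: "m \<in> D14" "m \<le> N" by (auto elim: dvdE)
      have "k \<in> D14" using D14_dvd[OF m(1)] k by simp
      moreover have "k \<le> p * k" using p0 by simp
      then have "k \<le> N" using m(2) unfolding k by linarith
      ultimately show "m \<in> (\<lambda>m. p * m) ` {m. m \<in> D14 \<and> m \<le> N}" using k by blast
    qed
  qed auto
  also have "\<dots> = (\<Sum>m | m \<in> D14 \<and> m \<le> N. 1 / real (p * m))"
    using p0 by (subst sum.reindex) (auto intro: inj_onI)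
  also have "\<dots> = D14_harm N / real p"
    by (simp add: D14_harm_def sum_divide_distrib mult.commute)
  finally show ?thesis .
qed

definition two_square_products :: "nat \<Rightarrow> nat \<Rightarrow> nat set" where
  "two_square_products K N = {q * m | q m. q \<in> primes14 \<and> m \<in> D14 \<and> m \<le> N \<and> N\<^sup>2 < q * m \<and> q * m \<le> K * N\<^sup>2}"

definition cofactor_primes :: "nat \<Rightarrow> nat \<Rightarrow> nat \<Rightarrow> nat set" where
  "cofactor_primes K N m = {q \<in> primes14. N\<^sup>2 < q * m \<and> q * m \<le> K * N\<^sup>2}"

lemma two_square_products_subset: "two_square_products K N \<subseteq> sums_of_two_squares"
  unfolding two_square_products_def
  by (blast intro: sums_of_two_squares_mult primes14_sum_of_two_squares D14_subset)

lemma finite_two_square_products: "finite (two_square_products K N)"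
  by (rule finite_subset[of _ "{..K * N\<^sup>2}"]) (auto simp: two_square_products_def)

lemma cofactor_primes_altdef:
  assumes "m > 0"
  shows "cofactor_primes K N m = {q \<in> primes14. N\<^sup>2 div m < q \<and> q \<le> K * N\<^sup>2 div m}"
  using assms unfolding cofactor_primes_def
  by (auto simp: div_less_iff_less_mult less_eq_div_iff_mult_less_eq)

lemma finite_cofactor_primes:
  assumes "m > 0"
  shows "finite (cofactor_primes K N m)"
  unfolding cofactor_primes_altdef[OF assms] by auto

lemma cofactor_primes_gt:
  assumes "m \<le> N" "q \<in> cofactor_primes K N m"
  shows "q > N"
proof (rule ccontr)
  assume "\<not> q > N"
  then have "q * m \<le> N * N" using assms(1) by (intro mult_mono) auto
  then show False using assms(2) by (simp add: cofactor_primes_def power2_eq_square)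
qed

lemma two_square_products_image:
  "two_square_products K N = (\<lambda>(m,q). q * m) ` (SIGMA m:{m \<in> D14. m \<le> N}. cofactor_primes K N m)"
  unfolding two_square_products_def cofactor_primes_def by force

text \<open>The prime q exceeds N >= m' and so cannot divide m'; it must be q'.\<close>

lemma inj_on_two_square_products:
  "inj_on (\<lambda>(m,q). q * m) (SIGMA m:{m \<in> D14. m \<le> N}. cofactor_primes K N m)"
proof (rule inj_onI, clarify)
  fix m q m' q'
  assume m: "m \<in> D14" "m \<le> N" "m' \<in> D14" "m' \<le> N"
    and q: "q \<in> cofactor_primes K N m" "q' \<in> cofactor_primes K N m'" and eq: "q * m = q' * m'"
  have pr: "prime q" "prime q'" using q by (auto simp: cofactor_primes_def primes14_def)
  have "q > m'" "m' > 0" using cofactor_primes_gt[OF m(2) q(1)] m D14_pos by auto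
  then have "\<not> q dvd m'" by (auto dest: dvd_imp_le)
  moreover have "q dvd q' * m'" using eq by (metis dvd_triv_left)
  ultimately have "q dvd q'" using pr by (simp add: prime_dvd_mult_iff)
  then have "q = q'" using pr primes_dvd_imp_eq by blast
  then show "m = m' \<and> q = q'" using eq prime_gt_0_nat[OF pr(2)] by simp
qed

lemma card_two_square_products:
  "card (two_square_products K N) = (\<Sum>m | m \<in> D14 \<and> m \<le> N. card (cofactor_primes K N m))"
proof -
  have "card (two_square_products K N) = card (SIGMA m:{m \<in> D14. m \<le> N}. cofactor_primes K N m)"
    unfolding two_square_products_image by (rule card_image[OF inj_on_two_square_products])
  also have "\<dots> = (\<Sum>m | m \<in> D14 \<and> m \<le> N. card (cofactor_primes K N m))"
    using finite_cofactor_primes D14_pos by (intro card_SigmaI) auto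
  finally show ?thesis .
qed

text \<open>For fixed m the primes q fill an interval of ratio K, where the sum of ln q / q is at
  least 1 while each term is at most ln (K N^2) m / N^2. So there are at least N^2 / (m ln (K N^2))
  of them.\<close>

lemma card_two_square_products_ge:
  assumes K: "K \<ge> 2"
    and int: "\<And>u v. u \<ge> 1 \<Longrightarrow> v \<ge> K * u \<Longrightarrow> (\<Sum>q | q \<in> primes14 \<and> u < q \<and> q \<le> v. ln (real q) / real q) \<ge> 1"
    and N: "N \<ge> 2"
  shows "real (card (two_square_products K N)) * ln (real (K * N\<^sup>2)) \<ge> real (N\<^sup>2) * D14_harm N"
proof -
  let ?L = "ln (real (K * N\<^sup>2))"
  have N2: "N\<^sup>2 > 0" "N \<le> N\<^sup>2" using N by (auto simp: power2_eq_square)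
  have "real (N\<^sup>2) * (1 / real m) \<le> real (card (cofactor_primes K N m)) * ?L" if m: "m \<in> D14" "m \<le> N" for m
  proof -
    have m0: "m > 0" using m D14_pos by simp
    have "N\<^sup>2 div m \<ge> 1" using m m0 N2 by (simp add: Suc_le_eq div_greater_zero_iff)
    moreover have "K * (N\<^sup>2 div m) \<le> K * N\<^sup>2 div m"
      using m0 by (simp add: less_eq_div_iff_mult_less_eq mult.assoc)
    ultimately have "1 \<le> (\<Sum>q\<in>cofactor_primes K N m. ln (real q) / real q)"
      using int unfolding cofactor_primes_altdef[OF m0] by simp
    also have "\<dots> \<le> (\<Sum>q\<in>cofactor_primes K N m. ?L * (real m / real (N\<^sup>2)))"
    proof (rule sum_mono)
      fix q assume "q \<in> cofactor_primes K N m"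
      then have q: "q > 0" "N\<^sup>2 < q * m" "q * m \<le> K * N\<^sup>2"
        by (auto simp: cofactor_primes_def primes14_def prime_gt_0_nat)
      have "q \<le> q * m" using m0 by simp
      then have "q \<le> K * N\<^sup>2" using q(3) by linarith
      then have "ln (real q) \<le> ?L" using q(1) by (subst ln_le_cancel_iff) (auto simp only: of_nat_0_less_iff of_nat_le_iff)
      moreover have "1 / real q \<le> real m / real (N\<^sup>2)"
      proof -
        have "real (N\<^sup>2) \<le> real (q * m)" using q(2) by (simp only: of_nat_le_iff)
        then show ?thesis using q(1) N2 by (simp add: field_simps)
      qed
      ultimately have "ln (real q) * (1 / real q) \<le> ?L * (real m / real (N\<^sup>2))"
        using q(1) K N2 by (intro mult_mono) (auto intro!: ln_ge_zero simp flip: of_nat_mult of_nat_power simp: Suc_le_eq)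
      then show "ln (real q) / real q \<le> ?L * (real m / real (N\<^sup>2))" by simp
    qed
    also have "\<dots> = real (card (cofactor_primes K N m)) * ?L * (real m / real (N\<^sup>2))" by simp
    finally have "1 * (real (N\<^sup>2) / real m) \<le> real (card (cofactor_primes K N m)) * ?L * (real m / real (N\<^sup>2)) * (real (N\<^sup>2) / real m)"
      by (intro mult_right_mono) auto
    also have "\<dots> = real (card (cofactor_primes K N m)) * ?L" using m0 N2 by simp
    finally show ?thesis by simp
  qed
  then have "(\<Sum>m | m \<in> D14 \<and> m \<le> N. real (N\<^sup>2) * (1 / real m)) \<le> (\<Sum>m | m \<in> D14 \<and> m \<le> N. real (card (cofactor_primes K N m)) * ?L)"
    by (intro sum_mono) auto
  then show ?thesis unfolding D14_harm_def card_two_square_products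
    by (simp only: sum_distrib_left sum_distrib_right of_nat_sum)
qed

text \<open>If p does not divide m, the class of q m fixes that of q and the progression bound
  applies; q > N turns the sum of ln q into a count. If p divides m, all primes q are counted by
  Chebyshev's bound, and the saving comes from the sparsity of such m.\<close>

lemma card_two_square_products_residue_le:
  assumes K: "K \<ge> 2" and N: "N \<ge> 2" and p: "prime p" "p \<le> N"
  shows "real (card {t \<in> two_square_products K N. t mod p = b}) * ln (real N)
       \<le> 48 * real K * real (N\<^sup>2) * D14_harm N * (ln (real p) / real p)"
proof -
  let ?M = "{m. m \<in> D14 \<and> m \<le> N}"
  let ?Q = "\<lambda>m. {q \<in> cofactor_primes K N m. q * m mod p = b}"
  let ?e = "\<lambda>m. ln (real p) / real p + (if p dvd m then 1 else 0)"
  have p2: "real p \<ge> 2" "p > 0" using prime_ge_2_nat[OF p(1)] by auto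
  have lnp: "ln (real p) \<ge> 1/2"
  proof -
    have "ln 2 \<le> ln (real p)" using p2 by (subst ln_le_cancel_iff) auto
    then show ?thesis using ln2_ge_two_thirds by simp
  qed
  have lnN: "ln (real N) \<ge> 0" using N by simp
  have each: "real (card (?Q m)) * ln (real N) \<le> 16 * (real (K * N\<^sup>2) / real m) * ?e m" if m: "m \<in> ?M" for m
  proof -
    have m0: "m > 0" "m \<le> N" using m D14_pos by auto
    define X where "X = K * N\<^sup>2 div m"
    have XR: "real X \<le> real (K * N\<^sup>2) / real m" unfolding X_def by (rule of_nat_div_le_of_nat)
    \<comment> \<open>m <= N gives X >= N, so the progression bound is available for every p <=
      N.\<close>
    have pX: "p \<le> X"
    proof -
      have "N * m \<le> K * N\<^sup>2" using m0 K mult_mono[of 1 K "N * m" "N * N"] by (simp add: power2_eq_square)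
      then have "N \<le> X" unfolding X_def using m0 by (simp add: less_eq_div_iff_mult_less_eq)
      then show ?thesis using p by simp
    qed
    have "real (card (?Q m)) * ln (real N) = (\<Sum>q\<in>?Q m. ln (real N))" by simp
    also have "\<dots> \<le> (\<Sum>q\<in>?Q m. ln (real q))"
    proof (rule sum_mono)
      fix q assume "q \<in> ?Q m"
      then have "q > N" using cofactor_primes_gt[OF m0(2)] by blast
      then show "ln (real N) \<le> ln (real q)" using N by (subst ln_le_cancel_iff) auto
    qed
    also have "\<dots> \<le> 16 * real X * ?e m"
    proof (cases "p dvd m")
      case True
      have "(\<Sum>q\<in>?Q m. ln (real q)) = (\<Sum>q\<in>?Q m. mangoldt q)"
        by (intro sum.cong refl) (auto simp: cofactor_primes_def primes14_def)
      also have "\<dots> \<le> cheb_psi X"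
        unfolding cheb_psi_def X_def using m0(1)
        by (intro sum_mono2) (auto simp: cofactor_primes_altdef primes14_def Suc_le_eq prime_gt_0_nat intro: mangoldt_nonneg)
      also have "\<dots> \<le> 4 * real X" by (rule cheb_psi_le)
      also have "\<dots> \<le> 16 * real X * 1" by simp
      also have "\<dots> \<le> 16 * real X * ?e m" using True lnp p2 by (intro mult_left_mono) auto
      finally show ?thesis .
    next
      case False
      show ?thesis
      proof (cases "?Q m = {}")
        case True
        then show ?thesis using lnp p2 by (simp only: sum.empty) (auto intro!: mult_nonneg_nonneg divide_nonneg_nonneg)
      next
        case nonempty: False
        \<comment> \<open>An arbitrary member fixes the class of q, in place of an inverse of m
          modulo p.\<close>
        then obtain q0 where q0: "q0 \<in> ?Q m" by blast
        have cop: "coprime m p" using False p(1) prime_imp_coprime[of p m] by (simp add: coprime_commute)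
        have "?Q m \<subseteq> {q. prime q \<and> q \<le> X \<and> q mod p = q0 mod p}"
        proof
          fix q assume q: "q \<in> ?Q m"
          then have "[q * m = q0 * m] (mod p)" using q0 by (simp add: Cong.cong_def)
          then have "[q = q0] (mod p)" using cop by (simp add: cong_mult_rcancel_nat)
          then show "q \<in> {q. prime q \<and> q \<le> X \<and> q mod p = q0 mod p}"
            using q m0 by (auto simp: Cong.cong_def cofactor_primes_altdef primes14_def X_def)
        qed
        then have "(\<Sum>q\<in>?Q m. ln (real q)) \<le> (\<Sum>q | prime q \<and> q \<le> X \<and> q mod p = q0 mod p. ln (real q))"
          by (intro sum_mono2) (auto intro!: ln_ge_zero simp: Suc_le_eq prime_gt_0_nat)
        also have "\<dots> \<le> 16 * real X * (ln (real p) / real p)"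
          using p pX by (intro theta_progression_le)
        also have "\<dots> = 16 * real X * ?e m" using False by simp
        finally show ?thesis .
      qed
    qed
    also have "\<dots> \<le> 16 * (real (K * N\<^sup>2) / real m) * ?e m"
      using XR lnp by (intro mult_right_mono mult_left_mono) auto
    finally show ?thesis .
  qed
  have "{t \<in> two_square_products K N. t mod p = b} = (\<lambda>(m,q). q * m) ` (SIGMA m:?M. ?Q m)"
    unfolding two_square_products_image by force
  moreover have "finite (SIGMA m:?M. ?Q m)"
    using finite_cofactor_primes D14_pos by (intro finite_SigmaI) auto
  ultimately have "card {t \<in> two_square_products K N. t mod p = b} \<le> card (SIGMA m:?M. ?Q m)"
    by (simp only: card_image_le)
  also have "\<dots> = (\<Sum>m\<in>?M. card (?Q m))"
    using finite_cofactor_primes D14_pos by (intro card_SigmaI) auto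
  finally have "real (card {t \<in> two_square_products K N. t mod p = b}) \<le> (\<Sum>m\<in>?M. real (card (?Q m)))"
    by (simp flip: of_nat_sum)
  then have "real (card {t \<in> two_square_products K N. t mod p = b}) * ln (real N) \<le> (\<Sum>m\<in>?M. real (card (?Q m))) * ln (real N)"
    using lnN by (rule mult_right_mono)
  also have "\<dots> = (\<Sum>m\<in>?M. real (card (?Q m)) * ln (real N))" by (rule sum_distrib_right)
  also have "\<dots> \<le> (\<Sum>m\<in>?M. 16 * (real (K * N\<^sup>2) / real m) * ?e m)" by (intro sum_mono each)
  also have "\<dots> = (\<Sum>m\<in>?M. 16 * real (K * N\<^sup>2) * ((ln (real p) / real p) * (1 / real m) + (if p dvd m then 1 / real m else 0)))"
    by (intro sum.cong refl) (auto simp: algebra_simps add_divide_distrib)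
  also have "\<dots> = 16 * real (K * N\<^sup>2) * ((ln (real p) / real p) * D14_harm N + (\<Sum>m\<in>?M. if p dvd m then 1 / real m else 0))"
    by (simp only: sum_distrib_left[symmetric] sum.distrib D14_harm_def)
  also have "(\<Sum>m\<in>?M. if p dvd m then 1 / real m else 0) = (\<Sum>m | m \<in> D14 \<and> m \<le> N \<and> p dvd m. 1 / real m)"
    by (subst sum.inter_filter[symmetric]) (auto intro!: sum.cong)
  also have "\<dots> \<le> D14_harm N / real p" by (rule D14_harm_multiples_le[OF p(1)])
  \<comment> \<open>As ln p >= 1/2, the multiples of p cost 2 units on top of the 1 from the
    progressions: 16 (1 + 2) = 48.\<close>
  also have "\<dots> \<le> 2 * ((ln (real p) / real p) * D14_harm N)"
  proof -
    have "D14_harm N * 1 \<le> D14_harm N * (2 * ln (real p))"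
      using lnp D14_harm_nonneg by (intro mult_left_mono) auto
    then show ?thesis using p2 by (simp add: field_simps)
  qed
  finally have "real (card {t \<in> two_square_products K N. t mod p = b}) * ln (real N)
      \<le> 16 * real (K * N\<^sup>2) * ((ln (real p) / real p) * D14_harm N + 2 * ((ln (real p) / real p) * D14_harm N))"
    by (simp add: mult_left_mono)
  then show ?thesis by (simp add: algebra_simps)
qed

text \<open>The ideal proportion in a class is about 1/p; the loss ln p is harmless because classes
  are later weighted by p powr (-1/2).\<close>

definition well_distributed :: "nat \<Rightarrow> real \<Rightarrow> real \<Rightarrow> nat \<Rightarrow> nat set \<Rightarrow> bool" where
  "well_distributed K c C N T \<longleftrightarrow> finite T \<and> T \<subseteq> sums_of_two_squares
     \<and> (\<forall>t\<in>T. N\<^sup>2 < t \<and> t \<le> K * N\<^sup>2)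
     \<and> c * real (N\<^sup>2) / sqrt (ln (real N)) \<le> real (card T)
     \<and> (\<forall>p b. prime p \<longrightarrow> p \<le> N \<longrightarrow>
           real (card {t \<in> T. t mod p = b}) \<le> C * (ln (real p) / real p) * real (card T))"

lemma well_distributed_two_squares:
  obtains K :: nat and c C :: real where "K \<ge> 2" "c > 0" "C > 0"
    "\<And>N. N \<ge> 2 \<Longrightarrow> \<exists>T. well_distributed K c C N T"
proof -
  obtain K where K: "K \<ge> 2"
    and int: "\<And>u v. u \<ge> 1 \<Longrightarrow> v \<ge> K * u \<Longrightarrow> (\<Sum>q | q \<in> primes14 \<and> u < q \<and> q \<le> v. ln (real q) / real q) \<ge> 1"
    using primes14_interval by metis
  \<comment> \<open>Chosen so that ln (K N^2) = ln K + 2 ln N is at most B ln N, using ln N >=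
    1/2.\<close>
  define B where "B = 2 * ln (real K) + 2"
  have lnK: "ln (real K) \<ge> 0" using K by simp
  have B: "B > 0" using lnK by (simp add: B_def)
  define c where "c = 1 / (sqrt 6 * B)"
  define C where "C = 48 * real K * B"
  have "well_distributed K c C N (two_square_products K N)" if N: "N \<ge> 2" for N
    unfolding well_distributed_def
  proof (intro conjI allI impI finite_two_square_products two_square_products_subset)
    show "\<forall>t\<in>two_square_products K N. N\<^sup>2 < t \<and> t \<le> K * N\<^sup>2" by (auto simp: two_square_products_def)
    let ?T = "real (card (two_square_products K N))"
    have lnN: "ln (real N) \<ge> 1/2"
    proof -
      have "ln 2 \<le> ln (real N)" using N by (subst ln_le_cancel_iff) auto
      then show ?thesis using ln2_ge_two_thirds by simp
    qed
    have "ln (real (K * N\<^sup>2)) = ln (real K) + 2 * ln (real N)"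
      using K N by (simp add: ln_mult_pos ln_realpow)
    also have "\<dots> \<le> 2 * ln (real K) * ln (real N) + 2 * ln (real N)"
      using mult_left_mono[of 1 "2 * ln (real N)" "ln (real K)"] lnK lnN by simp
    also have "\<dots> = B * ln (real N)" by (simp add: B_def algebra_simps)
    finally have lnKN: "ln (real (K * N\<^sup>2)) \<le> B * ln (real N)" .
    have "real (N\<^sup>2) * D14_harm N \<le> ?T * ln (real (K * N\<^sup>2))"
      by (rule card_two_square_products_ge[OF K int N])
    also have "\<dots> \<le> ?T * (B * ln (real N))" using lnKN by (intro mult_left_mono) auto
    finally have low: "real (N\<^sup>2) * D14_harm N \<le> ?T * (B * ln (real N))" .
    have "sqrt (ln (real N) / 6) \<le> D14_harm N"
      using D14_harm_ge[of N] N D14_harm_nonneg by (intro real_le_lsqrt) auto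
    then have "real (N\<^sup>2) * sqrt (ln (real N) / 6) \<le> real (N\<^sup>2) * D14_harm N" by (intro mult_left_mono) auto
    also note low
    finally have "real (N\<^sup>2) * (sqrt (ln (real N)) / sqrt 6) \<le> ?T * (B * (sqrt (ln (real N)) * sqrt (ln (real N))))"
      using lnN by (simp add: real_sqrt_divide)
    then have "sqrt (ln (real N)) * (real (N\<^sup>2) / sqrt 6) \<le> sqrt (ln (real N)) * (?T * B * sqrt (ln (real N)))"
      by (simp only: times_divide_eq_right mult_ac)
    moreover have sq: "sqrt (ln (real N)) > 0" using lnN by simp
    ultimately have "real (N\<^sup>2) / sqrt 6 \<le> ?T * B * sqrt (ln (real N))"
      by (simp only: mult_le_cancel_left_pos)
    then show "c * real (N\<^sup>2) / sqrt (ln (real N)) \<le> ?T"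
      using sq B by (simp add: c_def field_simps)
    fix p b :: nat assume p: "prime p" "p \<le> N"
    let ?e = "ln (real p) / real p"
    have e0: "?e \<ge> 0" using prime_ge_1_nat[OF p(1)] by simp
    have "real (card {t \<in> two_square_products K N. t mod p = b}) * ln (real N)
        \<le> 48 * real K * ?e * (real (N\<^sup>2) * D14_harm N)"
      using card_two_square_products_residue_le[OF K N p, of b] by (simp add: mult_ac)
    also have "\<dots> \<le> 48 * real K * ?e * (?T * (B * ln (real N)))"
      using low e0 by (intro mult_left_mono mult_nonneg_nonneg) auto
    also have "\<dots> = (C * ?e * ?T) * ln (real N)" by (simp add: C_def)
    finally show "real (card {t \<in> two_square_products K N. t mod p = b}) \<le> C * ?e * ?T"
      using lnN by (simp only: mult_le_cancel_right)
  qed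
  moreover have "c > 0" "C > 0" using B K by (auto simp: c_def C_def)
  ultimately show ?thesis
    using K that by blast
qed

subsection \<open>Differences of polynomial values\<close>

text \<open>Horner induction on a + s g(s). Growth with slope 1 and values at least 1 are proved
  together: the value of g at t supplies the slope of the product. The conditional covers constants,
  with which the induction starts.\<close>

lemma int_poly_eventually_increasing:
  fixes f :: "int poly"
  assumes "lead_coeff f > 0"
  shows "\<exists>s0. \<forall>s\<ge>s0. poly f s \<ge> 1 \<and> (\<forall>t\<ge>s. poly f s + (if degree f = 0 then 0 else t - s) \<le> poly f t)"
  using assms
proof (induction f rule: pCons_induct)
  case 0
  then show ?case by simp
next
  case (pCons a g)
  show ?case
  proof (cases "g = 0")
    case True
    then show ?thesis using pCons.prems by (auto intro!: exI[of _ 0])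
  next
    case False
    then have "lead_coeff g > 0" using pCons.prems by simp
    then obtain s1 where s1: "\<And>s. s \<ge> s1 \<Longrightarrow> poly g s \<ge> 1"
      "\<And>s t. s \<ge> s1 \<Longrightarrow> t \<ge> s \<Longrightarrow> poly g s + (if degree g = 0 then 0 else t - s) \<le> poly g t"
      using pCons.IH by blast
    have mono: "poly g s \<le> poly g t" if "s \<ge> s1" "t \<ge> s" for s t
      using s1(2)[OF that] that by (auto split: if_splits)
    show ?thesis
    proof (intro exI[of _ "\<bar>s1\<bar> + \<bar>a\<bar> + 1"] allI impI conjI)
      fix s assume s: "s \<ge> \<bar>s1\<bar> + \<bar>a\<bar> + 1"
      have "s * 1 \<le> s * poly g s" using s s1(1)[of s] by (intro mult_left_mono) auto
      then show "1 \<le> poly (pCons a g) s" using s by simp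
      fix t assume t: "t \<ge> s"
      have "s * poly g s \<le> s * poly g t" using mono[of s t] s t by (intro mult_left_mono) auto
      moreover have "(t - s) * 1 \<le> (t - s) * poly g t" using s1(1)[of t] s t by (intro mult_left_mono) auto
      ultimately have "s * poly g s + (t - s) \<le> t * poly g t" by (simp add: algebra_simps)
      then show "poly (pCons a g) s + (if degree (pCons a g) = 0 then 0 else t - s) \<le> poly (pCons a g) t"
        using False by simp
    qed
  qed
qed

lemma int_poly_upper_bound:
  fixes f :: "int poly"
  obtains B :: nat where "B > 0" "\<And>s::nat. s \<ge> 1 \<Longrightarrow> poly f (int s) \<le> int (B * s ^ degree f)"
proof -
  define B where "B = nat (\<Sum>i\<le>degree f. \<bar>Polynomial.coeff f i\<bar>) + 1"
  have "poly f (int s) \<le> int (B * s ^ degree f)" if s: "s \<ge> 1" for s :: nat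
  proof -
    have "poly f (int s) = (\<Sum>i\<le>degree f. Polynomial.coeff f i * int s ^ i)" by (rule poly_altdef)
    also have "\<dots> \<le> (\<Sum>i\<le>degree f. \<bar>Polynomial.coeff f i\<bar> * int s ^ degree f)"
      using s by (intro sum_mono mult_mono power_increasing) auto
    also have "\<dots> = (\<Sum>i\<le>degree f. \<bar>Polynomial.coeff f i\<bar>) * int s ^ degree f"
      by (rule sum_distrib_right[symmetric])
    also have "\<dots> \<le> int B * int s ^ degree f"
      by (intro mult_right_mono) (auto simp: B_def sum_nonneg)
    finally show ?thesis by simp
  qed
  moreover have "B > 0" by (simp add: B_def)
  ultimately show ?thesis using that by blast
qed

lemma card_prime_factors_le:
  assumes "r > 0"
  shows "real (card (prime_factors r)) \<le> 2 * ln (real r)"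
proof -
  have "2 ^ card (prime_factors r) = (\<Prod>p\<in>prime_factors r. 2 :: nat)" by simp
  also have "\<dots> \<le> (\<Prod>p\<in>prime_factors r. p ^ multiplicity p r)"
  proof (rule prod_mono)
    fix p assume p: "p \<in> prime_factors r"
    then have "prime p" "multiplicity p r > 0" by (auto simp: prime_factors_multiplicity)
    then have "2 \<le> p" "p \<le> p ^ multiplicity p r" using prime_ge_2_nat[of p] by (auto intro!: self_le_power)
    then show "0 \<le> (2::nat) \<and> 2 \<le> p ^ multiplicity p r" by simp
  qed
  also have "\<dots> = r" using prime_factorization_nat[OF assms] by simp
  finally have "(2::real) ^ card (prime_factors r) \<le> real r"
    by (metis of_nat_le_iff of_nat_numeral of_nat_power)
  then have "ln (2 ^ card (prime_factors r)) \<le> ln (real r)"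
    using assms by (subst ln_le_cancel_iff) auto
  then have "real (card (prime_factors r)) * ln 2 \<le> ln (real r)" by (simp add: ln_realpow)
  moreover have "real (card (prime_factors r)) * (1/2) \<le> real (card (prime_factors r)) * ln 2"
    using ln2_ge_two_thirds by (intro mult_left_mono) auto
  ultimately show ?thesis by linarith
qed

text \<open>ln p <= 4 p powr (1/4) leaves the exponent -1/2 + 1/4 - 1 = -5/4.\<close>

lemma sum_ln_over_powr_bounded:
  obtains Z :: real where "Z > 0" "\<And>N. (\<Sum>p | prime p \<and> p \<le> N. (1 / sqrt (real p)) * (ln (real p) / real p)) \<le> Z"
proof -
  let ?b = "\<lambda>n::nat. 4 * real n powr (-5/4)"
  have sb: "summable ?b" by (intro summable_mult) (simp add: summable_real_powr_iff)
  have "(\<Sum>p | prime p \<and> p \<le> N. (1 / sqrt (real p)) * (ln (real p) / real p)) \<le> suminf ?b + 1" for N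
  proof -
    have "(\<Sum>p | prime p \<and> p \<le> N. (1 / sqrt (real p)) * (ln (real p) / real p)) \<le> (\<Sum>p | prime p \<and> p \<le> N. ?b p)"
    proof (rule sum_mono)
      fix p assume "p \<in> {p. prime p \<and> p \<le> N}"
      then have p: "real p > 0" using prime_gt_0_nat by simp
      have "ln (real p) = 4 * ln (real p powr (1/4))" using p by (simp add: ln_powr)
      also have "\<dots> \<le> 4 * real p powr (1/4)" using p ln_bound[of "real p powr (1/4)"] by simp
      finally have "(1 / sqrt (real p)) * (ln (real p) / real p) \<le> (1 / sqrt (real p)) * (4 * real p powr (1/4) / real p)"
        using p by (intro mult_left_mono divide_right_mono) auto
      also have "\<dots> = 4 * (real p powr (-1/2) * real p powr (1/4) * real p powr (-1))"
        using p by (simp add: powr_minus_divide powr_half_sqrt)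
      also have "\<dots> = ?b p" by (simp only: powr_add[symmetric]) simp
      finally show "(1 / sqrt (real p)) * (ln (real p) / real p) \<le> ?b p" .
    qed
    also have "\<dots> \<le> suminf ?b" by (intro sum_le_suminf sb) auto
    finally show ?thesis by simp
  qed
  moreover have "suminf ?b + 1 > 0" using suminf_nonneg[OF sb] by simp
  ultimately show ?thesis using that by blast
qed

text \<open>Lagrange's theorem for f - f(t), each root class holding at most E elements. Primes up
  to the leading coefficient may divide it and get the trivial bound; there are boundedly many of
  them.\<close>

lemma card_poly_congruent_le:
  fixes f :: "int poly" and T :: "nat set"
  assumes f: "degree f \<ge> 1" "lead_coeff f > 0" and T: "finite T" and p: "prime p"
    and E: "E \<ge> 0" "\<And>b. real (card {t \<in> T. t mod p = b}) \<le> E"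
  shows "real (card {s \<in> T. int p dvd poly f (int t) - poly f (int s)})
      \<le> real (degree f) * E + (if int p \<le> lead_coeff f then real (card T) else 0)"
proof (cases "int p \<le> lead_coeff f")
  case True
  have "real (card {s \<in> T. int p dvd poly f (int t) - poly f (int s)}) \<le> real (card T)"
    using T by (auto intro!: card_mono)
  then show ?thesis using True E by (simp add: add_increasing)
next
  case False
  define g where "g = f - [:poly f (int t):]"
  have deg: "degree g = degree f" unfolding g_def
    using f by (metis degree_pCons_0 diff_conv_add_uminus degree_add_eq_left degree_minus less_eq_Suc_le One_nat_def)
  have "lead_coeff g = lead_coeff f"
    unfolding deg using f by (cases "degree f") (auto simp: g_def)
  then have "\<not> int p dvd lead_coeff g" using False f by (auto dest: zdvd_imp_le)
  then have R: "card {b \<in> {0..<int p}. int p dvd poly g b} \<le> degree f"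
    using card_poly_roots_mod_prime_le[OF p, of g] deg by simp
  let ?R = "{b \<in> {0..<int p}. int p dvd poly g b}"
  have fin: "finite ?R" by (rule finite_subset[of _ "{0..<int p}"]) auto
  have "{s \<in> T. int p dvd poly f (int t) - poly f (int s)} \<subseteq> (\<Union>b\<in>?R. {s \<in> T. s mod p = nat b})"
  proof
    fix s assume s: "s \<in> {s \<in> T. int p dvd poly f (int t) - poly f (int s)}"
    have p0: "p > 0" using p prime_gt_0_nat by simp
    have "int p dvd poly g (int s)" using s by (simp add: g_def dvd_diff_commute)
    moreover have "[poly g (int s mod int p) = poly g (int s)] (mod int p)"
      unfolding poly_altdef by (intro cong_sum cong_mult cong_pow cong_refl) (simp add: Cong.cong_def)
    ultimately have "int p dvd poly g (int s mod int p)"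
      by (simp add: cong_dvd_iff)
    then have "int s mod int p \<in> ?R" using p0 by simp
    moreover have "s mod p = nat (int s mod int p)" by (simp add: nat_mod_as_int)
    ultimately show "s \<in> (\<Union>b\<in>?R. {s \<in> T. s mod p = nat b})" using s by blast
  qed
  then have "card {s \<in> T. int p dvd poly f (int t) - poly f (int s)} \<le> card (\<Union>b\<in>?R. {s \<in> T. s mod p = nat b})"
    using fin T by (intro card_mono) auto
  also have "\<dots> \<le> (\<Sum>b\<in>?R. card {s \<in> T. s mod p = nat b})" by (rule card_UN_le[OF fin])
  finally have "real (card {s \<in> T. int p dvd poly f (int t) - poly f (int s)}) \<le> (\<Sum>b\<in>?R. real (card {s \<in> T. s mod p = nat b}))"
    by (simp flip: of_nat_sum)
  also have "\<dots> \<le> (\<Sum>b\<in>?R. E)" by (intro sum_mono E)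
  also have "\<dots> \<le> real (degree f) * E" using R E(1) by (simp add: mult_right_mono)
  finally show ?thesis using False by simp
qed

text \<open>After exchanging the sums over s and p, primes p <= N contribute a convergent series. A
  difference r has at most 2 ln r <= 2 L sqrt N prime factors, so those beyond N contribute at most
  2 L. \<open>M\<close> is separate from \<open>card T\<close> because the application is to the
  part of a set below t, whose classes are controlled by the whole set.\<close>

lemma ratio_totient_difference_sum_le:
  fixes f :: "int poly"
  assumes f: "degree f \<ge> 1" "lead_coeff f > 0" and "L \<ge> 0" "C0 \<ge> 0"
  obtains C :: real where "C > 0"
    "\<And>T N t M. finite T \<Longrightarrow> N \<ge> 1 \<Longrightarrow> real (card T) \<le> M \<Longrightarrow>
       (\<And>p b. prime p \<Longrightarrow> p \<le> N \<Longrightarrow> real (card {s \<in> T. s mod p = b}) \<le> C0 * (ln (real p) / real p) * M) \<Longrightarrow>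
       (\<And>s. s \<in> T \<Longrightarrow> 0 < poly f (int t) - poly f (int s) \<and> ln (poly f (int t) - poly f (int s)) \<le> L * sqrt (real N)) \<Longrightarrow>
       (\<Sum>s\<in>T. real (nat (poly f (int t) - poly f (int s))) / real (totient (nat (poly f (int t) - poly f (int s)))))
         \<le> C * M"
proof -
  obtain C1 where C1: "C1 > 0"
    "\<And>r. r \<ge> 1 \<Longrightarrow> real r / real (totient r) \<le> C1 * (1 + (\<Sum>p\<in>prime_factors r. 1 / sqrt (real p)))"
    using ratio_totient_le by metis
  obtain Z where Z: "Z > 0" "\<And>N. (\<Sum>p | prime p \<and> p \<le> N. (1 / sqrt (real p)) * (ln (real p) / real p)) \<le> Z"
    using sum_ln_over_powr_bounded by metis
  define d where "d = real (degree f)"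
  define l where "l = real_of_int (lead_coeff f)"
  \<comment> \<open>Inside: the leading 1, the class counts for p <= N, the trivial counts for p up
    to the leading coefficient (at most \<open>l + 1\<close> of them), and the primes beyond
    N.\<close>
  define C where "C = C1 * (1 + (d * C0 * Z + (l + 1)) + 2 * L)"
  have dl: "d \<ge> 1" "l > 0" using f by (auto simp: d_def l_def)
  have main: "(\<Sum>s\<in>T. real (nat (poly f (int t) - poly f (int s))) / real (totient (nat (poly f (int t) - poly f (int s)))))
         \<le> C * M"
    if T: "finite T" and N: "N \<ge> 1" and M: "real (card T) \<le> M"
      and eq: "\<And>p b. prime p \<Longrightarrow> p \<le> N \<Longrightarrow> real (card {s \<in> T. s mod p = b}) \<le> C0 * (ln (real p) / real p) * M"
      and pos: "\<And>s. s \<in> T \<Longrightarrow> 0 < poly f (int t) - poly f (int s) \<and> ln (poly f (int t) - poly f (int s)) \<le> L * sqrt (real N)"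
    for T N t M
  proof -
    define r where "r = (\<lambda>s. nat (poly f (int t) - poly f (int s)))"
    let ?P = "{p. prime p \<and> p \<le> N}"
    have M0: "M \<ge> 0" using M by linarith
    have finP: "finite ?P" by (rule finite_subset[of _ "{..N}"]) auto
    have r1: "r s \<ge> 1" if "s \<in> T" for s using pos[OF that] by (simp add: r_def Suc_le_eq)
    have dvd_r: "p dvd r s \<longleftrightarrow> int p dvd poly f (int t) - poly f (int s)" if "s \<in> T" for p s
      using pos[OF that] by (simp add: r_def nat_dvd_iff flip: int_dvd_int_iff)
    have each: "real (r s) / real (totient (r s)) \<le> C1 * (1 + (\<Sum>p\<in>?P. if p dvd r s then 1 / sqrt (real p) else 0) + 2 * L)"
      if s: "s \<in> T" for s
    proof -
      have "(\<Sum>p\<in>prime_factors (r s). 1 / sqrt (real p))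
          = (\<Sum>p | p \<in> prime_factors (r s) \<and> p \<le> N. 1 / sqrt (real p)) + (\<Sum>p | p \<in> prime_factors (r s) \<and> \<not> p \<le> N. 1 / sqrt (real p))"
        by (subst sum.union_disjoint[symmetric]) (auto intro!: sum.cong)
      also have "(\<Sum>p | p \<in> prime_factors (r s) \<and> p \<le> N. 1 / sqrt (real p)) = (\<Sum>p | p \<in> ?P \<and> p dvd r s. 1 / sqrt (real p))"
        using r1[OF s] by (intro sum.cong) (auto simp: in_prime_factors_iff)
      also have "\<dots> = (\<Sum>p\<in>?P. if p dvd r s then 1 / sqrt (real p) else 0)"
        by (rule sum.inter_filter[OF finP])
      also have "(\<Sum>p | p \<in> prime_factors (r s) \<and> \<not> p \<le> N. 1 / sqrt (real p)) \<le> (\<Sum>p | p \<in> prime_factors (r s) \<and> \<not> p \<le> N. 1 / sqrt (real N))"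
        using N by (intro sum_mono divide_left_mono) auto
      also have "\<dots> \<le> (\<Sum>p\<in>prime_factors (r s). 1 / sqrt (real N))" by (intro sum_mono2) auto
      also have "\<dots> = real (card (prime_factors (r s))) * (1 / sqrt (real N))" by simp
      also have "\<dots> \<le> (2 * (L * sqrt (real N))) * (1 / sqrt (real N))"
      proof (rule mult_right_mono)
        have "real (r s) = of_int (poly f (int t) - poly f (int s))" using pos[OF s] by (simp add: r_def)
        then have "ln (real (r s)) \<le> L * sqrt (real N)" using pos[OF s] by simp
        then show "real (card (prime_factors (r s))) \<le> 2 * (L * sqrt (real N))"
          using card_prime_factors_le[of "r s"] r1[OF s] by simp
      qed simp
      also have "\<dots> = 2 * L" using N by simp
      finally have "1 + (\<Sum>p\<in>prime_factors (r s). 1 / sqrt (real p)) \<le> 1 + (\<Sum>p\<in>?P. if p dvd r s then 1 / sqrt (real p) else 0) + 2 * L"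
        by simp
      then have "C1 * (1 + (\<Sum>p\<in>prime_factors (r s). 1 / sqrt (real p))) \<le> C1 * (1 + (\<Sum>p\<in>?P. if p dvd r s then 1 / sqrt (real p) else 0) + 2 * L)"
        using C1(1) by (intro mult_left_mono) auto
      then show ?thesis using C1(2)[OF r1[OF s]] by linarith
    qed
    have "(\<Sum>s\<in>T. \<Sum>p\<in>?P. if p dvd r s then 1 / sqrt (real p) else 0) = (\<Sum>p\<in>?P. \<Sum>s\<in>T. if p dvd r s then 1 / sqrt (real p) else 0)"
      by (rule sum.swap)
    also have "\<dots> = (\<Sum>p\<in>?P. (1 / sqrt (real p)) * real (card {s \<in> T. int p dvd poly f (int t) - poly f (int s)}))"
    proof (rule sum.cong[OF refl])
      fix p
      have "(\<Sum>s\<in>T. if p dvd r s then 1 / sqrt (real p) else 0) = (\<Sum>s | s \<in> T \<and> p dvd r s. 1 / sqrt (real p))"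
        by (rule sum.inter_filter[OF T, symmetric])
      also have "{s. s \<in> T \<and> p dvd r s} = {s \<in> T. int p dvd poly f (int t) - poly f (int s)}"
        using dvd_r by blast
      finally show "(\<Sum>s\<in>T. if p dvd r s then 1 / sqrt (real p) else 0)
          = (1 / sqrt (real p)) * real (card {s \<in> T. int p dvd poly f (int t) - poly f (int s)})" by simp
    qed
    also have "\<dots> \<le> (\<Sum>p\<in>?P. (1 / sqrt (real p)) * (d * (C0 * (ln (real p) / real p) * M) + (if int p \<le> lead_coeff f then M else 0)))"
    proof (intro sum_mono mult_left_mono)
      fix p assume p: "p \<in> ?P"
      have "real (card {s \<in> T. int p dvd poly f (int t) - poly f (int s)})
          \<le> d * (C0 * (ln (real p) / real p) * M) + (if int p \<le> lead_coeff f then real (card T) else 0)"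
        unfolding d_def using p eq assms M0 prime_ge_1_nat[of p]
        by (intro card_poly_congruent_le f T) (auto intro!: mult_nonneg_nonneg divide_nonneg_nonneg ln_ge_zero)
      then show "real (card {s \<in> T. int p dvd poly f (int t) - poly f (int s)})
          \<le> d * (C0 * (ln (real p) / real p) * M) + (if int p \<le> lead_coeff f then M else 0)"
        using M by (auto split: if_splits)
    qed simp
    also have "\<dots> = (\<Sum>p\<in>?P. (d * C0 * M) * ((1 / sqrt (real p)) * (ln (real p) / real p)) +
        M * (if int p \<le> lead_coeff f then 1 / sqrt (real p) else 0))"
      by (intro sum.cong refl) (simp add: algebra_simps)
    also have "\<dots> = d * C0 * M * (\<Sum>p\<in>?P. (1 / sqrt (real p)) * (ln (real p) / real p)) +
        M * (\<Sum>p\<in>?P. if int p \<le> lead_coeff f then 1 / sqrt (real p) else 0)"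
      by (simp only: sum.distrib sum_distrib_left)
    also have "\<dots> \<le> d * C0 * M * Z + M * (l + 1)"
    proof (intro add_mono mult_left_mono Z)
      have "(\<Sum>p\<in>?P. if int p \<le> lead_coeff f then 1 / sqrt (real p) else 0) = (\<Sum>p | p \<in> ?P \<and> int p \<le> lead_coeff f. 1 / sqrt (real p))"
        by (rule sum.inter_filter[OF finP, symmetric])
      also have "\<dots> \<le> (\<Sum>p | p \<in> ?P \<and> int p \<le> lead_coeff f. 1)"
        by (intro sum_mono) (auto simp: Suc_le_eq prime_gt_0_nat)
      also have "\<dots> \<le> (\<Sum>p\<in>{..nat (lead_coeff f)}. 1)" by (intro sum_mono2) auto
      also have "\<dots> = l + 1" using f by (simp add: l_def)
      finally show "(\<Sum>p\<in>?P. if int p \<le> lead_coeff f then 1 / sqrt (real p) else 0) \<le> l + 1" .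
    qed (use assms dl M0 in auto)
    finally have S: "(\<Sum>s\<in>T. \<Sum>p\<in>?P. if p dvd r s then 1 / sqrt (real p) else 0)
        \<le> d * C0 * M * Z + M * (l + 1)" .
    have "(\<Sum>s\<in>T. real (r s) / real (totient (r s))) \<le> (\<Sum>s\<in>T. C1 * (1 + (\<Sum>p\<in>?P. if p dvd r s then 1 / sqrt (real p) else 0) + 2 * L))"
      by (intro sum_mono each)
    also have "\<dots> = C1 * ((\<Sum>s\<in>T. \<Sum>p\<in>?P. if p dvd r s then 1 / sqrt (real p) else 0) + real (card T) * (1 + 2 * L))"
      unfolding sum_distrib_left[symmetric] sum.distrib by (simp add: algebra_simps)
    also have "\<dots> \<le> C1 * (d * C0 * M * Z + M * (l + 1) + M * (1 + 2 * L))"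
      using S C1(1) M \<open>L \<ge> 0\<close> by (intro mult_left_mono add_mono mult_right_mono) auto
    also have "\<dots> = C * M" by (simp add: C_def algebra_simps)
    finally show ?thesis by (simp add: r_def)
  qed
  have "C > 0" unfolding C_def
    using C1(1) Z(1) dl assms by (intro mult_pos_pos add_pos_nonneg) (auto intro!: mult_nonneg_nonneg add_nonneg_nonneg)
  then show ?thesis using main by (rule that)
qed

subsection \<open>The second moment\<close>

text \<open>Values hit fewer than \<open>card P / (2 * x)\<close> times account for at most half of
  \<open>P\<close>; Cauchy-Schwarz is applied to the rest. The last sum is the sum of squared fibre
  sizes, written over \<open>P\<close>.\<close>

lemma popular_values_card:
  fixes h :: "'a \<Rightarrow> nat" and x :: real
  assumes P: "finite P" and h: "\<And>p. p \<in> P \<Longrightarrow> 1 \<le> h p \<and> h p \<le> X" and X: "real X \<le> x" "x > 0"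
  shows "(real (card P))\<^sup>2 \<le> 4 * real (card {n \<in> {1..X}. real (card P) / (2 * x) \<le> real (card {p \<in> P. h p = n})})
      * (\<Sum>p\<in>P. real (card {q \<in> P. h q = h p}))"
proof -
  define r where "r = (\<lambda>n. real (card {p \<in> P. h p = n}))"
  define M where "M = real (card P)"
  let ?G = "{n \<in> {1..X}. M / (2 * x) \<le> r n}"
  have im: "h ` P \<subseteq> {1..X}" using h by auto
  have M: "M = (\<Sum>n=1..X. r n)"
    using sum_fun_comp[OF P _ im, of "\<lambda>_. 1 :: real"] by (simp add: M_def r_def)
  have M2: "(\<Sum>p\<in>P. r (h p)) = (\<Sum>n=1..X. (r n)\<^sup>2)"
    using sum_fun_comp[OF P _ im, of r] by (simp add: r_def power2_eq_square)
  have "(\<Sum>n=1..X. r n) = (\<Sum>n\<in>{1..X} - ?G. r n) + (\<Sum>n\<in>?G. r n)"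
    by (rule sum.subset_diff) auto
  then have "M = (\<Sum>n\<in>?G. r n) + (\<Sum>n\<in>{1..X} - ?G. r n)" using M by linarith
  also have "(\<Sum>n\<in>{1..X} - ?G. r n) \<le> (\<Sum>n\<in>{1..X} - ?G. M / (2 * x))"
    by (intro sum_mono) auto
  also have "\<dots> \<le> (\<Sum>n\<in>{1..X}. M / (2 * x))"
    using X by (intro sum_mono2) (auto simp: M_def)
  also have "\<dots> = real X * (M / (2 * x))" by simp
  also have "\<dots> \<le> x * (M / (2 * x))" using X by (intro mult_right_mono) (auto simp: M_def)
  also have "\<dots> = M / 2" using X by simp
  finally have "M / 2 \<le> (\<Sum>n\<in>?G. r n)" by simp
  then have "(M / 2)\<^sup>2 \<le> (\<Sum>n\<in>?G. r n)\<^sup>2" by (intro power_mono) (auto simp: M_def)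
  also have "\<dots> \<le> (\<Sum>n\<in>?G. (r n)\<^sup>2) * real (card ?G)" by (rule sum_squared_le_sum_of_squares)
  also have "\<dots> \<le> (\<Sum>n=1..X. (r n)\<^sup>2) * real (card ?G)"
    by (intro mult_right_mono sum_mono2) auto
  finally show ?thesis unfolding M2[symmetric] by (simp add: r_def M_def power2_eq_square mult_ac)
qed

text \<open>Coincidences are sorted by (s, t). The diagonal contributes \<open>card A\<close> for
  each t; off it, a coincidence is a pair of terms of \<open>a\<close> at distance |g t - g s|, and
  the two orders of s and t give the factor 2.\<close>

lemma sumset_second_moment_le:
  fixes a g :: "nat \<Rightarrow> nat" and D :: "nat \<Rightarrow> real"
  assumes A: "finite A" "inj_on a A" and T: "finite T" "inj_on g T"
    and D: "\<And>r. r \<ge> 1 \<Longrightarrow> real (card {k \<in> A. a k + r \<in> a ` A}) \<le> D r"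
  shows "(\<Sum>p\<in>A \<times> T. real (card {q \<in> A \<times> T. a (fst q) + g (snd q) = a (fst p) + g (snd p)}))
    \<le> real (card A) * real (card T) + 2 * (\<Sum>t\<in>T. \<Sum>s | s \<in> T \<and> g s < g t. D (g t - g s))"
proof -
  let ?N = "\<lambda>s t. {(k,l) \<in> A \<times> A. a k + g s = a l + g t}"
  let ?h = "\<lambda>p. a (fst p) + g (snd p)"
  have finN: "finite (?N s t)" for s t by (rule finite_subset[of _ "A \<times> A"]) (use A in auto)
  have up: "real (card (?N s t)) \<le> D (g t - g s)" if "g s < g t" for s t
  proof -
    have "card (?N s t) \<le> card {k \<in> A. a k + (g t - g s) \<in> a ` A}"
    proof (rule card_inj_on_le[of snd])
      show "inj_on snd (?N s t)" using A(2) by (auto simp: inj_on_def)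
      show "snd ` ?N s t \<subseteq> {k \<in> A. a k + (g t - g s) \<in> a ` A}"
      proof
        fix l assume "l \<in> snd ` ?N s t"
        then obtain k where k: "k \<in> A" "l \<in> A" "a k + g s = a l + g t" by auto
        then have "a l + (g t - g s) = a k" using that by simp
        then show "l \<in> {k \<in> A. a k + (g t - g s) \<in> a ` A}" using k by (metis (mono_tags, lifting) imageI mem_Collect_eq)
      qed
    qed (use A in auto)
    also have "real (card {k \<in> A. a k + (g t - g s) \<in> a ` A}) \<le> D (g t - g s)" using that by (intro D) auto
    finally show ?thesis by simp
  qed
  have down: "real (card (?N s t)) \<le> D (g s - g t)" if "g t < g s" for s t
  proof -
    have "card (?N s t) \<le> card (?N t s)"
      by (rule card_inj_on_le[of prod.swap]) (use finN in \<open>auto simp: inj_on_def\<close>)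
    then show ?thesis using up[OF that] by linarith
  qed
  have diag: "real (card (?N s t)) \<le> real (card A)" if "g s = g t" for s t
  proof -
    have "card (?N s t) \<le> card A"
      by (rule card_inj_on_le[of fst]) (use A that in \<open>auto simp: inj_on_def\<close>)
    then show ?thesis by simp
  qed
  have "(\<Sum>p\<in>A \<times> T. card {q \<in> A \<times> T. ?h q = ?h p}) = card (SIGMA p:A \<times> T. {q \<in> A \<times> T. ?h q = ?h p})"
    using A T by (intro card_SigmaI[symmetric]) auto
  also have "\<dots> \<le> card (SIGMA st:T \<times> T. ?N (fst st) (snd st))"
  proof (rule card_inj_on_le[of "\<lambda>((k,s),(l,t)). ((s,t),(k,l))"])
    show "(\<lambda>((k,s),(l,t)). ((s,t),(k,l))) ` (SIGMA p:A \<times> T. {q \<in> A \<times> T. ?h q = ?h p}) \<subseteq> (SIGMA st:T \<times> T. ?N (fst st) (snd st))"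
      by auto
  qed (use T finN in \<open>auto simp: inj_on_def\<close>)
  also have "\<dots> = (\<Sum>st\<in>T \<times> T. card (?N (fst st) (snd st)))"
    using T finN by (intro card_SigmaI) auto
  finally have "(\<Sum>p\<in>A \<times> T. real (card {q \<in> A \<times> T. ?h q = ?h p})) \<le> (\<Sum>st\<in>T \<times> T. real (card (?N (fst st) (snd st))))"
    by (simp flip: of_nat_sum)
  also have "\<dots> = (\<Sum>s\<in>T. \<Sum>t\<in>T. real (card (?N s t)))"
    by (simp add: sum.cartesian_product case_prod_beta)
  also have "\<dots> \<le> (\<Sum>s\<in>T. \<Sum>t\<in>T. (if s = t then real (card A) else 0)
      + (if g s < g t then D (g t - g s) else 0) + (if g t < g s then D (g s - g t) else 0))"
  proof (intro sum_mono)
    fix s t assume st: "s \<in> T" "t \<in> T"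
    then have "s = t \<longleftrightarrow> g s = g t" using T(2) by (auto dest: inj_onD)
    then show "real (card (?N s t)) \<le> (if s = t then real (card A) else 0)
      + (if g s < g t then D (g t - g s) else 0) + (if g t < g s then D (g s - g t) else 0)"
      using up[of s t] down[of t s] diag[of s t] by (cases "g s" "g t" rule: linorder_cases) auto
  qed
  also have "\<dots> = (\<Sum>s\<in>T. \<Sum>t\<in>T. if s = t then real (card A) else 0)
      + (\<Sum>s\<in>T. \<Sum>t\<in>T. if g s < g t then D (g t - g s) else 0)
      + (\<Sum>s\<in>T. \<Sum>t\<in>T. if g t < g s then D (g s - g t) else 0)"
    by (simp only: sum.distrib)
  also have "(\<Sum>s\<in>T. \<Sum>t\<in>T. if s = t then real (card A) else 0) = real (card A) * real (card T)"
    using T by simp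
  also have "(\<Sum>s\<in>T. \<Sum>t\<in>T. if g s < g t then D (g t - g s) else 0) = (\<Sum>t\<in>T. \<Sum>s\<in>T. if g s < g t then D (g t - g s) else 0)"
    by (rule sum.swap)
  also have "(\<Sum>t\<in>T. \<Sum>s\<in>T. if g s < g t then D (g t - g s) else 0) = (\<Sum>t\<in>T. \<Sum>s | s \<in> T \<and> g s < g t. D (g t - g s))"
    by (intro sum.cong refl sum.inter_filter[symmetric] T)
  finally show ?thesis by (simp add: algebra_simps)
qed

section \<open>Representations by the sequence and the polynomial\<close>

lemma pos_int_seq_ge:
  assumes "pos_int_seq a" "n \<ge> 1"
  shows "a n \<ge> n"
  using assms(2)
proof (induction n rule: dec_induct)
  case base
  then show ?case using assms(1) by (auto simp: pos_int_seq_def Suc_le_eq)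
next
  case (step n)
  have "a n < a (Suc n)"
    using assms(1) step.hyps by (auto simp: pos_int_seq_def intro: strict_mono_onD)
  then show ?case using step.IH by simp
qed

lemma finite_pos_int_seq_le:
  assumes "pos_int_seq a"
  shows "finite {n. n \<ge> 1 \<and> real (a n) \<le> x}"
proof (rule finite_subset)
  show "{n. n \<ge> 1 \<and> real (a n) \<le> x} \<subseteq> {..nat \<lfloor>x\<rfloor>}"
  proof
    fix n assume "n \<in> {n. n \<ge> 1 \<and> real (a n) \<le> x}"
    then have "n \<le> a n" "real (a n) \<le> x" using pos_int_seq_ge[OF assms] by auto
    then have "real n \<le> x" by linarith
    then show "n \<in> {..nat \<lfloor>x\<rfloor>}" by (simp add: le_nat_floor)
  qed
qed simp

text \<open>An infinite set has \<open>card\<close> 0, so \<open>rep_count\<close> dominates counts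
  over subsets only once this is known. Positivity of f bounds k, its eventual growth bounds
  s.\<close>

lemma finite_representations:
  assumes f: "degree f \<ge> 1" "lead_coeff f > 0" "\<forall>n::nat. n \<ge> 1 \<longrightarrow> poly f (int n) \<ge> 1"
    and a: "pos_int_seq a"
  shows "finite {(k, s). k \<ge> 1 \<and> s \<in> sums_of_two_squares \<and> int (a k) + poly f (int s) = int n}"
proof -
  obtain s0 where s0: "\<And>s t. s \<ge> s0 \<Longrightarrow> t \<ge> s \<Longrightarrow> poly f s + (t - s) \<le> poly f t"
    "\<And>s. s \<ge> s0 \<Longrightarrow> poly f s \<ge> 1"
    using int_poly_eventually_increasing[OF f(2)] f(1) by auto
  have "{(k, s). k \<ge> 1 \<and> s \<in> sums_of_two_squares \<and> int (a k) + poly f (int s) = int n}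
      \<subseteq> {..n} \<times> {..nat \<bar>s0\<bar> + n}"
  proof
    fix y assume "y \<in> {(k, s). k \<ge> 1 \<and> s \<in> sums_of_two_squares \<and> int (a k) + poly f (int s) = int n}"
    then obtain k s where y: "y = (k, s)" and k: "1 \<le> k" and s: "s \<in> sums_of_two_squares"
      and eq: "int (a k) + poly f (int s) = int n" by blast
    have "s \<ge> 1" using s by (simp add: sums_of_two_squares_def Suc_le_eq)
    then have "poly f (int s) \<ge> 1" using f(3) by simp
    then have "k \<le> n" using eq pos_int_seq_ge[OF a k] by linarith
    moreover have "s \<le> nat \<bar>s0\<bar> + n"
    proof (rule ccontr)
      assume "\<not> s \<le> nat \<bar>s0\<bar> + n"
      then have "int s > \<bar>s0\<bar> + int n" by linarith
      then have "poly f \<bar>s0\<bar> + (int s - \<bar>s0\<bar>) \<le> poly f (int s)" "poly f \<bar>s0\<bar> \<ge> 1"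
        using s0(1)[of "\<bar>s0\<bar>" "int s"] s0(2)[of "\<bar>s0\<bar>"] by auto
      then show False using eq \<open>int s > \<bar>s0\<bar> + int n\<close> by linarith
    qed
    ultimately show "y \<in> {..n} \<times> {..nat \<bar>s0\<bar> + n}" using y by simp
  qed
  then show ?thesis by (rule finite_subset) simp
qed

text \<open>Terms and polynomial values up to x / 2 keep every sum within x, which is why the
  sequence is counted at x / 2. \<open>thr\<close> is at most half the average number of
  representations.\<close>

lemma representations_second_moment:
  fixes f :: "int poly" and a :: "nat \<Rightarrow> nat" and x e C K4 thr :: real
  assumes f: "degree f \<ge> 1" "lead_coeff f > 0" "\<forall>n::nat. n \<ge> 1 \<longrightarrow> poly f (int n) \<ge> 1"
    and a: "pos_int_seq a" and x: "x \<ge> 2"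
    and pairs: "\<And>r. r \<ge> 1 \<Longrightarrow> real (seq_pair_count a x r) \<le> K4 * (real r / real (totient r)) * (x / e\<^sup>2)"
    and "K4 > 0" "e > 0"
    and T: "finite T" "T \<subseteq> sums_of_two_squares"
    and T_le: "\<And>t. t \<in> T \<Longrightarrow> real_of_int (poly f (int t)) \<le> x / 2"
    and T_mono: "\<And>s t. s \<in> T \<Longrightarrow> t \<in> T \<Longrightarrow> s < t \<Longrightarrow> poly f (int s) < poly f (int t)"
    and T_sum: "\<And>t. t \<in> T \<Longrightarrow> (\<Sum>s | s \<in> T \<and> s < t. real (nat (poly f (int t) - poly f (int s)))
           / real (totient (nat (poly f (int t) - poly f (int s))))) \<le> C * real (card T)"
    and thr: "thr \<le> real (seq_count a (x / 2)) * real (card T) / (2 * x)"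
  shows "(real (seq_count a (x / 2)) * real (card T))\<^sup>2
     \<le> 4 * real (card {n::nat. n \<ge> 1 \<and> real n \<le> x \<and> real (rep_count a f n) \<ge> thr})
        * (real (seq_count a (x / 2)) * real (card T) + 2 * (K4 * (x / e\<^sup>2)) * C * (real (card T))\<^sup>2)"
proof -
  define A where "A = {k. k \<ge> 1 \<and> real (a k) \<le> x / 2}"
  define g where "g = (\<lambda>s. nat (poly f (int s)))"
  define X where "X = nat \<lfloor>x\<rfloor>"
  let ?D = "\<lambda>r. K4 * (real r / real (totient r)) * (x / e\<^sup>2)"
  let ?h = "\<lambda>p. a (fst p) + g (snd p)"
  have Xx: "real X \<le> x" "\<And>n. real n \<le> x \<Longrightarrow> n \<le> X" using x by (auto simp: X_def le_nat_floor)
  have finA: "finite A" unfolding A_def by (rule finite_pos_int_seq_le[OF a])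
  have cardA: "card A = seq_count a (x / 2)" by (simp add: A_def seq_count_def)
  have injA: "inj_on a A"
    using a strict_mono_on_imp_inj_on[of "{1..}" a] by (auto simp: pos_int_seq_def A_def elim: inj_on_subset)
  have T1: "t \<ge> 1" "poly f (int t) \<ge> 1" if "t \<in> T" for t
  proof -
    have "t \<in> sums_of_two_squares" using T(2) that by blast
    then show "t \<ge> 1" by (simp add: sums_of_two_squares_def Suc_le_eq)
    then show "poly f (int t) \<ge> 1" using f(3) by simp
  qed
  have g: "int (g t) = poly f (int t)" if "t \<in> T" for t using T1[OF that] by (simp add: g_def)
  have g_less: "g s < g t \<longleftrightarrow> s < t" if "s \<in> T" "t \<in> T" for s t
    using T_mono[OF that] T_mono[OF that(2,1)] g[OF that(1)] g[OF that(2)]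
    by (cases s t rule: linorder_cases) auto
  have injT: "inj_on g T" using g_less by (intro linorder_inj_onI') (metis less_irrefl)
  have D: "real (card {k \<in> A. a k + r \<in> a ` A}) \<le> ?D r" if "r \<ge> 1" for r
  proof -
    have "card {k \<in> A. a k + r \<in> a ` A} \<le> seq_pair_count a x r"
      unfolding seq_pair_count_def
    proof (rule card_mono)
      show "finite {n. 1 \<le> n \<and> real (a n) \<le> x \<and> a n + r \<in> a ` {1..}}"
        by (rule finite_subset[OF _ finite_pos_int_seq_le[OF a, of x]]) auto
      show "{k \<in> A. a k + r \<in> a ` A} \<subseteq> {n. 1 \<le> n \<and> real (a n) \<le> x \<and> a n + r \<in> a ` {1..}}"
        using x by (auto simp: A_def)
    qed
    then show ?thesis using pairs[OF that] by linarith
  qed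
  have M2: "(\<Sum>p\<in>A \<times> T. real (card {q \<in> A \<times> T. ?h q = ?h p}))
      \<le> real (card A) * real (card T) + 2 * (K4 * (x / e\<^sup>2)) * C * (real (card T))\<^sup>2"
  proof -
    have "(\<Sum>p\<in>A \<times> T. real (card {q \<in> A \<times> T. ?h q = ?h p}))
      \<le> real (card A) * real (card T) + 2 * (\<Sum>t\<in>T. \<Sum>s | s \<in> T \<and> g s < g t. ?D (g t - g s))"
      by (rule sumset_second_moment_le[OF finA injA T(1) injT D])
    also have "(\<Sum>t\<in>T. \<Sum>s | s \<in> T \<and> g s < g t. ?D (g t - g s)) \<le> (\<Sum>t\<in>T. (K4 * (x / e\<^sup>2)) * (C * real (card T)))"
    proof (rule sum_mono)
      fix t assume t: "t \<in> T"
      have "(\<Sum>s | s \<in> T \<and> g s < g t. ?D (g t - g s))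
          = (\<Sum>s | s \<in> T \<and> s < t. (K4 * (x / e\<^sup>2)) * (real (nat (poly f (int t) - poly f (int s)))
           / real (totient (nat (poly f (int t) - poly f (int s))))))"
      proof (intro sum.cong)
        show "{s. s \<in> T \<and> g s < g t} = {s. s \<in> T \<and> s < t}" using g_less t by blast
        fix s assume "s \<in> {s. s \<in> T \<and> s < t}"
        then have "g t - g s = nat (poly f (int t) - poly f (int s))"
          using g[of s] g[OF t] by simp
        then show "?D (g t - g s) = (K4 * (x / e\<^sup>2)) * (real (nat (poly f (int t) - poly f (int s)))
           / real (totient (nat (poly f (int t) - poly f (int s)))))" by (simp add: mult_ac)
      qed
      also have "\<dots> = (K4 * (x / e\<^sup>2)) * (\<Sum>s | s \<in> T \<and> s < t. real (nat (poly f (int t) - poly f (int s)))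
           / real (totient (nat (poly f (int t) - poly f (int s)))))"
        by (rule sum_distrib_left[symmetric])
      also have "\<dots> \<le> (K4 * (x / e\<^sup>2)) * (C * real (card T))"
        using T_sum[OF t] \<open>K4 > 0\<close> x by (intro mult_left_mono) auto
      finally show "(\<Sum>s | s \<in> T \<and> g s < g t. ?D (g t - g s)) \<le> (K4 * (x / e\<^sup>2)) * (C * real (card T))" .
    qed
    finally show ?thesis by (simp add: power2_eq_square mult_ac)
  qed
  let ?R = "{n::nat. n \<ge> 1 \<and> real n \<le> x \<and> real (rep_count a f n) \<ge> thr}"
  let ?G = "{n \<in> {1..X}. real (card (A \<times> T)) / (2 * x) \<le> real (card {p \<in> A \<times> T. ?h p = n})}"
  have "?G \<subseteq> ?R"
  proof
    fix n assume "n \<in> ?G"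
    then have n: "n \<in> {1..X}" "real (card (A \<times> T)) / (2 * x) \<le> real (card {p \<in> A \<times> T. ?h p = n})" by auto
    have "{p \<in> A \<times> T. ?h p = n} \<subseteq> {(k, s). k \<ge> 1 \<and> s \<in> sums_of_two_squares \<and> int (a k) + poly f (int s) = int n}"
      using T(2) g by (auto simp: A_def)
    then have "card {p \<in> A \<times> T. ?h p = n} \<le> rep_count a f n"
      unfolding rep_count_def by (intro card_mono finite_representations f a)
    then have "thr \<le> real (rep_count a f n)"
      using n(2) thr by (simp add: card_cartesian_product cardA)
    moreover have "real n \<le> x" using n(1) Xx(1) by (auto intro: order_trans[of _ "real X"])
    ultimately show "n \<in> ?R" using n(1) by simp
  qed
  moreover have "finite ?R" by (rule finite_subset[of _ "{..X}"]) (use Xx in auto)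
  ultimately have "card ?G \<le> card ?R" by (intro card_mono)
  have "(real (card (A \<times> T)))\<^sup>2 \<le> 4 * real (card ?G) * (\<Sum>p\<in>A \<times> T. real (card {q \<in> A \<times> T. ?h q = ?h p}))"
  proof (rule popular_values_card)
    fix p assume "p \<in> A \<times> T"
    then obtain k t where p: "p = (k,t)" "k \<in> A" "t \<in> T" by auto
    have "real (a k + g t) \<le> x"
    proof -
      have "real (g t) = of_int (poly f (int t))" using g[OF p(3)] by (metis of_int_of_nat_eq)
      then show ?thesis using T_le[OF p(3)] p(2) by (simp add: A_def)
    qed
    then have "a k + g t \<le> X" by (rule Xx(2))
    moreover have "g t \<ge> 1" using T1[OF p(3)] g[OF p(3)] by linarith
    ultimately show "1 \<le> ?h p \<and> ?h p \<le> X" using p by simp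
  qed (use finA T Xx x in auto)
  also have "\<dots> \<le> 4 * real (card ?R) * (\<Sum>p\<in>A \<times> T. real (card {q \<in> A \<times> T. ?h q = ?h p}))"
    using \<open>card ?G \<le> card ?R\<close> by (intro mult_right_mono mult_left_mono) (auto intro: sum_nonneg)
  also have "\<dots> \<le> 4 * real (card ?R) * (real (card A) * real (card T) + 2 * (K4 * (x / e\<^sup>2)) * C * (real (card T))\<^sup>2)"
    by (intro mult_left_mono M2) auto
  finally show ?thesis by (simp add: card_cartesian_product cardA)
qed

text \<open>Only \<open>f\<close> and \<open>x\<close> enter: the set is fixed before
  \<open>a\<close> and \<open>\<eta>\<close> are given. The bound x / 2 leaves the other half of x
  to the terms of the sequence.\<close>

definition spread_values :: "int poly \<Rightarrow> real \<Rightarrow> real \<Rightarrow> real \<Rightarrow> nat set \<Rightarrow> bool" where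
  "spread_values f c C x T \<longleftrightarrow> finite T \<and> T \<subseteq> sums_of_two_squares
     \<and> c * (x powr (1 / real (degree f)) / sqrt (ln x)) \<le> real (card T)
     \<and> (\<forall>t\<in>T. real_of_int (poly f (int t)) \<le> x / 2)
     \<and> (\<forall>s\<in>T. \<forall>t\<in>T. s < t \<longrightarrow> poly f (int s) < poly f (int t))
     \<and> (\<forall>t\<in>T. (\<Sum>s | s \<in> T \<and> s < t. real (nat (poly f (int t) - poly f (int s)))
           / real (totient (nat (poly f (int t) - poly f (int s))))) \<le> C * real (card T))"

lemma two_squares_with_spread_values:
  fixes f :: "int poly"
  assumes f: "degree f \<ge> 1" "lead_coeff f > 0" "\<forall>n::nat. n \<ge> 1 \<longrightarrow> poly f (int n) \<ge> 1"
  obtains x0 c C :: real where "x0 \<ge> 2" "c > 0" "C > 0"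
    "\<And>x. x \<ge> x0 \<Longrightarrow> \<exists>T. spread_values f c C x T"
proof -
  define d where "d = degree f"
  have d: "d \<ge> 1" using f by (simp add: d_def)
  obtain K :: nat and c1 C0 :: real where K: "K \<ge> 2" "c1 > 0" "C0 > 0"
    and T_exists: "\<And>N. N \<ge> 2 \<Longrightarrow> \<exists>T. well_distributed K c1 C0 N T"
    using well_distributed_two_squares by blast
  obtain B where B: "B > 0" "\<And>s::nat. s \<ge> 1 \<Longrightarrow> poly f (int s) \<le> int (B * s ^ d)"
    using int_poly_upper_bound[of f] unfolding d_def by blast
  obtain s0 where s0: "\<And>s t. s \<ge> s0 \<Longrightarrow> t \<ge> s \<Longrightarrow> poly f s + (t - s) \<le> poly f t"
    using int_poly_eventually_increasing[OF f(2)] f(1) by auto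
  \<comment> \<open>For t <= K N^2 the value f(t) is at most B (K N^2)^d = (E / 2) N^(2 d), hence at
    most x / 2 once N^(2 d) <= x / E.\<close>
  define E where "E = 2 * real B * real K ^ d"
  have E: "E \<ge> 2"
  proof -
    have "1 * 1 \<le> real B * real K ^ d" using B(1) K by (intro mult_mono one_le_power) auto
    then show ?thesis by (simp add: E_def)
  qed
  \<comment> \<open>Logarithms of differences are at most ln (E / 2) + 2 d ln N, and ln N <= 2 sqrt
    N gives the 4 d.\<close>
  define L where "L = \<bar>ln (E / 2)\<bar> + 4 * real d"
  have L: "L \<ge> 0" by (simp add: L_def)
  obtain C where C: "C > 0"
    "\<And>T N t M. finite T \<Longrightarrow> N \<ge> 1 \<Longrightarrow> real (card T) \<le> M \<Longrightarrow>
       (\<And>p b. prime p \<Longrightarrow> p \<le> N \<Longrightarrow> real (card {s \<in> T. s mod p = b}) \<le> C0 * (ln (real p) / real p) * M) \<Longrightarrow>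
       (\<And>s. s \<in> T \<Longrightarrow> 0 < poly f (int t) - poly f (int s) \<and> ln (poly f (int t) - poly f (int s)) \<le> L * sqrt (real N)) \<Longrightarrow>
       (\<Sum>s\<in>T. real (nat (poly f (int t) - poly f (int s))) / real (totient (nat (poly f (int t) - poly f (int s)))))
         \<le> C * M"
  proof (rule ratio_totient_difference_sum_le[OF f(1,2) L less_imp_le[OF K(3)]], goal_cases)
    case (1 C)
    from 1(2,3) show thesis by (rule that)
  qed
  \<comment> \<open>N >= N1 ensures N >= 2 and puts every t > N^2 beyond \<open>s0\<close>, where f
    is strictly increasing.\<close>
  define N1 where "N1 = 2 + nat \<bar>s0\<bar>"
  define x0 where "x0 = max 2 (E * real N1 powr (2 * real d))"
  \<comment> \<open>Rounding gives w <= 2 N, hence the 4; w^2 = (x / E) powr (1 / d) gives the power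
    of E.\<close>
  define c where "c = c1 / 4 * E powr (- 1 / real d)"
  have main: "\<exists>T. spread_values f c C x T"
    if x: "x \<ge> x0" for x
  proof -
    have x2: "x \<ge> 2" using x by (simp add: x0_def)
    define w where "w = (x / E) powr (1 / (2 * real d))"
    define N where "N = nat \<lfloor>w\<rfloor>"
    have xE: "x / E > 0" using x2 E by simp
    have "real N1 powr (2 * real d) \<le> x / E"
      using x E by (simp add: x0_def field_simps)
    then have "(real N1 powr (2 * real d)) powr (1 / (2 * real d)) \<le> w"
      unfolding w_def using d by (intro powr_mono2) auto
    then have w: "real N1 \<le> w" using d by (simp add: powr_powr N1_def)
    then have N1: "N1 \<le> N" unfolding N_def by (rule le_nat_floor)
    then have N2: "N \<ge> 2" by (simp add: N1_def)
    have Nw: "real N \<le> w" using w unfolding N_def by simp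
    have wN: "w \<le> 2 * real N"
    proof -
      have "w < real N + 1" unfolding N_def using w by linarith
      then show ?thesis using N2 by simp
    qed
    have wd: "w ^ (2 * d) = x / E"
    proof -
      have "w ^ (2 * d) = w powr real (2 * d)" using w N1_def by (subst powr_realpow) auto
      also have "\<dots> = x / E" unfolding w_def powr_powr using d x2 E by simp
      finally show ?thesis .
    qed
    have Nd: "real N ^ (2 * d) \<le> x / E" unfolding wd[symmetric] using Nw by (intro power_mono) auto
    have w2: "w\<^sup>2 = x powr (1 / real d) * E powr (- 1 / real d)"
    proof -
      have "w\<^sup>2 = w powr 2" using w N1_def by (subst powr_numeral) auto
      also have "\<dots> = (x / E) powr (1 / real d)" unfolding w_def powr_powr by simp
      also have "\<dots> = x powr (1 / real d) * E powr (- 1 / real d)"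
        using x2 E by (simp add: powr_divide powr_minus_divide)
      finally show ?thesis .
    qed
    obtain T where "well_distributed K c1 C0 N T" using T_exists[OF N2] by blast
    then have T': "finite T" "T \<subseteq> sums_of_two_squares" "\<forall>t\<in>T. N\<^sup>2 < t \<and> t \<le> K * N\<^sup>2"
      "c1 * real (N\<^sup>2) / sqrt (ln (real N)) \<le> real (card T)"
      "\<forall>p b. prime p \<longrightarrow> p \<le> N \<longrightarrow> real (card {t \<in> T. t mod p = b}) \<le> C0 * (ln (real p) / real p) * real (card T)"
      unfolding well_distributed_def by blast+
    note T = T'(1,2) T'(3)[rule_format] T'(4) T'(5)[rule_format]
    have f_le: "real_of_int (poly f (int t)) \<le> E / 2 * real N ^ (2 * d)" if t: "t \<in> T" for t
    proof -
      have "t \<ge> 1" using T(3)[OF t] by linarith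
      then have "real_of_int (poly f (int t)) \<le> real_of_int (int (B * t ^ d))" using B(2) by (simp only: of_int_le_iff)
      also have "\<dots> = real B * real t ^ d" by simp
      also have "\<dots> \<le> real B * (real K * (real N)\<^sup>2) ^ d"
      proof (intro mult_left_mono power_mono)
        have "real t \<le> real (K * N\<^sup>2)" using T(3)[OF t] by (simp only: of_nat_le_iff)
        then show "real t \<le> real K * (real N)\<^sup>2" by simp
      qed auto
      also have "\<dots> = E / 2 * real N ^ (2 * d)" by (simp add: E_def power_mult_distrib power_mult)
      finally show ?thesis .
    qed
    have f_half: "real_of_int (poly f (int t)) \<le> x / 2" if t: "t \<in> T" for t
    proof -
      have "E / 2 * real N ^ (2 * d) \<le> E / 2 * (x / E)" using Nd E by (intro mult_left_mono) auto
      also have "\<dots> = x / 2" using E by simp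
      finally show ?thesis using f_le[OF t] by simp
    qed
    have f_mono: "poly f (int s) < poly f (int t)" if "s \<in> T" "t \<in> T" "s < t" for s t
    proof -
      have "N \<le> N\<^sup>2" by (simp add: power2_eq_square)
      then have "int s \<ge> s0" using T(3)[OF that(1)] N1 unfolding N1_def by linarith
      then show ?thesis using s0[of "int s" "int t"] that(3) by simp
    qed
    have card_ge: "c * (x powr (1 / real d) / sqrt (ln x)) \<le> real (card T)"
    proof -
      have "real N ^ 1 \<le> real N ^ (2 * d)" using N2 d by (intro power_increasing) auto
      also have "\<dots> \<le> x / 1" using E x2 by (intro order_trans[OF Nd] divide_left_mono) auto
      finally have "real N \<le> x" by simp
      then have ln_le: "sqrt (ln (real N)) \<le> sqrt (ln x)" using N2 x2 by (subst real_sqrt_le_iff) auto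
      have lnN: "sqrt (ln (real N)) > 0" using N2 by simp
      have "c * (x powr (1 / real d) / sqrt (ln x)) = c1 * (w\<^sup>2 / 4) / sqrt (ln x)"
        by (simp add: c_def w2)
      also have "\<dots> \<le> c1 * real (N\<^sup>2) / sqrt (ln (real N))"
      proof (rule frac_le)
        have "w\<^sup>2 \<le> (2 * real N)\<^sup>2" using wN w by (intro power_mono) auto
        then have "w\<^sup>2 / 4 \<le> real (N\<^sup>2)" by (simp add: power_mult_distrib)
        then show "c1 * (w\<^sup>2 / 4) \<le> c1 * real (N\<^sup>2)" using K by (intro mult_left_mono) auto
      qed (use ln_le lnN K in auto)
      also have "\<dots> \<le> real (card T)" by (rule T(4))
      finally show ?thesis .
    qed
    have "(\<Sum>s | s \<in> T \<and> s < t. real (nat (poly f (int t) - poly f (int s)))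
            / real (totient (nat (poly f (int t) - poly f (int s))))) \<le> C * real (card T)" if t: "t \<in> T" for t
    proof (rule C(2)[of _ N])
      show "finite {s. s \<in> T \<and> s < t}" using T(1) by simp
      show "real (card {s. s \<in> T \<and> s < t}) \<le> real (card T)"
        using T(1) by (auto intro!: card_mono)
      show "1 \<le> N" using N2 by simp
    next
      fix p b :: nat assume p: "prime p" "p \<le> N"
      have "card {s \<in> {s. s \<in> T \<and> s < t}. s mod p = b} \<le> card {s \<in> T. s mod p = b}"
        using T(1) by (intro card_mono) auto
      then show "real (card {s \<in> {s. s \<in> T \<and> s < t}. s mod p = b}) \<le> C0 * (ln (real p) / real p) * real (card T)"
        using T(5)[OF p, of b] by linarith
    next
      fix s assume s: "s \<in> {s. s \<in> T \<and> s < t}"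
      then have lt: "poly f (int s) < poly f (int t)" using f_mono t by simp
      have "s \<ge> 1" using T(3)[of s] s by simp
      then have "poly f (int s) \<ge> 1" using f(3) by simp
      then have "real_of_int (poly f (int t) - poly f (int s)) \<le> E / 2 * real N ^ (2 * d)"
        using f_le[OF t] by simp
      then have "ln (real_of_int (poly f (int t) - poly f (int s))) \<le> ln (E / 2 * real N ^ (2 * d))"
        using lt E N2 by (subst ln_le_cancel_iff) auto
      also have "\<dots> = ln (E / 2) + ln (real N ^ (2 * d))"
        using E N2 by (intro ln_mult_pos) auto
      also have "ln (real N ^ (2 * d)) = 2 * real d * ln (real N)"
        using N2 by (simp add: ln_realpow)
      also have "ln (E / 2) + 2 * real d * ln (real N) \<le> \<bar>ln (E / 2)\<bar> * sqrt (real N) + 2 * real d * (2 * sqrt (real N))"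
      proof (intro add_mono mult_left_mono)
        have "sqrt 1 \<le> sqrt (real N)" using N2 by (subst real_sqrt_le_iff) auto
        then have "\<bar>ln (E / 2)\<bar> * 1 \<le> \<bar>ln (E / 2)\<bar> * sqrt (real N)" by (intro mult_left_mono) auto
        then show "ln (E / 2) \<le> \<bar>ln (E / 2)\<bar> * sqrt (real N)" by linarith
        show "ln (real N) \<le> 2 * sqrt (real N)"
          using ln_bound[of "sqrt (real N)"] N2 by (simp add: ln_sqrt)
      qed auto
      also have "\<dots> = L * sqrt (real N)" by (simp add: L_def algebra_simps)
      finally show "0 < poly f (int t) - poly f (int s) \<and> ln (real_of_int (poly f (int t) - poly f (int s))) \<le> L * sqrt (real N)"
        using lt by simp
    qed
    then have "spread_values f c C x T"
      using T(1,2) f_half f_mono card_ge unfolding spread_values_def d_def by blast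
    then show ?thesis ..
  qed
  have "x0 \<ge> 2" "c > 0" using K E by (auto simp: x0_def c_def)
  then show ?thesis using C(1) main by (rule that)
qed

theorem theorem1p8:
  fixes f :: "int poly" and K1 K2 K3 K4 :: real
  assumes "degree f \<ge> 1" and "lead_coeff f > 0"
    and "\<forall>n::nat. n \<ge> 1 \<longrightarrow> poly f (int n) \<ge> 1"
    and "K1 > 0" and "K2 > 0" and "K3 > 0" and "K4 > 0"
  shows "\<exists>x0 c1 c2 :: real. x0 > 0 \<and> c1 > 0 \<and> c2 > 0 \<and>
    (\<forall>(\<eta> :: real \<Rightarrow> real) (a :: nat \<Rightarrow> nat).
      (\<forall>x\<ge>2. \<eta> x > 0) \<longrightarrow>
      pos_int_seq a \<longrightarrow>
      (\<forall>x\<ge>2. K1 * x / \<eta> x \<le> real (seq_count a x) \<and> real (seq_count a x) \<le> K2 * x / \<eta> x) \<longrightarrow>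
      (\<forall>x\<ge>2. real (seq_count a (x / 2)) \<ge> K3 * real (seq_count a x)) \<longrightarrow>
      (\<forall>x\<ge>2. \<forall>r::nat. r \<ge> 1 \<longrightarrow>
         real (seq_pair_count a x r) \<le> K4 * (real r / real (totient r)) * (x / (\<eta> x)\<^sup>2)) \<longrightarrow>
      (\<forall>x\<ge>x0.
         real (card {n::nat. n \<ge> 1 \<and> real n \<le> x \<and>
           real (rep_count a f n) \<ge> c1 * (x powr (1 / real (degree f)) / (\<eta> x * sqrt (ln x)))})
         \<ge> c2 * x * (x powr (1 / real (degree f)) /
              (x powr (1 / real (degree f)) + \<eta> x * sqrt (ln x)))))"
proof -
  note f = assms(1-3) and Ks = assms(4-7)
  obtain x0 c C :: real where x0: "x0 \<ge> 2" and c: "c > 0" and C: "C > 0"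
    and T_exists: "\<And>x. x \<ge> x0 \<Longrightarrow> \<exists>T. spread_values f c C x T"
    using two_squares_with_spread_values[OF f] by blast
  \<comment> \<open>K2 bounds the diagonal part through the count up to x, and 2 K4 C is the
    off-diagonal coefficient.\<close>
  define Q where "Q = K2 + 2 * K4 * C"
  define k where "k = (K1 * K3)\<^sup>2 / (4 * Q)"
  \<comment> \<open>K1 K3 and c come from the lower bounds for the count up to x / 2 and for |T|;
    the 2 makes the threshold at most half the average.\<close>
  define c1 where "c1 = K1 * K3 * c / 2"
  define c2 where "c2 = k * min c 1"
  have Q: "Q > 0" using Ks C by (simp add: Q_def add_pos_pos)
  have k: "k > 0" using Ks Q by (simp add: k_def)
  have "c1 > 0" using Ks c by (simp add: c1_def)
  have "c2 > 0" using k c by (simp add: c2_def)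
  have main: "real (card {n::nat. n \<ge> 1 \<and> real n \<le> x \<and>
           real (rep_count a f n) \<ge> c1 * (x powr (1 / real (degree f)) / (\<eta> x * sqrt (ln x)))})
         \<ge> c2 * x * (x powr (1 / real (degree f)) /
              (x powr (1 / real (degree f)) + \<eta> x * sqrt (ln x)))"
    if eta: "\<forall>x\<ge>2. \<eta> x > 0" and a: "pos_int_seq a"
      and count: "\<forall>x\<ge>2. K1 * x / \<eta> x \<le> real (seq_count a x) \<and> real (seq_count a x) \<le> K2 * x / \<eta> x"
      and half: "\<forall>x\<ge>2. real (seq_count a (x / 2)) \<ge> K3 * real (seq_count a x)"
      and pairs: "\<forall>x\<ge>2. \<forall>r::nat. r \<ge> 1 \<longrightarrow>
         real (seq_pair_count a x r) \<le> K4 * (real r / real (totient r)) * (x / (\<eta> x)\<^sup>2)"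
      and x: "x \<ge> x0" for \<eta> a x
  proof -
    define e where "e = \<eta> x"
    define l where "l = sqrt (ln x)"
    define y where "y = x powr (1 / real (degree f))"
    define \<alpha> where "\<alpha> = real (seq_count a (x / 2))"
    have x2: "x \<ge> 2" using x x0 by simp
    have e: "e > 0" using eta x2 by (simp add: e_def)
    have l: "l > 0" using x2 by (simp add: l_def)
    have y: "y > 0" using x2 by (simp add: y_def)
    obtain T where "spread_values f c C x T" using T_exists[OF x] by blast
    then have T': "finite T" "T \<subseteq> sums_of_two_squares"
      "c * (y / l) \<le> real (card T)"
      "\<forall>t\<in>T. real_of_int (poly f (int t)) \<le> x / 2"
      "\<forall>s\<in>T. \<forall>t\<in>T. s < t \<longrightarrow> poly f (int s) < poly f (int t)"
      "\<forall>t\<in>T. (\<Sum>s | s \<in> T \<and> s < t. real (nat (poly f (int t) - poly f (int s)))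
            / real (totient (nat (poly f (int t) - poly f (int s))))) \<le> C * real (card T)"
      unfolding spread_values_def y_def l_def by blast+
    note T = T'(1-3) T'(4)[rule_format] T'(5)[rule_format] T'(6)[rule_format]
    define \<tau> where "\<tau> = real (card T)"
    have cyl: "c * (y / l) > 0" using c y l by simp
    then have \<tau>: "\<tau> > 0" "c * (y / l) \<le> \<tau>" using T(3) by (auto simp: \<tau>_def)
    have "seq_count a (x / 2) \<le> seq_count a x"
      unfolding seq_count_def using x2 finite_pos_int_seq_le[OF a, of x] by (intro card_mono) auto
    then have \<alpha>_le: "\<alpha> \<le> K2 * x / e"
      using count x2 unfolding \<alpha>_def e_def by (metis of_nat_le_iff order_trans)
    have \<alpha>_ge: "K1 * K3 * (x / e) \<le> \<alpha>"
    proof -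
      have "K3 * (K1 * x / e) \<le> K3 * real (seq_count a x)"
        using count x2 Ks unfolding e_def by (intro mult_left_mono) auto
      also have "\<dots> \<le> \<alpha>" using half x2 by (simp add: \<alpha>_def)
      finally show ?thesis by (simp add: mult_ac)
    qed
    define R where "R = real (card {n::nat. n \<ge> 1 \<and> real n \<le> x \<and> real (rep_count a f n) \<ge> c1 * (y / (e * l))})"
    have thr: "c1 * (y / (e * l)) \<le> \<alpha> * \<tau> / (2 * x)"
    proof -
      have "c1 * (y / (e * l)) = (K1 * K3 * (x / e)) * (c * (y / l)) / (2 * x)"
        using x2 e l by (simp add: c1_def)
      also have "\<dots> \<le> \<alpha> * \<tau> / (2 * x)"
        using \<alpha>_ge \<tau> cyl x2 e Ks by (intro divide_right_mono mult_mono) (auto simp: \<alpha>_def)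
      finally show ?thesis .
    qed
    have "(\<alpha> * \<tau>)\<^sup>2 \<le> 4 * R * (\<alpha> * \<tau> + 2 * (K4 * (x / e\<^sup>2)) * C * \<tau>\<^sup>2)"
      unfolding \<alpha>_def \<tau>_def R_def
      by (rule representations_second_moment[OF f a x2 _ Ks(4) e T(1,2,4,5,6)])
         (use pairs x2 thr in \<open>auto simp: e_def \<alpha>_def \<tau>_def\<close>)
    also have "\<dots> \<le> 4 * R * ((K2 * x / e) * \<tau> + 2 * (K4 * (x / e\<^sup>2)) * C * \<tau>\<^sup>2)"
      using \<alpha>_le \<tau> by (intro mult_left_mono add_right_mono mult_right_mono) (auto simp: R_def)
    also have "\<dots> = 4 * R * (x * \<tau> / e\<^sup>2) * (K2 * e + 2 * K4 * C * \<tau>)"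
      using e by (simp add: power2_eq_square field_simps)
    also have "\<dots> \<le> 4 * R * (x * \<tau> / e\<^sup>2) * (Q * (e + \<tau>))"
    proof (intro mult_left_mono)
      have "0 \<le> K2 * \<tau>" "0 \<le> 2 * K4 * C * e" using Ks C e \<tau> by auto
      then show "K2 * e + 2 * K4 * C * \<tau> \<le> Q * (e + \<tau>)" by (simp add: Q_def algebra_simps)
    qed (use x2 \<tau> in \<open>auto simp: R_def\<close>)
    finally have "(\<alpha> * \<tau>)\<^sup>2 \<le> 4 * R * (x * \<tau> / e\<^sup>2) * (Q * (e + \<tau>))" .
    moreover have "(K1 * K3 * (x / e) * \<tau>)\<^sup>2 \<le> (\<alpha> * \<tau>)\<^sup>2"
      using \<alpha>_ge \<tau> x2 e Ks by (intro power_mono mult_right_mono) auto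
    ultimately have "(K1 * K3 * (x / e) * \<tau>)\<^sup>2 \<le> 4 * R * (x * \<tau> / e\<^sup>2) * (Q * (e + \<tau>))" by linarith
    then have "(x * \<tau> / e\<^sup>2) * ((K1 * K3)\<^sup>2 * x * \<tau>) \<le> (x * \<tau> / e\<^sup>2) * (4 * R * Q * (e + \<tau>))"
      by (simp add: power2_eq_square mult_ac)
    moreover have "x * \<tau> / e\<^sup>2 > 0" using x2 \<tau> e by simp
    ultimately have "(K1 * K3)\<^sup>2 * x * \<tau> \<le> 4 * R * Q * (e + \<tau>)" by (simp only: mult_le_cancel_left_pos)
    then have R1: "k * x * (\<tau> / (e + \<tau>)) \<le> R"
    proof -
      have "k * x * (\<tau> / (e + \<tau>)) = ((K1 * K3)\<^sup>2 * x * \<tau>) / (4 * Q * (e + \<tau>))"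
        by (simp add: k_def)
      moreover have "4 * Q * (e + \<tau>) > 0" using Q e \<tau> by simp
      moreover have "(K1 * K3)\<^sup>2 * x * \<tau> \<le> R * (4 * Q * (e + \<tau>))"
        using \<open>(K1 * K3)\<^sup>2 * x * \<tau> \<le> 4 * R * Q * (e + \<tau>)\<close> by (simp only: mult_ac)
      ultimately show ?thesis by (simp only: pos_divide_le_eq)
    qed
    \<comment> \<open>z / (e + z) increases in z, and |T| >= c y / l. Capping c at 1 allows the same
      factor to be inserted in the denominator.\<close>
    have "min c 1 * (y / (y + e * l)) \<le> \<tau> / (e + \<tau>)"
    proof -
      have "min c 1 * (y / (y + e * l)) = (min c 1 * (y / l)) / (e + y / l)"
        using l by (simp add: field_simps)
      also have "\<dots> \<le> (min c 1 * (y / l)) / (e + min c 1 * (y / l))"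
      proof (intro divide_left_mono add_left_mono)
        show "min c 1 * (y / l) \<le> y / l" using y l mult_right_mono[of "min c 1" 1 "y / l"] by simp
        have "e + y / l > 0" "e + min c 1 * (y / l) > 0" using e y l c by (auto intro!: add_pos_pos)
        then show "0 < (e + y / l) * (e + min c 1 * (y / l))" by simp
      qed (use y l c in auto)
      also have "\<dots> \<le> \<tau> / (e + \<tau>)"
      proof -
        define z where "z = min c 1 * (y / l)"
        have "z \<le> c * (y / l)" unfolding z_def using y l by (intro mult_right_mono) auto
        then have "z \<le> \<tau>" using \<tau> by simp
        moreover have "z > 0" using y l c by (simp add: z_def)
        ultimately have "z / (e + z) \<le> \<tau> / (e + \<tau>)"
          using e by (simp add: divide_simps mult_right_mono algebra_simps)
        then show ?thesis by (simp add: z_def)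
      qed
      finally show ?thesis .
    qed
    then have "k * x * (min c 1 * (y / (y + e * l))) \<le> k * x * (\<tau> / (e + \<tau>))"
      using k x2 by (intro mult_left_mono) auto
    also note R1
    finally show ?thesis unfolding R_def c2_def y_def e_def l_def by (simp add: mult_ac)
  qed
  show ?thesis
  proof (rule exI[of _ x0], rule exI[of _ c1], rule exI[of _ c2], intro conjI allI impI)
    show "x0 > 0" using x0 by simp
    show "c1 > 0" "c2 > 0" by fact+
  qed (rule main)
qed

end
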